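(* Let $D=D_1\times\cdots\times D_n\subset\mathbb{C}^n$ be a bounded product domain, where each $D_j\subset\mathbb{C}$ is a domain with piecewise $C^1$ boundary. If $f\in\mathcal{B}$, then $\bar\partial(Tf)=f$ weakly on $D$, where $$T(f)=-\sum_{\emptyset\neq I\subset\{1,\dots,n\}}\bm{C}^{I}\left(f_{I}^{I^c}\right).$$
   Context: For a $(0,1)$-form $f=\sum_{j=1}^n f_j\,d\bar z_j$ on $D$ and a nonempty $I=\{i_1,\dots,i_l\}\subset\{1,\dots,n\}$, set $f_I=f_j$ if $I=\{j\}$ and $$f_I=\frac{\partial^{l-1}f_{i_1}}{\partial\bar\zeta_{i_2}\cdots\partial\bar\zeta_{i_l}}\quad\text{if } l>1,$$ with derivatives in the sense of distributions. When $\bar\partial f=0$ weakly, $f_I$ depends only on the set $I$, not on the ordering of its elements. $\mathcal{B}$ is the Banach space of $(0,1)$-forms $f$ on $D$ with $\bar\partial f=0$ weakly and $f_I\in L^1(D)$ for all nonempty $I\subset\{1,\dots,n\}$, with norm $\|f\|_{\mathcal B}=\sum_{I\ne\emptyset}\|f_I\|_{L^1(D)}$. $I^c=\{1,\dots,n\}\setminus I$. The superscript $I^c$ in $f_I^{I^c}$ means that the variables $z_j$, $j\in I^c$, are fixed (for a.e. value of these variables the resulting function of $(\zeta_i)_{i\in I}$ is in $L^1$ by Fubini), and $\bm{C}^I$ is the partial solid multi-Cauchy transform: for $I=\{i_1,\dots,i_l\}$, $$\bm{C}^I\left(f_I^{I^c}\right)(z)=\frac{1}{(2\pi i)^l}\int_{D_{i_1}\times\cdots\times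 D_{i_l}}\frac{f_I(w)\,d\bar\zeta_{i_1}\wedge d\zeta_{i_1}\wedge\cdots\wedge d\bar\zeta_{i_l}\wedge d\zeta_{i_l}}{(\zeta_{i_1}-z_{i_1})\cdots(\zeta_{i_l}-z_{i_l})},$$ where $w_i=\zeta_i$ for $i\in I$ and $w_j=z_j$ for $j\in I^c$; it is defined for a.e. $z\in D$. *)

theory Defs
  imports "HOL-Analysis.Analysis"
begin

section \<open>Planar domains with piecewise \<open>C\<^sup>1\<close> boundary and their products\<close>

text \<open>
  The boundary is a finite union of pairwise disjoint piecewise \<open>C\<^sup>1\<close> Jordan curves. That the
  domain lies on one side of each of them is automatic from connectedness.
\<close>

definition pw_C1_domain :: "complex set \<Rightarrow> bool" where
  "pw_C1_domain S \<longleftrightarrow> open S \<and> connected S \<and> S \<noteq> {} \<and>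
     (\<exists>\<Gamma>. finite \<Gamma> \<and>
          (\<forall>\<gamma>\<in>\<Gamma>. valid_path \<gamma> \<and> simple_path \<gamma> \<and> pathfinish \<gamma> = pathstart \<gamma>) \<and>
          pairwise (\<lambda>\<gamma> \<eta>. path_image \<gamma> \<inter> path_image \<eta> = {}) \<Gamma> \<and>
          frontier S = (\<Union>\<gamma>\<in>\<Gamma>. path_image \<gamma>))"

definition prod_domain :: "('n::finite \<Rightarrow> complex set) \<Rightarrow> (complex ^ 'n) set" where
  "prod_domain D = {z. \<forall>j. z $ j \<in> D j}"

section \<open>Test functions and distributional \<open>\<partial>/\<partial>(cnj z)\<close>-derivatives\<close>

text \<open>
  \<open>C\<^sup>k\<close> in the real sense, on a finite-dimensional space: differentiable everywhere, with every
  directional derivative of class \<open>C\<^bsup>k-1\<^esup>\<close>.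
\<close>

primrec Ck :: "nat \<Rightarrow> ('a::euclidean_space \<Rightarrow> 'b::real_normed_vector) \<Rightarrow> bool" where
  "Ck 0 \<phi> \<longleftrightarrow> continuous_on UNIV \<phi>"
| "Ck (Suc k) \<phi> \<longleftrightarrow> (\<forall>x. \<phi> differentiable (at x)) \<and>
     (\<forall>v. Ck k (\<lambda>x. frechet_derivative \<phi> (at x) v))"

definition test_fun :: "'a::euclidean_space set \<Rightarrow> ('a \<Rightarrow> complex) \<Rightarrow> bool" where
  "test_fun U \<phi> \<longleftrightarrow> (\<forall>k. Ck k \<phi>) \<and>
     compact (closure {x. \<phi> x \<noteq> 0}) \<and> closure {x. \<phi> x \<noteq> 0} \<subseteq> U"

definition locally_L1 :: "'a::euclidean_space set \<Rightarrow> ('a \<Rightarrow> complex) \<Rightarrow> bool" where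
  "locally_L1 U u \<longleftrightarrow> (\<forall>K. compact K \<and> K \<subseteq> U \<longrightarrow> u absolutely_integrable_on K)"

text \<open>
  The Wirtinger derivative \<open>\<partial>/\<partial>(cnj z\<^sub>j) = 1/2 (\<partial>/\<partial>x\<^sub>j + \<i> \<partial>/\<partial>y\<^sub>j)\<close>; the real directions \<open>x\<^sub>j\<close> and \<open>y\<^sub>j\<close>
  are \<open>axis j 1\<close> and \<open>axis j \<i>\<close>.
\<close>

definition dbar :: "'n::finite \<Rightarrow> (complex ^ 'n \<Rightarrow> complex) \<Rightarrow> complex ^ 'n \<Rightarrow> complex" where
  "dbar j \<phi> z = (frechet_derivative \<phi> (at z) (axis j 1)
                  + \<i> * frechet_derivative \<phi> (at z) (axis j \<i>)) / 2"

text \<open>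
  \<open>g\<close> is the iterated derivative of \<open>u\<close> in the directions \<open>js\<close>, on \<open>U\<close>, in the sense of
  distributions.
\<close>

definition weak_dbar ::
  "(complex ^ 'n::finite) set \<Rightarrow> 'n list \<Rightarrow> (complex ^ 'n \<Rightarrow> complex) \<Rightarrow> (complex ^ 'n \<Rightarrow> complex) \<Rightarrow> bool"
  where
  "weak_dbar U js u g \<longleftrightarrow> locally_L1 U u \<and> locally_L1 U g \<and>
     (\<forall>\<phi>. test_fun U \<phi> \<longrightarrow>
        (LINT z:U|lebesgue. g z * \<phi> z)
          = (-1) ^ length js * (LINT z:U|lebesgue. u z * foldr dbar js \<phi> z))"

section \<open>\<open>(0,1)\<close>-forms and the space \<open>\<B>\<close>\<close>

text \<open>
  A \<open>(0,1)\<close>-form \<open>f = \<Sum>\<^sub>j f\<^sub>j d(cnj z\<^sub>j)\<close> is given by its coefficients \<open>f j\<close>; only their values on the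
  domain matter.
\<close>

type_synonym 'n form01 = "'n \<Rightarrow> complex ^ 'n \<Rightarrow> complex"

text \<open>The equation \<open>dbar u = f\<close> for a function \<open>u\<close>, and \<open>dbar f = 0\<close> for a \<open>(0,1)\<close>-form \<open>f\<close>.\<close>

definition dbar_eq_weakly ::
  "(complex ^ 'n::finite) set \<Rightarrow> (complex ^ 'n \<Rightarrow> complex) \<Rightarrow> 'n form01 \<Rightarrow> bool" where
  "dbar_eq_weakly U u f \<longleftrightarrow> (\<forall>j. weak_dbar U [j] u (f j))"

definition dbar_closed_weakly :: "(complex ^ 'n::finite) set \<Rightarrow> 'n form01 \<Rightarrow> bool" where
  "dbar_closed_weakly U f \<longleftrightarrow> (\<forall>j. locally_L1 U (f j)) \<and>
     (\<forall>j k \<phi>. test_fun U \<phi> \<longrightarrow>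
        (LINT z:U|lebesgue. f j z * dbar k \<phi> z) = (LINT z:U|lebesgue. f k z * dbar j \<phi> z))"

text \<open>
  \<open>is_form_comp U f I g\<close>: the distribution \<open>f\<^sub>I\<close> is the function \<open>g\<close>. For \<open>card I > 1\<close> some enumeration
  \<open>i # js\<close> of \<open>I\<close> is used; for weakly closed \<open>f\<close> the choice is immaterial.
\<close>

definition is_form_comp ::
  "(complex ^ 'n::finite) set \<Rightarrow> 'n form01 \<Rightarrow> 'n set \<Rightarrow> (complex ^ 'n \<Rightarrow> complex) \<Rightarrow> bool" where
  "is_form_comp U f I g \<longleftrightarrow>
     (if is_singleton I then g = f (the_elem I)
      else \<exists>i js. distinct (i # js) \<and> set (i # js) = I \<and> weak_dbar U js (f i) g)"

definition space_B :: "(complex ^ 'n::finite) set \<Rightarrow> 'n form01 set" where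
  "space_B U = {f. dbar_closed_weakly U f \<and>
     (\<forall>I. I \<noteq> {} \<longrightarrow> (\<exists>g. is_form_comp U f I g \<and> g absolutely_integrable_on U))}"

text \<open>A representative of \<open>f\<^sub>I\<close>, unique up to null sets for \<open>f\<close> in \<open>\<B>\<close>.\<close>

definition form_comp :: "(complex ^ 'n::finite) set \<Rightarrow> 'n form01 \<Rightarrow> 'n set \<Rightarrow> complex ^ 'n \<Rightarrow> complex" where
  "form_comp U f I = (SOME g. is_form_comp U f I g \<and> g absolutely_integrable_on U)"

section \<open>The partial solid multi-Cauchy transform and the operator \<open>T\<close>\<close>

text \<open>
  As \<open>d(cnj \<zeta>) \<and> d\<zeta> = 2\<i> dx \<and> dy\<close>, the form
  \<open>d(cnj \<zeta>\<^sub>1) \<and> d\<zeta>\<^sub>1 \<and> \<dots> \<and> d(cnj \<zeta>\<^sub>l) \<and> d\<zeta>\<^sub>l\<close> is \<open>(2\<i>)\<^sup>l\<close> times Lebesgue measure on \<open>\<complex>\<^sup>l\<close>.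
  The measure is completed because for Lebesgue measurable \<open>g\<close> the sections are in general only
  Lebesgue measurable.
\<close>

definition cauchy_transform ::
  "('n::finite \<Rightarrow> complex set) \<Rightarrow> 'n set \<Rightarrow> (complex ^ 'n \<Rightarrow> complex) \<Rightarrow> complex ^ 'n \<Rightarrow> complex" where
  "cauchy_transform D I g z =
     1 / (2 * of_real pi * \<i>) ^ card I *
     (LINT \<zeta>:(\<Pi>\<^sub>E i\<in>I. D i)|completion (\<Pi>\<^sub>M i\<in>I. lborel).
        g (\<chi> i. if i \<in> I then \<zeta> i else z $ i) / (\<Prod>i\<in>I. \<zeta> i - z $ i) * (2 * \<i>) ^ card I)"

definition T_op :: "('n::finite \<Rightarrow> complex set) \<Rightarrow> 'n form01 \<Rightarrow> complex ^ 'n \<Rightarrow> complex" where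
  "T_op D f z = - (\<Sum>I | I \<noteq> {}. cauchy_transform D I (form_comp (prod_domain D) f I) z)"

end

theory Submission
  imports Defs
begin

text \<open>
  For a large radius \<open>R\<close> the transform \<open>C\<^sup>I\<close> is on the bounded domain convolution with the integrable
  kernel \<open>\<Prod>\<^sub>i \<kappa>(\<xi>\<^sub>i) / \<pi>\<close>, where \<open>\<kappa>(\<xi>) = 1 / \<xi>\<close> for \<open>\<bar>\<xi>\<bar> \<le> R\<close> and \<open>0\<close> otherwise. By Fubini and translation
  invariance \<open>\<integral> C\<^sup>I(f\<^sub>I) \<psi> = \<integral> f\<^sub>I \<Psi>\<^sub>I(\<psi>)\<close> with the reflected convolution \<open>\<Psi>\<^sub>I\<close>. Put \<open>a\<^sub>I = \<integral> f\<^sub>I \<Psi>\<^sub>I(dbar\<^sub>j \<phi>)\<close>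
  for a test function \<open>\<phi>\<close>. If \<open>j\<close> is not in \<open>I\<close>, the Cauchy--Pompeiu formula in the variable \<open>z\<^sub>j\<close> gives
  \<open>\<Psi>\<^bsub>I+j\<^esub>(dbar\<^sub>j \<phi>) = \<Psi>\<^sub>I(\<phi>)\<close>, while \<open>\<Psi>\<^sub>I(dbar\<^sub>j \<phi>) = dbar\<^sub>j \<Psi>\<^sub>I(\<phi>)\<close> and the weak identity
  \<open>dbar\<^sub>j f\<^sub>I = f\<^bsub>I+j\<^esub>\<close> give \<open>a\<^sub>I = - a\<^bsub>I+j\<^esub>\<close> for nonempty \<open>I\<close>. Hence all terms of
  \<open>- \<integral> T(f) dbar\<^sub>j \<phi> = \<Sum>\<^sub>I a\<^sub>I\<close> cancel except \<open>a\<^bsub>{j}\<^esub> = \<integral> f\<^sub>j \<phi>\<close>.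
\<close>

section \<open>Calculus of smooth functions\<close>

text \<open>Two features of the data shape the argument. First, f_I is merely Lebesgue measurable,
  so the integrands of Fubini need not be measurable for the product of the Borel measures. Each f_I
  is replaced by a Borel function on the whole space that vanishes almost everywhere off D, and the
  return to \<open>cauchy_transform\<close> holds for almost every z only. Second, f_I has no
  regularity, so all differentiation is moved to the test function: derivatives of \<Psi>_I(\<phi>)
  fall on \<phi>, and the kernel need only be integrable. R bounds the diameters of all D_i, so the
  truncation is invisible for differences of points of D while the kernel becomes integrable over
  the plane. The Cauchy--Pompeiu step therefore holds at points of D only, which suffices because
  f_I is extended by zero. Also, \<Psi>_I(\<phi>) is not a test function on D; the weak identity is
  applied to cut-off versions, followed by a limit. In the final sum the partner of {j} would be the
  empty set, which does not occur; hence {j} survives.\<close>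

lemma Ck_SucI:
  assumes "\<And>x. (\<phi> has_derivative \<phi>' x) (at x)" and "\<And>v. Ck k (\<lambda>x. \<phi>' x v)"
  shows "Ck (Suc k) \<phi>"
proof -
  have "frechet_derivative \<phi> (at x) = \<phi>' x" for x
    using frechet_derivative_at[OF assms(1)] by simp
  then show ?thesis
    using assms by (auto simp: differentiable_def)
qed

lemma Ck_has_derivative:
  "Ck (Suc k) \<phi> \<Longrightarrow> (\<phi> has_derivative frechet_derivative \<phi> (at x)) (at x)"
  by (simp add: frechet_derivative_works[symmetric])

lemma Ck_Suc_D: "Ck (Suc k) \<phi> \<Longrightarrow> Ck k \<phi>"
proof (induction k arbitrary: \<phi>)
  case 0
  then show ?case
    by (auto intro!: continuous_at_imp_continuous_on differentiable_imp_continuous_within)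
next
  case (Suc k)
  then show ?case by (metis Ck.simps(2))
qed

lemma Ck_continuous: "Ck k \<phi> \<Longrightarrow> continuous_on UNIV \<phi>"
  by (induction k) (auto dest: Ck_Suc_D simp del: Ck.simps(2))

lemma Ck_const [simp]: "Ck k (\<lambda>x. c)"
proof (induction k arbitrary: c)
  case (Suc k)
  show ?case by (rule Ck_SucI[where \<phi>' = "\<lambda>_ _. 0"]) (simp_all add: Suc)
qed simp

lemma Ck_add: "Ck k \<phi> \<Longrightarrow> Ck k \<psi> \<Longrightarrow> Ck k (\<lambda>x. \<phi> x + \<psi> x)"
proof (induction k arbitrary: \<phi> \<psi>)
  case (Suc k)
  show ?case
  proof (rule Ck_SucI)
    show "((\<lambda>x. \<phi> x + \<psi> x) has_derivative
        (\<lambda>v. frechet_derivative \<phi> (at x) v + frechet_derivative \<psi> (at x) v)) (at x)" for x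
      using Suc.prems by (intro has_derivative_add Ck_has_derivative)
  qed (use Suc in auto)
qed (auto intro: continuous_intros)

lemma Ck_bounded_linear: "bounded_linear L \<Longrightarrow> Ck k \<phi> \<Longrightarrow> Ck k (\<lambda>x. L (\<phi> x))"
proof (induction k arbitrary: \<phi>)
  case 0
  then show ?case by (auto intro: bounded_linear.continuous_on)
next
  case (Suc k)
  show ?case
  proof (rule Ck_SucI)
    show "((\<lambda>x. L (\<phi> x)) has_derivative (\<lambda>v. L (frechet_derivative \<phi> (at x) v))) (at x)" for x
      by (rule bounded_linear.has_derivative[OF Suc.prems(1) Ck_has_derivative[OF Suc.prems(2)]])
    show "Ck k (\<lambda>x. L (frechet_derivative \<phi> (at x) v))" for v
      using Suc.prems by (intro Suc.IH) simp_all
  qed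
qed

lemma Ck_mult:
  fixes \<phi> \<psi> :: "'a::euclidean_space \<Rightarrow> 'b::real_normed_algebra"
  shows "Ck k \<phi> \<Longrightarrow> Ck k \<psi> \<Longrightarrow> Ck k (\<lambda>x. \<phi> x * \<psi> x)"
proof (induction k arbitrary: \<phi> \<psi>)
  case (Suc k)
  show ?case
  proof (rule Ck_SucI)
    show "((\<lambda>x. \<phi> x * \<psi> x) has_derivative
        (\<lambda>v. \<phi> x * frechet_derivative \<psi> (at x) v + frechet_derivative \<phi> (at x) v * \<psi> x)) (at x)" for x
      using Suc.prems by (intro has_derivative_mult Ck_has_derivative)
    show "Ck k (\<lambda>x. \<phi> x * frechet_derivative \<psi> (at x) v + frechet_derivative \<phi> (at x) v * \<psi> x)" for v
      using Suc.prems Ck_Suc_D[OF Suc.prems(1)] Ck_Suc_D[OF Suc.prems(2)]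
      by (intro Ck_add Suc.IH) simp_all
  qed
qed (auto intro: continuous_intros)

lemma Ck_prod:
  fixes \<phi> :: "'i \<Rightarrow> 'a::euclidean_space \<Rightarrow> 'b::{real_normed_algebra, comm_ring_1}"
  shows "(\<And>i. i \<in> A \<Longrightarrow> Ck k (\<phi> i)) \<Longrightarrow> Ck k (\<lambda>x. \<Prod>i\<in>A. \<phi> i x)"
  by (induction A rule: infinite_finite_induct) (simp_all add: Ck_mult)

lemma Ck_power:
  fixes \<phi> :: "'a::euclidean_space \<Rightarrow> 'b::{real_normed_algebra, comm_ring_1}"
  shows "Ck k \<phi> \<Longrightarrow> Ck k (\<lambda>x. \<phi> x ^ m)"
  by (induction m) (simp_all add: Ck_mult)

lemma Ck_minus: "Ck k \<phi> \<Longrightarrow> Ck k (\<lambda>x. - \<phi> x)"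
  by (intro Ck_bounded_linear[of uminus] bounded_linear_minus bounded_linear_ident)

lemma Ck_diff: "Ck k \<phi> \<Longrightarrow> Ck k \<psi> \<Longrightarrow> Ck k (\<lambda>x. \<phi> x - \<psi> x)"
  using Ck_add[of k \<phi> "\<lambda>x. - \<psi> x"] Ck_minus[of k \<psi>] by simp

text \<open>Smoothness without a support condition: \<Psi>_I(\<phi>) is smooth but in general has no
  compact support in D, so \<open>test_fun\<close> is too narrow for it.\<close>

definition smooth :: "('a::euclidean_space \<Rightarrow> 'b::real_normed_vector) \<Rightarrow> bool" where
  "smooth \<phi> \<longleftrightarrow> (\<forall>k. Ck k \<phi>)"

lemma smooth_imp_Ck: "smooth \<phi> \<Longrightarrow> Ck k \<phi>"
  by (simp add: smooth_def)

lemma smooth_continuous: "smooth \<phi> \<Longrightarrow> continuous_on UNIV \<phi>"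
  by (meson Ck_continuous smooth_imp_Ck)

lemma smooth_has_derivative:
  "smooth \<phi> \<Longrightarrow> (\<phi> has_derivative frechet_derivative \<phi> (at x)) (at x)"
  by (meson Ck_has_derivative smooth_imp_Ck)

lemma smooth_frechet_derivative:
  "smooth \<phi> \<Longrightarrow> smooth (\<lambda>x. frechet_derivative \<phi> (at x) v)"
  unfolding smooth_def by (metis Ck.simps(2))

lemma smooth_mult:
  fixes \<phi> \<psi> :: "'a::euclidean_space \<Rightarrow> 'b::real_normed_algebra"
  shows "smooth \<phi> \<Longrightarrow> smooth \<psi> \<Longrightarrow> smooth (\<lambda>x. \<phi> x * \<psi> x)"
  by (simp add: smooth_def Ck_mult)

text \<open>The mean value inequality along v, applied to the increment in direction w, brings in
  only the derivative \<open>A\<close> of \<open>\<lambda>y. \<phi>' y v\<close> at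
  \<open>x\<close>. The second difference itself is symmetric in v and w, and this is what gives the
  symmetry of second derivatives.\<close>

lemma mixed_difference_bound:
  fixes \<phi> :: "'a::euclidean_space \<Rightarrow> 'b::real_normed_vector"
  assumes D: "\<And>x. (\<phi> has_derivative \<phi>' x) (at x)"
    and A: "((\<lambda>y. \<phi>' y v) has_derivative A) (at x)" and e: "e > 0"
  shows "\<exists>d>0. \<forall>h. 0 < h \<and> h < d \<longrightarrow>
    norm (\<phi> (x + h *\<^sub>R v + h *\<^sub>R w) - \<phi> (x + h *\<^sub>R v) - \<phi> (x + h *\<^sub>R w) + \<phi> x - (h * h) *\<^sub>R A w)
      \<le> e * (h * h)"
proof -
  \<comment> \<open>The displacements s v + h w and s v, with 0 \<le> s \<le> h, have total length
    at most h (2 |v| + |w|); the summand 1 keeps \<open>C\<close> positive when v and w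
    vanish.\<close>
  define C where "C = 2 * norm v + norm w + 1"
  have C: "C > 0" by (simp add: C_def add_nonneg_pos)
  interpret A: bounded_linear A using A by (rule has_derivative_bounded_linear)
  obtain d where d: "d > 0"
    and db: "\<And>y. norm (y - x) < d \<Longrightarrow> norm (\<phi>' y v - \<phi>' x v - A (y - x)) \<le> (e / C) * norm (y - x)"
    using A e C unfolding has_derivative_at_alt by (metis divide_pos_pos)
  show ?thesis
  proof (intro exI[of _ "d / C"] conjI allI impI)
    show "d / C > 0" using d C by simp
    fix h :: real assume h: "0 < h \<and> h < d / C"
    then have h0: "h > 0" and hd: "h * C < d" using C by (auto simp: field_simps)
    \<comment> \<open>\<open>g h - g 0\<close> is the second difference minus its expected value,
      and subtracting the linear term makes the derivative of \<open>g\<close> of size e h.\<close>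
    define g where "g s = \<phi> (x + s *\<^sub>R v + h *\<^sub>R w) - \<phi> (x + s *\<^sub>R v) - (s * h) *\<^sub>R A w" for s
    define g' where "g' s t = \<phi>' (x + s *\<^sub>R v + h *\<^sub>R w) (t *\<^sub>R v) - \<phi>' (x + s *\<^sub>R v) (t *\<^sub>R v) - (t * h) *\<^sub>R A w" for s t
    have "norm (g h - g 0) \<le> e * h * norm (h - 0)"
    proof (rule differentiable_bound[of "{0..h}" g g'])
      fix s assume s: "s \<in> {0..h}"
      show "(g has_derivative g' s) (at s within {0..h})"
        unfolding g_def g'_def
        by (rule has_derivative_at_withinI, (rule derivative_eq_intros has_derivative_compose[OF _ D] | simp)+)
      have lin: "\<phi>' y (t *\<^sub>R v) = t *\<^sub>R \<phi>' y v" for y t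
        using has_derivative_linear[OF D, of y] by (simp add: linear_cmul)
      have n1: "norm (s *\<^sub>R v + h *\<^sub>R w) \<le> h * (norm v + norm w)"
        using s h0 by (intro order_trans[OF norm_triangle_ineq]) (auto simp: algebra_simps intro!: mult_right_mono)
      have n2: "norm (s *\<^sub>R v) \<le> h * norm v"
        using s h0 by (auto intro!: mult_right_mono)
      have lt: "h * (norm v + norm w) < d" "h * norm v < d"
        using h0 by (auto simp: C_def intro!: le_less_trans[OF mult_left_mono hd])
      have b1: "norm (\<phi>' (x + s *\<^sub>R v + h *\<^sub>R w) v - \<phi>' x v - A (s *\<^sub>R v + h *\<^sub>R w)) \<le> (e / C) * (h * (norm v + norm w))"
        using db[of "x + s *\<^sub>R v + h *\<^sub>R w"] n1 lt(1) mult_left_mono[OF n1, of "e / C"] e C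
        by (auto simp: add.assoc)
      have b2: "norm (\<phi>' (x + s *\<^sub>R v) v - \<phi>' x v - A (s *\<^sub>R v)) \<le> (e / C) * (h * norm v)"
        using db[of "x + s *\<^sub>R v"] n2 lt(2) mult_left_mono[OF n2, of "e / C"] e C
        by (auto simp del: norm_scaleR)
      have "norm (\<phi>' (x + s *\<^sub>R v + h *\<^sub>R w) v - \<phi>' (x + s *\<^sub>R v) v - h *\<^sub>R A w)
        = norm ((\<phi>' (x + s *\<^sub>R v + h *\<^sub>R w) v - \<phi>' x v - A (s *\<^sub>R v + h *\<^sub>R w)) - (\<phi>' (x + s *\<^sub>R v) v - \<phi>' x v - A (s *\<^sub>R v)))"
        by (simp add: A.add A.scaleR algebra_simps)
      also have "\<dots> \<le> (e / C) * (h * (norm v + norm w)) + (e / C) * (h * norm v)"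
        using norm_triangle_ineq4 b1 b2 by (meson add_mono order_trans)
      also have "\<dots> = (e / C) * h * (2 * norm v + norm w)" by (simp add: algebra_simps)
      also have "\<dots> \<le> (e / C) * h * C" using e C h0 by (intro mult_left_mono) (auto simp: C_def)
      also have "\<dots> = e * h" using C by simp
      finally have fin: "norm (\<phi>' (x + s *\<^sub>R v + h *\<^sub>R w) v - \<phi>' (x + s *\<^sub>R v) v - h *\<^sub>R A w) \<le> e * h" .
      show "onorm (g' s) \<le> e * h"
      proof (rule onorm_le)
        fix t
        have "g' s t = t *\<^sub>R (\<phi>' (x + s *\<^sub>R v + h *\<^sub>R w) v - \<phi>' (x + s *\<^sub>R v) v - h *\<^sub>R A w)"
          by (simp add: g'_def lin algebra_simps)
        then show "norm (g' s t) \<le> e * h * norm t"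
          using fin mult_left_mono[OF fin, of "\<bar>t\<bar>"] by (simp add: mult.commute)
      qed
    qed (use h0 in auto)
    then show "norm (\<phi> (x + h *\<^sub>R v + h *\<^sub>R w) - \<phi> (x + h *\<^sub>R v) - \<phi> (x + h *\<^sub>R w) + \<phi> x - (h * h) *\<^sub>R A w) \<le> e * (h * h)"
      using h0 by (simp add: g_def algebra_simps)
  qed
qed

text \<open>The same second difference is expanded in both orders of v and w, and the two expansions
  are compared after division by h^2.\<close>

lemma frechet_derivative_commute:
  fixes \<phi> :: "'a::euclidean_space \<Rightarrow> 'b::real_normed_vector"
  assumes "smooth \<phi>"
  shows "frechet_derivative (\<lambda>y. frechet_derivative \<phi> (at y) v) (at x) w
       = frechet_derivative (\<lambda>y. frechet_derivative \<phi> (at y) w) (at x) v" (is "?a = ?b")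
proof -
  note D = smooth_has_derivative[OF assms]
  note D2 = smooth_has_derivative[OF smooth_frechet_derivative[OF assms]]
  have "norm (?a - ?b) \<le> e" if e: "e > 0" for e
  proof -
    have e2: "e / 2 > 0" using e by simp
    obtain d1 where d1: "d1 > 0" "\<And>h. 0 < h \<Longrightarrow> h < d1 \<Longrightarrow>
      norm (\<phi> (x + h *\<^sub>R v + h *\<^sub>R w) - \<phi> (x + h *\<^sub>R v) - \<phi> (x + h *\<^sub>R w) + \<phi> x - (h * h) *\<^sub>R ?a) \<le> e / 2 * (h * h)"
      using mixed_difference_bound[OF D D2 e2, of x v w] by blast
    obtain d2 where d2: "d2 > 0" "\<And>h. 0 < h \<Longrightarrow> h < d2 \<Longrightarrow>
      norm (\<phi> (x + h *\<^sub>R w + h *\<^sub>R v) - \<phi> (x + h *\<^sub>R w) - \<phi> (x + h *\<^sub>R v) + \<phi> x - (h * h) *\<^sub>R ?b) \<le> e / 2 * (h * h)"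
      using mixed_difference_bound[OF D D2 e2, of x w v] by blast
    define h where "h = min d1 d2 / 2"
    have h: "0 < h" "h < d1" "h < d2" using d1(1) d2(1) by (auto simp: h_def)
    let ?L = "\<phi> (x + h *\<^sub>R v + h *\<^sub>R w) - \<phi> (x + h *\<^sub>R v) - \<phi> (x + h *\<^sub>R w) + \<phi> x"
    have "norm ((h * h) *\<^sub>R (?a - ?b)) = norm ((?L - (h * h) *\<^sub>R ?b) - (?L - (h * h) *\<^sub>R ?a))"
      by (simp add: algebra_simps)
    also have "\<dots> \<le> e / 2 * (h * h) + e / 2 * (h * h)"
      using d1(2)[OF h(1,2)] d2(2)[OF h(1,3)]
      by (intro order_trans[OF norm_triangle_ineq4 add_mono]) (simp_all add: algebra_simps)
    finally have "(h * h) * norm (?a - ?b) \<le> (h * h) * e" by (simp add: mult.commute)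
    then show ?thesis by (rule mult_left_le_imp_le) (use h(1) in simp)
  qed
  then have "norm (?a - ?b) \<le> 0"
    by (metis add.left_neutral field_le_epsilon)
  then show ?thesis by simp
qed

section \<open>Commuting Wirtinger derivatives\<close>

lemma smooth_dbar: "smooth \<phi> \<Longrightarrow> smooth (dbar j \<phi>)"
proof -
  assume s: "smooth \<phi>"
  have "Ck k (\<lambda>z. (1 / 2) * (frechet_derivative \<phi> (at z) (axis j 1) + \<i> * frechet_derivative \<phi> (at z) (axis j \<i>)))" for k
    by (intro Ck_mult Ck_add Ck_const smooth_imp_Ck smooth_frechet_derivative s)
  then show ?thesis by (simp add: smooth_def dbar_def[abs_def])
qed

lemma dbar_commute:
  assumes "smooth \<phi>"
  shows "dbar j (dbar k \<phi>) = dbar k (dbar j \<phi>)"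
proof
  fix z
  let ?F = "\<lambda>\<psi> v z. frechet_derivative \<psi> (at z) v"
  note D = smooth_has_derivative[OF smooth_frechet_derivative[OF assms]]
  have F: "?F (dbar k \<phi>) v z
      = (?F (?F \<phi> (axis k 1)) v z + \<i> * ?F (?F \<phi> (axis k \<i>)) v z) / 2" for k v
  proof -
    have "(dbar k \<phi> has_derivative
        (\<lambda>v. (?F (?F \<phi> (axis k 1)) v z + \<i> * ?F (?F \<phi> (axis k \<i>)) v z) / 2)) (at z)"
      unfolding dbar_def[abs_def]
      by (intro bounded_linear.has_derivative[OF bounded_linear_divide] has_derivative_add
          has_derivative_mult_right D)
    from frechet_derivative_at[OF this, symmetric] show ?thesis by simp
  qed
  have e: "dbar j (dbar k \<phi>) z = (?F (dbar k \<phi>) (axis j 1) z + \<i> * ?F (dbar k \<phi>) (axis j \<i>) z) / 2"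
    "dbar k (dbar j \<phi>) z = (?F (dbar j \<phi>) (axis k 1) z + \<i> * ?F (dbar j \<phi>) (axis k \<i>) z) / 2"
    by (simp_all only: dbar_def)
  show "dbar j (dbar k \<phi>) z = dbar k (dbar j \<phi>) z"
    unfolding e F
    unfolding frechet_derivative_commute[OF assms, of "axis k 1" z] frechet_derivative_commute[OF assms, of "axis k \<i>" z]
    by (simp add: algebra_simps add_divide_distrib)
qed

lemma smooth_foldr_dbar: "smooth \<phi> \<Longrightarrow> smooth (foldr dbar js \<phi>)"
  by (induction js) (auto intro: smooth_dbar)

lemma foldr_dbar_remove1:
  assumes "smooth \<phi>" "j \<in> set js"
  shows "foldr dbar js \<phi> = dbar j (foldr dbar (remove1 j js) \<phi>)"
  using assms(2)
proof (induction js)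
  case (Cons k js)
  then show ?case
    using dbar_commute[OF smooth_foldr_dbar[OF assms(1)], of k j "remove1 j js"] by auto
qed simp

text \<open>\<open>is_form_comp\<close> fixes some unknown enumeration of I, so iterated derivatives
  in different orders have to be compared.\<close>

lemma foldr_dbar_perm:
  assumes "smooth \<phi>" "distinct js" "distinct ks" "set js = set ks"
  shows "foldr dbar js \<phi> = foldr dbar ks \<phi>"
  using assms(2-4)
proof (induction js arbitrary: ks)
  case (Cons j js)
  then have "foldr dbar ks \<phi> = dbar j (foldr dbar (remove1 j ks) \<phi>)"
    by (intro foldr_dbar_remove1 assms(1)) auto
  also have "foldr dbar (remove1 j ks) \<phi> = foldr dbar js \<phi>"
    using Cons by (intro Cons.IH[symmetric]) auto
  finally show ?case by simp
qed simp

section \<open>Convolution with an integrable kernel\<close>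

lemma frechet_derivative_outside_support:
  assumes "smooth \<phi>" "x \<notin> closure {x. \<phi> x \<noteq> 0}"
  shows "frechet_derivative \<phi> (at x) v = 0"
proof -
  have "((\<lambda>x. 0) has_derivative (\<lambda>v. 0)) (at x)" by simp
  then have "(\<phi> has_derivative (\<lambda>v. 0)) (at x)"
  proof (rule has_derivative_transform_within_open)
    show "open (- closure {x. \<phi> x \<noteq> 0})" by auto
    show "0 = \<phi> y" if "y \<in> - closure {x. \<phi> x \<noteq> 0}" for y
      using that closure_subset[of "{x. \<phi> x \<noteq> 0}"] by auto
  qed (use assms in auto)
  from frechet_derivative_at[OF this] show ?thesis by metis
qed

lemma support_frechet_derivative:
  "smooth \<phi> \<Longrightarrow> {x. frechet_derivative \<phi> (at x) v \<noteq> 0} \<subseteq> closure {x. \<phi> x \<noteq> 0}"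
  using frechet_derivative_outside_support by blast

lemma bounded_support_frechet_derivative:
  "smooth \<phi> \<Longrightarrow> bounded {x. \<phi> x \<noteq> 0} \<Longrightarrow> bounded {x. frechet_derivative \<phi> (at x) v \<noteq> 0}"
  using support_frechet_derivative bounded_closure bounded_subset by metis

lemma bounded_support_uniformly_continuous:
  fixes \<phi> :: "'a::euclidean_space \<Rightarrow> 'b::real_normed_vector"
  assumes "continuous_on UNIV \<phi>" "bounded {x. \<phi> x \<noteq> 0}"
  shows "uniformly_continuous_on UNIV \<phi>"
proof -
  obtain R where R: "\<And>x. \<phi> x \<noteq> 0 \<Longrightarrow> norm x \<le> R"
    using assms(2) by (auto simp: bounded_iff)
  \<comment> \<open>Radius R + 1 rather than R: a point within distance 1 of the support then lies
    in the same compact ball.\<close>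
  have u: "uniformly_continuous_on (cball 0 (R + 1)) \<phi>"
    by (intro compact_uniformly_continuous continuous_on_subset[OF assms(1)]) auto
  show ?thesis
    unfolding uniformly_continuous_on_def
  proof safe
    fix e :: real assume e: "e > 0"
    obtain d where d: "d > 0" "\<And>x y. x \<in> cball 0 (R + 1) \<Longrightarrow> y \<in> cball 0 (R + 1) \<Longrightarrow> dist y x < d \<Longrightarrow> dist (\<phi> y) (\<phi> x) < e"
      using u e unfolding uniformly_continuous_on_def by meson
    show "\<exists>d>0. \<forall>x\<in>UNIV. \<forall>x'\<in>UNIV. dist x' x < d \<longrightarrow> dist (\<phi> x') (\<phi> x) < e"
    proof (intro exI[of _ "min d 1"] conjI ballI impI)
      fix x y :: 'a assume xy: "dist y x < min d 1"
      show "dist (\<phi> y) (\<phi> x) < e"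
      proof (cases "\<phi> x = 0 \<and> \<phi> y = 0")
        case False
        then have "norm x \<le> R \<or> norm y \<le> R" using R by blast
        moreover have "norm x \<le> norm y + 1" "norm y \<le> norm x + 1"
          using xy norm_triangle_ineq2[of x y] norm_triangle_ineq2[of y x]
          by (auto simp: dist_norm norm_minus_commute)
        ultimately show ?thesis using xy d(2)[of x y] by auto
      qed (use e in auto)
    qed (use d in auto)
  qed
qed

lemma bounded_support_bounded:
  fixes \<phi> :: "'a::euclidean_space \<Rightarrow> 'b::real_normed_vector"
  assumes "continuous_on UNIV \<phi>" "bounded {x. \<phi> x \<noteq> 0}"
  obtains B where "\<And>x. norm (\<phi> x) \<le> B" "B \<ge> 0"
proof -
  have "compact (\<phi> ` closure {x. \<phi> x \<noteq> 0})"
    using assms by (intro compact_continuous_image continuous_on_subset[OF assms(1)]) (auto simp: compact_closure)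
  then obtain B where B: "\<And>x. x \<in> closure {x. \<phi> x \<noteq> 0} \<Longrightarrow> norm (\<phi> x) \<le> B"
    by (metis bounded_iff compact_imp_bounded imageI)
  have "norm (\<phi> x) \<le> max B 0" for x
    using B[of x] closure_subset[of "{x. \<phi> x \<noteq> 0}"] by (cases "\<phi> x = 0") (auto simp: le_max_iff_disj)
  then show ?thesis using that[of "max B 0"] by auto
qed

text \<open>The remainder is small uniformly in the base point because every directional derivative
  is uniformly continuous. This uniformity allows differentiation under an integral against a merely
  integrable kernel.\<close>

lemma uniform_derivative:
  fixes \<phi> :: "'a::euclidean_space \<Rightarrow> 'b::real_normed_vector"
  assumes "smooth \<phi>" "bounded {x. \<phi> x \<noteq> 0}" "e > 0"
  obtains d where "d > 0"
    "\<And>x h. norm h < d \<Longrightarrow> norm (\<phi> (x + h) - \<phi> x - frechet_derivative \<phi> (at x) h) \<le> e * norm h"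
proof -
  let ?D = "\<lambda>x. frechet_derivative \<phi> (at x)"
  \<comment> \<open>The operator norm of a difference of derivatives is estimated by its values on
    the basis vectors, each of which gets an equal share of e.\<close>
  define c where "c = e / DIM('a)"
  have c: "c > 0" using assms(3) by (simp add: c_def)
  have "\<exists>d>0. \<forall>x y. dist y x < d \<longrightarrow> norm (?D y b - ?D x b) < c" for b
    using bounded_support_uniformly_continuous[OF smooth_continuous[OF smooth_frechet_derivative[OF assms(1)]]
        bounded_support_frechet_derivative[OF assms(1,2)], of b] c
    unfolding uniformly_continuous_on_def by (auto simp: dist_norm)
  then obtain \<delta> where \<delta>: "\<And>b. \<delta> b > 0" "\<And>b x y. dist y x < \<delta> b \<Longrightarrow> norm (?D y b - ?D x b) < c"
    by metis
  define d where "d = Min (\<delta> ` (Basis :: 'a set))"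
  have d: "d > 0" "\<And>b. b \<in> Basis \<Longrightarrow> d \<le> \<delta> b"
    using \<delta>(1) by (auto simp: d_def)
  have lin: "linear (?D x)" for x
    using smooth_has_derivative[OF assms(1)] by (rule has_derivative_linear)
  have on: "onorm (?D y - ?D x) \<le> e" if xy: "dist y x < d" for x y
  proof (rule onorm_le)
    fix h
    have l: "linear (?D y - ?D x)" unfolding fun_diff_def by (intro linear_compose_sub lin)
    have "(?D y - ?D x) h = (\<Sum>b\<in>Basis. (h \<bullet> b) *\<^sub>R (?D y - ?D x) b)"
      using linear_sum[OF l, of "\<lambda>b. (h \<bullet> b) *\<^sub>R b" Basis]
      by (simp only: euclidean_representation linear_cmul[OF l])
    also have "norm \<dots> \<le> (\<Sum>b\<in>(Basis :: 'a set). norm h * c)"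
    proof (rule sum_norm_le)
      fix b :: 'a assume b: "b \<in> Basis"
      have "norm ((?D y - ?D x) b) \<le> c"
        using \<delta>(2)[of y x b] d(2)[OF b] xy by simp
      then show "norm ((h \<bullet> b) *\<^sub>R (?D y - ?D x) b) \<le> norm h * c"
        unfolding norm_scaleR using Basis_le_norm[OF b, of h] by (intro mult_mono) auto
    qed
    also have "\<dots> = e * norm h" by (simp add: c_def)
    finally show "norm ((?D y - ?D x) h) \<le> e * norm h" .
  qed
  show ?thesis
  proof (rule that[OF d(1)])
    fix x h :: 'a assume h: "norm h < d"
    have "norm (\<phi> (x + h) - \<phi> x - ?D x (x + h - x)) \<le> norm (x + h - x) * e"
    proof (rule differentiable_bound_linearization[where S = "ball x d" and f' = ?D and ?x0.0 = x])
      show "x + t *\<^sub>R (x + h - x) \<in> ball x d" if "t \<in> {0..1}" for t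
        using that h mult_right_mono[of t 1 "norm h"] by (auto simp: dist_norm)
      show "(\<phi> has_derivative ?D y) (at y within ball x d)" for y
        by (rule has_derivative_at_withinI[OF smooth_has_derivative[OF assms(1)]])
      show "onorm (?D y - ?D x) \<le> e" if "y \<in> ball x d" for y
        using that on by (auto simp: dist_commute)
    qed (use d in auto)
    then show "norm (\<phi> (x + h) - \<phi> x - ?D x h) \<le> e * norm h"
      by (simp only: add_diff_cancel_left' mult.commute)
  qed
qed

section \<open>Differentiation under the integral sign\<close>

lemma integrable_conv:
  fixes \<phi> :: "'a::euclidean_space \<Rightarrow> complex"
  assumes "continuous_on UNIV \<phi>" "bounded {x. \<phi> x \<noteq> 0}"
    and "integrable \<mu> k" "\<iota> \<in> borel_measurable \<mu>"
  shows "integrable \<mu> (\<lambda>\<xi>. k \<xi> * \<phi> (w - \<iota> \<xi>))"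
proof -
  obtain B where B: "\<And>x. norm (\<phi> x) \<le> B" "B \<ge> 0"
    using bounded_support_bounded[OF assms(1,2)] by metis
  have [measurable]: "\<phi> \<in> borel_measurable borel" "k \<in> borel_measurable \<mu>" "\<iota> \<in> borel_measurable \<mu>"
    using assms by (auto intro: borel_measurable_continuous_onI)
  show ?thesis
  proof (rule Bochner_Integration.integrable_bound)
    show "integrable \<mu> (\<lambda>\<xi>. B * norm (k \<xi>))" using assms(3) by auto
    show "AE \<xi> in \<mu>. norm (k \<xi> * \<phi> (w - \<iota> \<xi>)) \<le> norm (B * norm (k \<xi>))"
      using B by (auto simp: norm_mult mult.commute[of B] intro!: mult_left_mono AE_I2)
  qed measurable
qed

text \<open>Integrated against \<open>k\<close>, the uniform remainder of \<phi> is at most its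
  bound times the L1 norm of \<open>k\<close>. The general \<open>\<mu>\<close> and
  \<open>\<iota>\<close> serve two uses: product measures with \<open>\<iota> = embed I\<close> for
  the dual potentials, and Lebesgue measure with \<open>\<iota>\<close> the negation for integrals
  of derivatives.\<close>

lemma conv_has_derivative:
  fixes \<phi> :: "'a::euclidean_space \<Rightarrow> complex"
  assumes \<phi>: "smooth \<phi>" "bounded {x. \<phi> x \<noteq> 0}"
    and k: "integrable \<mu> k" and \<iota>: "\<iota> \<in> borel_measurable \<mu>"
  shows "((\<lambda>w. \<integral>\<xi>. k \<xi> * \<phi> (w - \<iota> \<xi>) \<partial>\<mu>) has_derivative
          (\<lambda>v. \<integral>\<xi>. k \<xi> * frechet_derivative \<phi> (at (w - \<iota> \<xi>)) v \<partial>\<mu>)) (at w)"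
proof -
  let ?D = "\<lambda>x. frechet_derivative \<phi> (at x)"
  let ?K = "\<integral>\<xi>. norm (k \<xi>) \<partial>\<mu>"
  have i0: "integrable \<mu> (\<lambda>\<xi>. k \<xi> * \<phi> (w - \<iota> \<xi>))" for w
    by (intro integrable_conv smooth_continuous assms)
  have i1: "integrable \<mu> (\<lambda>\<xi>. k \<xi> * ?D (w - \<iota> \<xi>) v)" for w v
    by (rule integrable_conv[of "\<lambda>x. ?D x v"])
      (intro smooth_continuous smooth_frechet_derivative bounded_support_frechet_derivative assms)+
  have lin: "linear (?D x)" for x
    using smooth_has_derivative[OF assms(1)] by (rule has_derivative_linear)
  have K: "?K \<ge> 0" "?K + 1 > 0" by (simp_all add: add_nonneg_pos)
  show ?thesis
    unfolding has_derivative_at_alt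
  proof (intro conjI allI impI)
    show "bounded_linear (\<lambda>v. \<integral>\<xi>. k \<xi> * ?D (w - \<iota> \<xi>) v \<partial>\<mu>)"
      unfolding linear_conv_bounded_linear[symmetric]
      by (rule linearI) (use i1 in \<open>simp_all add: linear_add[OF lin] linear_cmul[OF lin] distrib_left\<close>)
    fix e :: real assume e: "e > 0"
    \<comment> \<open>The L1 norm \<open>?K\<close> may be zero; \<open>?K + 1\<close> avoids the
      division by zero.\<close>
    then have "e / (?K + 1) > 0" using K(2) by (rule divide_pos_pos)
    from uniform_derivative[OF \<phi> this] obtain d where d: "d > 0"
      "\<And>x h. norm h < d \<Longrightarrow> norm (\<phi> (x + h) - \<phi> x - ?D x h) \<le> e / (?K + 1) * norm h" by metis
    show "\<exists>d>0. \<forall>y. norm (y - w) < d \<longrightarrow>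
      norm ((\<integral>\<xi>. k \<xi> * \<phi> (y - \<iota> \<xi>) \<partial>\<mu>) - (\<integral>\<xi>. k \<xi> * \<phi> (w - \<iota> \<xi>) \<partial>\<mu>)
         - (\<integral>\<xi>. k \<xi> * ?D (w - \<iota> \<xi>) (y - w) \<partial>\<mu>)) \<le> e * norm (y - w)"
    proof (intro exI[of _ d] conjI allI impI d(1))
      fix y assume y: "norm (y - w) < d"
      let ?r = "\<lambda>\<xi>. \<phi> (y - \<iota> \<xi>) - \<phi> (w - \<iota> \<xi>) - ?D (w - \<iota> \<xi>) (y - w)"
      have r: "norm (?r \<xi>) \<le> e / (?K + 1) * norm (y - w)" for \<xi>
        using d(2)[OF y, of "w - \<iota> \<xi>"] by (simp add: algebra_simps)
      have "norm ((\<integral>\<xi>. k \<xi> * \<phi> (y - \<iota> \<xi>) \<partial>\<mu>) - (\<integral>\<xi>. k \<xi> * \<phi> (w - \<iota> \<xi>) \<partial>\<mu>)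
         - (\<integral>\<xi>. k \<xi> * ?D (w - \<iota> \<xi>) (y - w) \<partial>\<mu>)) = norm (\<integral>\<xi>. k \<xi> * ?r \<xi> \<partial>\<mu>)"
        using i0 i1 by (simp add: right_diff_distrib)
      also have "\<dots> \<le> (\<integral>\<xi>. norm (k \<xi>) * (e / (?K + 1) * norm (y - w)) \<partial>\<mu>)"
      proof (rule order_trans[OF integral_norm_bound integral_mono])
        show "integrable \<mu> (\<lambda>\<xi>. norm (k \<xi> * ?r \<xi>))"
          using i0 i1 by (simp add: right_diff_distrib)
        show "integrable \<mu> (\<lambda>\<xi>. norm (k \<xi>) * (e / (?K + 1) * norm (y - w)))"
          using k by simp
        show "norm (k \<xi> * ?r \<xi>) \<le> norm (k \<xi>) * (e / (?K + 1) * norm (y - w))" for \<xi>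
          unfolding norm_mult by (intro mult_left_mono r) simp
      qed
      also have "\<dots> = ?K * (e / (?K + 1) * norm (y - w))" by simp
      also have "\<dots> = (?K / (?K + 1)) * (e * norm (y - w))" by simp
      also have "\<dots> \<le> 1 * (e * norm (y - w))"
        using K e by (intro mult_right_mono) (simp_all add: divide_le_eq_1 not_less less_imp_le)
      finally show "norm ((\<integral>\<xi>. k \<xi> * \<phi> (y - \<iota> \<xi>) \<partial>\<mu>) - (\<integral>\<xi>. k \<xi> * \<phi> (w - \<iota> \<xi>) \<partial>\<mu>)
         - (\<integral>\<xi>. k \<xi> * ?D (w - \<iota> \<xi>) (y - w) \<partial>\<mu>)) \<le> e * norm (y - w)" by simp
    qed
  qed
qed

lemma conv_frechet_derivative:
  fixes \<phi> :: "'a::euclidean_space \<Rightarrow> complex"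
  assumes "smooth \<phi>" "bounded {x. \<phi> x \<noteq> 0}" "integrable \<mu> k" "\<iota> \<in> borel_measurable \<mu>"
  shows "frechet_derivative (\<lambda>w. \<integral>\<xi>. k \<xi> * \<phi> (w - \<iota> \<xi>) \<partial>\<mu>) (at w) v
       = (\<integral>\<xi>. k \<xi> * frechet_derivative \<phi> (at (w - \<iota> \<xi>)) v \<partial>\<mu>)"
  by (metis frechet_derivative_at[OF conv_has_derivative[OF assms]])

lemma smooth_conv:
  fixes \<phi> :: "'a::euclidean_space \<Rightarrow> complex"
  assumes "smooth \<phi>" "bounded {x. \<phi> x \<noteq> 0}" "integrable \<mu> k" "\<iota> \<in> borel_measurable \<mu>"
  shows "smooth (\<lambda>w. \<integral>\<xi>. k \<xi> * \<phi> (w - \<iota> \<xi>) \<partial>\<mu>)"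
  unfolding smooth_def
proof
  fix m show "Ck m (\<lambda>w. \<integral>\<xi>. k \<xi> * \<phi> (w - \<iota> \<xi>) \<partial>\<mu>)"
    using assms(1,2)
  proof (induction m arbitrary: \<phi>)
    case 0
    show ?case
      using conv_has_derivative[OF 0 assms(3,4)]
      by (auto intro!: continuous_at_imp_continuous_on has_derivative_continuous)
  next
    case (Suc m)
    show ?case
      by (rule Ck_SucI[OF conv_has_derivative[OF Suc.prems assms(3,4)]])
        (intro Suc.IH smooth_frechet_derivative bounded_support_frechet_derivative Suc.prems)
  qed
qed

lemma dbar_conv:
  fixes \<phi> :: "complex ^ 'n::finite \<Rightarrow> complex"
  assumes \<phi>: "smooth \<phi>" "bounded {x. \<phi> x \<noteq> 0}"
    and k: "integrable \<mu> k" "\<iota> \<in> borel_measurable \<mu>"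
  shows "dbar j (\<lambda>w. \<integral>\<xi>. k \<xi> * \<phi> (w - \<iota> \<xi>) \<partial>\<mu>) w = (\<integral>\<xi>. k \<xi> * dbar j \<phi> (w - \<iota> \<xi>) \<partial>\<mu>)"
proof -
  have i1: "integrable \<mu> (\<lambda>\<xi>. k \<xi> * frechet_derivative \<phi> (at (w - \<iota> \<xi>)) v)" for v
    by (rule integrable_conv[of "\<lambda>x. frechet_derivative \<phi> (at x) v"])
      (intro smooth_continuous smooth_frechet_derivative bounded_support_frechet_derivative assms)+
  have "(\<integral>\<xi>. k \<xi> * dbar j \<phi> (w - \<iota> \<xi>) \<partial>\<mu>)
    = (\<integral>\<xi>. (k \<xi> * frechet_derivative \<phi> (at (w - \<iota> \<xi>)) (axis j 1)
        + \<i> * (k \<xi> * frechet_derivative \<phi> (at (w - \<iota> \<xi>)) (axis j \<i>))) / 2 \<partial>\<mu>)"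
    by (simp add: dbar_def algebra_simps)
  also have "\<dots> = dbar j (\<lambda>w. \<integral>\<xi>. k \<xi> * \<phi> (w - \<iota> \<xi>) \<partial>\<mu>) w"
    unfolding dbar_def[of j "\<lambda>w. \<integral>\<xi>. k \<xi> * \<phi> (w - \<iota> \<xi>) \<partial>\<mu>"] conv_frechet_derivative[OF assms]
    using i1 by simp
  finally show ?thesis by simp
qed

section \<open>Stability of test functions\<close>

lemma test_fun_smooth: "test_fun U \<phi> \<Longrightarrow> smooth \<phi>"
  by (simp add: test_fun_def smooth_def)

lemma test_fun_bounded_support: "test_fun U \<phi> \<Longrightarrow> bounded {x. \<phi> x \<noteq> 0}"
  unfolding test_fun_def using bounded_subset closure_subset compact_imp_bounded by metis

lemma test_fun_outside: "test_fun U \<phi> \<Longrightarrow> x \<notin> U \<Longrightarrow> \<phi> x = 0"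
  unfolding test_fun_def using closure_subset[of "{x. \<phi> x \<noteq> 0}"] by auto

lemma dbar_outside_support: "smooth \<phi> \<Longrightarrow> x \<notin> closure {x. \<phi> x \<noteq> 0} \<Longrightarrow> dbar j \<phi> x = 0"
  by (simp add: dbar_def frechet_derivative_outside_support)

lemma test_fun_dbar: "test_fun U \<phi> \<Longrightarrow> test_fun U (dbar j \<phi>)"
proof -
  assume t: "test_fun U \<phi>"
  have "{x. dbar j \<phi> x \<noteq> 0} \<subseteq> closure {x. \<phi> x \<noteq> 0}"
    using dbar_outside_support[OF test_fun_smooth[OF t]] by blast
  then have "closure {x. dbar j \<phi> x \<noteq> 0} \<subseteq> closure {x. \<phi> x \<noteq> 0}"
    by (simp add: closure_minimal)
  with t smooth_dbar[OF test_fun_smooth[OF t]] show ?thesis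
    unfolding test_fun_def smooth_def compact_eq_bounded_closed
    by (meson closed_closure bounded_subset order_trans)
qed

section \<open>Smooth cutoff functions\<close>

lemma has_derivative_affine:
  "bounded_linear L \<Longrightarrow> ((\<lambda>x. a + L x) has_derivative L) (at x)"
  using has_derivative_add[OF has_derivative_const bounded_linear_imp_has_derivative] by fastforce

lemma Ck_compose_affine:
  assumes "bounded_linear L"
  shows "Ck k \<phi> \<Longrightarrow> Ck k (\<lambda>x. \<phi> (a + L x))"
proof (induction k arbitrary: \<phi>)
  case 0
  have "continuous_on UNIV (\<lambda>x. a + L x)"
    by (rule continuous_on_add[OF continuous_on_const linear_continuous_on[OF assms]])
  with 0 show ?case
    using continuous_on_compose2[of UNIV \<phi> UNIV "\<lambda>x. a + L x"] by simp
next
  case (Suc k)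
  show ?case
  proof (rule Ck_SucI)
    show "((\<lambda>x. \<phi> (a + L x)) has_derivative (\<lambda>v. frechet_derivative \<phi> (at (a + L x)) (L v))) (at x)" for x
      by (rule has_derivative_compose[OF has_derivative_affine[OF assms] Ck_has_derivative[OF Suc.prems]])
    show "Ck k (\<lambda>x. frechet_derivative \<phi> (at (a + L x)) (L v))" for v
      using Suc.prems by (intro Suc.IH) simp
  qed
qed

lemma Ck_inverse:
  fixes \<phi> :: "'a::euclidean_space \<Rightarrow> 'b::real_normed_field"
  assumes "\<And>x. \<phi> x \<noteq> 0"
  shows "Ck k \<phi> \<Longrightarrow> Ck k (\<lambda>x. inverse (\<phi> x))"
proof (induction k)
  case 0
  then show ?case using assms by (auto intro: continuous_on_inverse)
next
  case (Suc k)
  show ?case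
  proof (rule Ck_SucI)
    show "((\<lambda>x. inverse (\<phi> x)) has_derivative
        (\<lambda>v. - (inverse (\<phi> x) * frechet_derivative \<phi> (at x) v * inverse (\<phi> x)))) (at x)" for x
      by (rule Deriv.has_derivative_inverse[OF assms Ck_has_derivative[OF Suc.prems]])
    show "Ck k (\<lambda>x. - (inverse (\<phi> x) * frechet_derivative \<phi> (at x) v * inverse (\<phi> x)))" for v
      using Suc.IH[OF Ck_Suc_D[OF Suc.prems]] Suc.prems by (intro Ck_minus Ck_mult) simp_all
  qed
qed

text \<open>The classical exp(-1/t), extended by 0. Carrying a polynomial in 1/t makes the family
  closed under differentiation, so that smoothness, also at 0, follows by an induction in which the
  polynomial varies.\<close>

definition flat :: "real poly \<Rightarrow> real \<Rightarrow> real" where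
  "flat p t = (if t > 0 then poly p (1 / t) * exp (- (1 / t)) else 0)"

lemma flat_tendsto_0: "(flat p \<longlongrightarrow> 0) (at 0)"
proof -
  have "((\<lambda>x. \<Sum>i\<le>degree p. coeff p i * (x ^ i / exp x)) \<longlongrightarrow> (\<Sum>i\<le>degree p. coeff p i * 0)) at_top"
    by (intro tendsto_intros tendsto_power_div_exp_0)
  then have "((\<lambda>x. poly p x * exp (- x)) \<longlongrightarrow> 0) at_top"
    by (simp add: poly_altdef sum_distrib_right exp_minus divide_inverse mult.assoc)
  then have "((\<lambda>t. poly p (inverse t) * exp (- inverse t)) \<longlongrightarrow> 0) (at_right 0)"
    by (rule filterlim_compose[OF _ filterlim_inverse_at_top_right])
  then have "(flat p \<longlongrightarrow> 0) (at_right 0)"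
    by (rule Lim_transform_eventually) (auto simp: flat_def eventually_at_filter inverse_eq_divide)
  moreover have "(flat p \<longlongrightarrow> 0) (at_left 0)"
    by (rule Lim_transform_eventually[OF tendsto_const]) (auto simp: flat_def eventually_at_filter)
  ultimately show ?thesis by (simp add: filterlim_split_at)
qed

text \<open>In s = 1/t the derivative d/dt is -s^2 d/ds, which sends p(s) exp(-s) to s^2 (p - p')(s)
  exp(-s).\<close>

lemma DERIV_flat: "(flat p has_real_derivative flat ([:0, 0, 1:] * (p - pderiv p)) t) (at t)"
proof -
  consider "t > 0" | "t < 0" | "t = 0" by linarith
  then show ?thesis
  proof cases
    case 1
    have "((\<lambda>t. poly p (1 / t) * exp (- (1 / t))) has_real_derivative flat ([:0, 0, 1:] * (p - pderiv p)) t) (at t)"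
      using 1 by (auto intro!: derivative_eq_intros DERIV_chain2[OF poly_DERIV]
          simp: flat_def field_simps power2_eq_square)
    then show ?thesis
      by (rule has_field_derivative_transform_within_open[of _ _ _ "{0<..}"]) (use 1 in \<open>auto simp: flat_def\<close>)
  next
    case 2
    have "((\<lambda>t. 0) has_real_derivative flat ([:0, 0, 1:] * (p - pderiv p)) t) (at t)"
      using 2 by (simp add: flat_def)
    then show ?thesis
      by (rule has_field_derivative_transform_within_open[of _ _ _ "{..<0}"]) (use 2 in \<open>auto simp: flat_def\<close>)
  next
    case 3
    \<comment> \<open>The difference quotient at 0 is itself a member of the family, with one more
      factor 1/h, so its limit is already known.\<close>
    have "(\<lambda>h. (flat p h - flat p 0) / h) = flat ([:0, 1:] * p)"
      by (rule ext) (simp add: flat_def)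
    then have "((\<lambda>h. (flat p h - flat p 0) / h) \<longlongrightarrow> 0) (at 0)"
      using flat_tendsto_0 by (simp only:)
    then show ?thesis
      unfolding 3 DERIV_def by (simp add: flat_def)
  qed
qed

lemma Ck_flat_affine:
  assumes "bounded_linear L"
  shows "Ck k (\<lambda>x. complex_of_real (flat p (a + L x)))"
proof (induction k arbitrary: p)
  case 0
  have "continuous_on UNIV (flat p)"
    by (intro DERIV_continuous_on[OF DERIV_subset[OF DERIV_flat]]) auto
  moreover have "continuous_on UNIV (\<lambda>x. a + L x)"
    by (rule continuous_on_add[OF continuous_on_const linear_continuous_on[OF assms]])
  ultimately have "continuous_on UNIV (\<lambda>x. flat p (a + L x))"
    using continuous_on_compose2[of UNIV "flat p" UNIV "\<lambda>x. a + L x"] by blast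
  then show ?case by (simp add: continuous_on_of_real)
next
  case (Suc k)
  let ?q = "[:0, 0, 1:] * (p - pderiv p)"
  show ?case
  proof (rule Ck_SucI)
    from has_derivative_compose[OF has_derivative_affine[OF assms] DERIV_flat[unfolded has_field_derivative_def]]
    show "((\<lambda>x. complex_of_real (flat p (a + L x))) has_derivative
        (\<lambda>v. complex_of_real (flat ?q (a + L x)) * of_real (L v))) (at x)" for x
      by (auto intro!: derivative_eq_intros)
    show "Ck k (\<lambda>x. complex_of_real (flat ?q (a + L x)) * of_real (L v))" for v
      by (intro Ck_mult Suc Ck_const)
  qed
qed

lemma flat_1_bounds: "0 \<le> flat 1 t" "flat 1 t \<le> 1" "0 < flat 1 t \<longleftrightarrow> 0 < t"
  by (auto simp: flat_def)

text \<open>The factors are exp(-1/t) of the distances to the faces. Nothing is normalised: only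
  smoothness, values in [0,1] and positivity exactly on the open box enter the cutoffs.\<close>

definition box_bump :: "'a::euclidean_space \<Rightarrow> 'a \<Rightarrow> 'a \<Rightarrow> real" where
  "box_bump a c x = (\<Prod>b\<in>Basis. flat 1 (x \<bullet> b - a \<bullet> b) * flat 1 (c \<bullet> b - x \<bullet> b))"

lemma box_bump_nonneg: "0 \<le> box_bump a c x"
  unfolding box_bump_def by (intro prod_nonneg mult_nonneg_nonneg flat_1_bounds ballI)

lemma box_bump_le_1: "box_bump a c x \<le> 1"
  unfolding box_bump_def by (intro prod_le_1 conjI mult_nonneg_nonneg mult_le_one flat_1_bounds)

lemma box_bump_pos_iff: "0 < box_bump a c x \<longleftrightarrow> x \<in> box a c"
proof -
  have "0 < box_bump a c x \<longleftrightarrow> box_bump a c x \<noteq> 0"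
    using box_bump_nonneg[of a c x] by auto
  also have "\<dots> \<longleftrightarrow> (\<forall>b\<in>Basis. flat 1 (x \<bullet> b - a \<bullet> b) \<noteq> 0 \<and> flat 1 (c \<bullet> b - x \<bullet> b) \<noteq> 0)"
    by (simp add: box_bump_def)
  also have "\<dots> \<longleftrightarrow> x \<in> box a c"
    by (auto simp: flat_def mem_box)
  finally show ?thesis .
qed

lemma Ck_box_bump: "Ck k (\<lambda>x. complex_of_real (box_bump a c x))"
proof -
  have "Ck k (\<lambda>x. complex_of_real (flat 1 (x \<bullet> b - a \<bullet> b)))" for b
    using Ck_flat_affine[OF bounded_linear_inner_left, of k 1 "- (a \<bullet> b)" b] by simp
  moreover have "Ck k (\<lambda>x. complex_of_real (flat 1 (c \<bullet> b - x \<bullet> b)))" for b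
    using Ck_flat_affine[OF bounded_linear_minus[OF bounded_linear_inner_left], of k 1 "c \<bullet> b" b] by simp
  ultimately show ?thesis
    unfolding box_bump_def of_real_prod of_real_mult by (intro Ck_prod Ck_mult)
qed

text \<open>The closed boxes are kept inside the set because finite unions of them will be the
  compact supports of the cutoffs.\<close>

lemma open_countable_Union_boxes:
  fixes \<Omega> :: "'a::euclidean_space set"
  assumes "open \<Omega>" "\<Omega> \<noteq> {}"
  obtains a c :: "nat \<Rightarrow> 'a" where "\<And>m. cbox (a m) (c m) \<subseteq> \<Omega>" "(\<Union>m. box (a m) (c m)) = \<Omega>"
proof -
  define \<F> where "\<F> = {S. \<exists>a c. S = box a c \<and> cbox a c \<subseteq> \<Omega>}"
  have "\<Union>\<F> = \<Omega>"
  proof (intro equalityI subsetI)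
    show "x \<in> \<Omega>" if "x \<in> \<Union>\<F>" for x
      using that box_subset_cbox by (fastforce simp: \<F>_def)
    show "x \<in> \<Union>\<F>" if "x \<in> \<Omega>" for x
      using open_contains_cbox[OF assms(1) that] by (metis (mono_tags, lifting) UnionI \<F>_def mem_Collect_eq)
  qed
  obtain \<G> where \<G>: "\<G> \<subseteq> \<F>" "countable \<G>" "\<Union>\<G> = \<Union>\<F>"
    by (rule Lindelof[of \<F>]) (auto simp: \<F>_def)
  have ne: "\<G> \<noteq> {}" using \<G>(3) \<open>\<Union>\<F> = \<Omega>\<close> assms(2) by auto
  have "from_nat_into \<G> m \<in> \<F>" for m
    using from_nat_into[OF ne] \<G>(1) by blast
  then obtain a c where ac: "\<And>m. from_nat_into \<G> m = box (a m) (c m)" "\<And>m. cbox (a m) (c m) \<subseteq> \<Omega>"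
    unfolding \<F>_def by simp metis
  have "(\<Union>m. box (a m) (c m)) = \<Omega>"
    using range_from_nat_into[OF ne \<G>(2)] \<G>(3) \<open>\<Union>\<F> = \<Omega>\<close> by (simp flip: ac(1))
  with ac(2) that show ?thesis by blast
qed

text \<open>The cutoffs will be removed by dominated convergence, so the uniform bound 1 and
  pointwise convergence to 1 are the properties aimed at.\<close>

lemma smooth_cutoff_sequence:
  fixes \<Omega> :: "'a::euclidean_space set"
  assumes "open \<Omega>"
  obtains \<eta> :: "nat \<Rightarrow> 'a \<Rightarrow> complex" and K
  where "\<And>k. smooth (\<eta> k)" "\<And>k x. norm (\<eta> k x) \<le> 1"
    "\<And>k. compact (K k)" "\<And>k. K k \<subseteq> \<Omega>" "\<And>k x. \<eta> k x \<noteq> 0 \<Longrightarrow> x \<in> K k"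
    "\<And>x. x \<in> \<Omega> \<Longrightarrow> (\<lambda>k. \<eta> k x) \<longlonglongrightarrow> 1"
proof (cases "\<Omega> = {}")
  case True
  then show ?thesis
    using that[of "\<lambda>_ _. 0" "\<lambda>_. {}"] by (simp add: smooth_def)
next
  case False
  obtain a c :: "nat \<Rightarrow> 'a" where ac: "\<And>m. cbox (a m) (c m) \<subseteq> \<Omega>" "(\<Union>m. box (a m) (c m)) = \<Omega>"
    using open_countable_Union_boxes[OF assms False] by metis
  let ?b = "\<lambda>m. box_bump (a m) (c m)"
  \<comment> \<open>Off the first k closed boxes every factor is 1, so 1 - r vanishes there. At a
    point of the set some bump is positive, and the exponent k drives the corresponding factor,
    hence \<open>r\<close>, to 0.\<close>
  define r where "r k x = (\<Prod>m<k. (1 - ?b m x) ^ k)" for k :: nat and x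
  have r: "0 \<le> r k x" "r k x \<le> 1" for k x
    unfolding r_def using box_bump_le_1 box_bump_nonneg
    by (auto intro!: prod_nonneg prod_le_1 power_le_one zero_le_power)
  show ?thesis
  proof (rule that[of "\<lambda>k x. complex_of_real (1 - r k x)" "\<lambda>k. \<Union>m<k. cbox (a m) (c m)"])
    show "smooth (\<lambda>x. complex_of_real (1 - r k x))" for k
      unfolding smooth_def r_def of_real_diff of_real_prod of_real_power of_real_1
      by (intro allI Ck_diff Ck_prod Ck_power Ck_box_bump Ck_const)
    show "norm (complex_of_real (1 - r k x)) \<le> 1" for k x
      using r[of k x] by (simp only: norm_of_real)
    show "x \<in> (\<Union>m<k. cbox (a m) (c m))" if "complex_of_real (1 - r k x) \<noteq> 0" for k x
    proof (rule ccontr)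
      assume "x \<notin> (\<Union>m<k. cbox (a m) (c m))"
      then have "?b m x = 0" if "m < k" for m
        using that box_bump_pos_iff[of "a m" "c m" x] box_bump_nonneg[of "a m" "c m" x] box_subset_cbox[of "a m" "c m"]
        by (auto simp: less_le)
      then have "r k x = 1" by (simp add: r_def)
      with that show False by simp
    qed
    show "(\<lambda>k. complex_of_real (1 - r k x)) \<longlonglongrightarrow> 1" if "x \<in> \<Omega>" for x
    proof -
      obtain m where m: "x \<in> box (a m) (c m)" using \<open>x \<in> \<Omega>\<close> ac(2) by blast
      have le: "r k x \<le> (1 - ?b m x) ^ k" if "m < k" for k
      proof -
        have "r k x = (1 - ?b m x) ^ k * (\<Prod>m\<in>{..<k} - {m}. (1 - ?b m x) ^ k)"
          unfolding r_def using that by (subst prod.remove[of _ m]) auto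
        also have "\<dots> \<le> (1 - ?b m x) ^ k * 1"
          using box_bump_le_1 box_bump_nonneg
          by (intro mult_left_mono prod_le_1 conjI power_le_one zero_le_power) auto
        finally show ?thesis by simp
      qed
      have "(\<lambda>k. r k x) \<longlonglongrightarrow> 0"
      proof (rule tendsto_sandwich[OF _ _ tendsto_const])
        show "(\<lambda>k. (1 - ?b m x) ^ k) \<longlonglongrightarrow> 0"
          using m box_bump_pos_iff[of "a m" "c m" x] box_bump_le_1[of "a m" "c m" x] by (intro LIMSEQ_power_zero) auto
        show "\<forall>\<^sub>F k in sequentially. r k x \<le> (1 - ?b m x) ^ k"
          using eventually_gt_at_top[of m] by eventually_elim (rule le)
      qed (use r in auto)
      then have "(\<lambda>k. complex_of_real (1 - r k x)) \<longlonglongrightarrow> complex_of_real (1 - 0)"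
        by (intro tendsto_intros)
      then show ?thesis by simp
    qed
  qed (use ac(1) in auto)
qed

section \<open>The Cauchy kernel and the Cauchy--Pompeiu formula\<close>

lemma nn_integral_even:
  fixes f :: "real \<Rightarrow> ennreal"
  assumes [measurable]: "f \<in> borel_measurable borel" and even: "\<And>x. f (- x) = f x"
  shows "(\<integral>\<^sup>+x. f x \<partial>lborel) = 2 * (\<integral>\<^sup>+x. f x * indicator {0..} x \<partial>lborel)"
proof -
  have "(\<integral>\<^sup>+x. f x \<partial>lborel) = (\<integral>\<^sup>+x. f x * indicator {0..} x + f x * indicator {..<0} x \<partial>lborel)"
    by (intro nn_integral_cong) (auto split: split_indicator)
  also have "\<dots> = (\<integral>\<^sup>+x. f x * indicator {0..} x \<partial>lborel) + (\<integral>\<^sup>+x. f x * indicator {..<0} x \<partial>lborel)"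
    by (intro nn_integral_add) auto
  also have "(\<integral>\<^sup>+x. f x * indicator {..<0} x \<partial>lborel) = (\<integral>\<^sup>+x. f x * indicator {0<..} x \<partial>lborel)"
    by (subst nn_integral_real_affine[of _ "-1" 0]) (auto simp: even indicator_def)
  also have "\<dots> = (\<integral>\<^sup>+x. f x * indicator {0..} x \<partial>lborel)"
    using AE_lborel_singleton[of "0::real"]
    by (intro nn_integral_cong_AE) (auto elim!: eventually_mono split: split_indicator)
  finally show ?thesis by (simp add: mult_2)
qed

text \<open>This is the inner integral of \<open>reg_delta\<close> along a horizontal line, with c =
  sqrt (1 + y^2).\<close>

lemma nn_integral_inverse_square_quadratic:
  assumes c: "c > 0"
  shows "(\<integral>\<^sup>+x. ennreal (1 / (c\<^sup>2 + x\<^sup>2)\<^sup>2) \<partial>lborel) = ennreal (pi / (2 * c ^ 3))"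
proof -
  \<comment> \<open>An antiderivative from the standard reduction formula for 1 / (c^2 + x^2)^2. It
    is 0 at 0 and tends to pi / (4 c^3); evenness doubles this value.\<close>
  define F where "F x = x / (2 * c\<^sup>2 * (c\<^sup>2 + x\<^sup>2)) + arctan (x / c) / (2 * c ^ 3)" for x
  have pos: "c\<^sup>2 + x\<^sup>2 > 0" for x using c by (simp add: add_pos_nonneg)
  have "(\<integral>\<^sup>+x. ennreal (1 / (c\<^sup>2 + x\<^sup>2)\<^sup>2) * indicator {0..} x \<partial>lborel) = pi / (4 * c ^ 3) - F 0"
  proof (rule nn_integral_FTC_atLeast)
    show "(F has_real_derivative 1 / (c\<^sup>2 + x\<^sup>2)\<^sup>2) (at x)" for x
    proof -
      have ne: "c\<^sup>2 + x\<^sup>2 \<noteq> 0" "c \<noteq> 0" using pos[of x] c by auto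
      have "(F has_real_derivative ((2 * c\<^sup>2 * (c\<^sup>2 + x\<^sup>2)) - x * (2 * c\<^sup>2 * (2 * x))) / (2 * c\<^sup>2 * (c\<^sup>2 + x\<^sup>2))\<^sup>2
          + (1 / (1 + (x / c)\<^sup>2) * (1 / c)) / (2 * c ^ 3)) (at x)"
        unfolding F_def
      proof (rule DERIV_add)
        show "((\<lambda>x. x / (2 * c\<^sup>2 * (c\<^sup>2 + x\<^sup>2))) has_real_derivative
            ((2 * c\<^sup>2 * (c\<^sup>2 + x\<^sup>2)) - x * (2 * c\<^sup>2 * (2 * x))) / (2 * c\<^sup>2 * (c\<^sup>2 + x\<^sup>2))\<^sup>2) (at x)"
          using ne by (auto intro!: derivative_eq_intros simp: power2_eq_square)
        have "((\<lambda>x. arctan (x / c)) has_real_derivative inverse (1 + (x / c)\<^sup>2) * (1 / c)) (at x)"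
          by (rule DERIV_chain2[OF DERIV_arctan]) (rule DERIV_cdivide[OF DERIV_ident])
        from DERIV_cdivide[OF this, of "2 * c ^ 3"]
        show "((\<lambda>x. arctan (x / c) / (2 * c ^ 3)) has_real_derivative
            1 / (1 + (x / c)\<^sup>2) * (1 / c) / (2 * c ^ 3)) (at x)"
          by (simp add: inverse_eq_divide)
      qed
      moreover have "1 / (1 + (x / c)\<^sup>2) * (1 / c) / (2 * c ^ 3) = 1 / (2 * c\<^sup>2 * (c\<^sup>2 + x\<^sup>2))"
      proof -
        have "1 + (x / c)\<^sup>2 = (c\<^sup>2 + x\<^sup>2) / c\<^sup>2" using ne by (simp add: field_simps)
        then show ?thesis using ne by (simp add: power2_eq_square power3_eq_cube)
      qed
      moreover have "((2 * c\<^sup>2 * (c\<^sup>2 + x\<^sup>2)) - x * (2 * c\<^sup>2 * (2 * x))) / (2 * c\<^sup>2 * (c\<^sup>2 + x\<^sup>2))\<^sup>2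
          + 1 / (2 * c\<^sup>2 * (c\<^sup>2 + x\<^sup>2)) = 1 / (c\<^sup>2 + x\<^sup>2)\<^sup>2"
      proof -
        define N where "N = c\<^sup>2 + x\<^sup>2"
        have xx: "x * x = N - c\<^sup>2" by (simp add: N_def power2_eq_square)
        have "((2 * c\<^sup>2 * N) - x * (2 * c\<^sup>2 * (2 * x))) = 2 * c\<^sup>2 * N - 4 * c\<^sup>2 * (x * x)"
          by simp
        also have "\<dots> = 2 * c\<^sup>2 * (2 * c\<^sup>2 - N)"
          unfolding xx by (simp add: algebra_simps)
        finally have "((2 * c\<^sup>2 * N) - x * (2 * c\<^sup>2 * (2 * x))) = 2 * c\<^sup>2 * (2 * c\<^sup>2 - N)" .
        then show ?thesis
          using ne unfolding N_def[symmetric]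
          by (simp add: divide_simps) (simp add: power2_eq_square power4_eq_xxxx algebra_simps)
      qed
      ultimately show ?thesis by (simp only:)
    qed
    have "((\<lambda>x. x / (2 * c\<^sup>2 * (c\<^sup>2 + x\<^sup>2))) \<longlongrightarrow> 0) at_top"
    proof (rule tendsto_sandwich[OF _ _ tendsto_const])
      show "\<forall>\<^sub>F x in at_top. 0 \<le> x / (2 * c\<^sup>2 * (c\<^sup>2 + x\<^sup>2))"
        using eventually_ge_at_top[of 0] by eventually_elim (use pos in \<open>simp add: less_imp_le\<close>)
      show "\<forall>\<^sub>F x in at_top. x / (2 * c\<^sup>2 * (c\<^sup>2 + x\<^sup>2)) \<le> (1 / (2 * c\<^sup>2)) * inverse x"
        using eventually_gt_at_top[of 0]
      proof eventually_elim
        fix x :: real assume "x > 0"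
        then have "x / (2 * c\<^sup>2 * (c\<^sup>2 + x\<^sup>2)) \<le> x / (2 * c\<^sup>2 * x\<^sup>2)"
          using c by (intro divide_left_mono mult_left_mono mult_pos_pos pos) auto
        also have "\<dots> = (1 / (2 * c\<^sup>2)) * inverse x"
          using \<open>x > 0\<close> by (simp add: power2_eq_square field_simps)
        finally show "x / (2 * c\<^sup>2 * (c\<^sup>2 + x\<^sup>2)) \<le> (1 / (2 * c\<^sup>2)) * inverse x" .
      qed
      show "((\<lambda>x. (1 / (2 * c\<^sup>2)) * inverse x) \<longlongrightarrow> 0) at_top"
        by (rule tendsto_mult_right_zero[OF tendsto_inverse_0_at_top[OF filterlim_ident]])
    qed
    moreover have "filterlim (\<lambda>x. x / c) at_top at_top"
      using filterlim_tendsto_pos_mult_at_top[OF tendsto_const _ filterlim_ident, of "1 / c"] c by simp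
    then have "((\<lambda>x. arctan (x / c) / (2 * c ^ 3)) \<longlongrightarrow> (pi / 2) / (2 * c ^ 3)) at_top"
      using c by (intro tendsto_divide tendsto_const filterlim_compose[OF tendsto_arctan_at_top]) auto
    ultimately have "(F \<longlongrightarrow> 0 + (pi / 2) / (2 * c ^ 3)) at_top"
      unfolding F_def by (rule tendsto_add)
    then show "(F \<longlongrightarrow> pi / (4 * c ^ 3)) at_top" by simp
  qed auto
  then have "(\<integral>\<^sup>+x. ennreal (1 / (c\<^sup>2 + x\<^sup>2)\<^sup>2) * indicator {0..} x \<partial>lborel) = ennreal (pi / (4 * c ^ 3))"
    by (simp add: F_def)
  then have "(\<integral>\<^sup>+x. ennreal (1 / (c\<^sup>2 + x\<^sup>2)\<^sup>2) \<partial>lborel) = ennreal 2 * ennreal (pi / (4 * c ^ 3))"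
    by (subst nn_integral_even) auto
  also have "\<dots> = ennreal (pi / (2 * c ^ 3))"
    using c by (subst ennreal_mult[symmetric]) auto
  finally show ?thesis .
qed

text \<open>The remaining outer integral for \<open>reg_delta\<close>: the antiderivative y / sqrt
  (1 + y^2) rises from 0 to 1 on the half line, and evenness doubles this.\<close>

lemma nn_integral_sqrt_cube:
  "(\<integral>\<^sup>+y. ennreal (1 / sqrt (1 + y\<^sup>2) ^ 3) \<partial>lborel) = 2"
proof -
  define F where "F y = y / sqrt (1 + y\<^sup>2)" for y :: real
  have pos: "1 + y\<^sup>2 > 0" for y :: real by (simp add: add_pos_nonneg)
  have "(\<integral>\<^sup>+y. ennreal (1 / sqrt (1 + y\<^sup>2) ^ 3) * indicator {0..} y \<partial>lborel) = 1 - F 0"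
  proof (rule nn_integral_FTC_atLeast)
    show "(F has_real_derivative 1 / sqrt (1 + y\<^sup>2) ^ 3) (at y)" for y
    proof -
      define s where "s = sqrt (1 + y\<^sup>2)"
      have s: "s > 0" "s * s = 1 + y * y" using pos[of y] by (simp_all add: s_def power2_eq_square)
      have "(F has_real_derivative (s - y * (y / s)) / (s * s)) (at y)"
        unfolding F_def using pos[of y] s(1) unfolding s_def
        by (auto intro!: derivative_eq_intros simp: power2_eq_square inverse_eq_divide)
      moreover have "s - y * (y / s) = 1 / s"
        using s by (simp add: field_simps)
      then have "(s - y * (y / s)) / (s * s) = 1 / s ^ 3"
        by (simp add: power3_eq_cube)
      ultimately show ?thesis by (simp add: s_def)
    qed
    \<comment> \<open>The antiderivative is rewritten for y \<ge> 0 so that its limit can be read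
      off.\<close>
    have "((\<lambda>y. sqrt (1 - inverse (1 + y\<^sup>2))) \<longlongrightarrow> sqrt (1 - 0)) at_top"
      by (intro tendsto_intros tendsto_inverse_0_at_top filterlim_tendsto_add_at_top[OF tendsto_const]
          filterlim_pow_at_top filterlim_ident) simp
    moreover have "\<forall>\<^sub>F y in at_top. sqrt (1 - inverse (1 + y\<^sup>2)) = F y"
      using eventually_ge_at_top[of 0]
    proof eventually_elim
      fix y :: real assume y: "y \<ge> 0"
      have "1 - inverse (1 + y\<^sup>2) = y\<^sup>2 / (1 + y\<^sup>2)" using pos[of y] by (simp add: field_simps)
      then show "sqrt (1 - inverse (1 + y\<^sup>2)) = F y" using y by (simp add: F_def real_sqrt_divide)
    qed
    ultimately show "(F \<longlongrightarrow> 1) at_top" by (simp add: tendsto_cong)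
  qed auto
  then show ?thesis by (subst nn_integral_even) (auto simp: F_def)
qed

lemma lborel_complex:
  "lborel = distr (lborel \<Otimes>\<^sub>M lborel) borel (\<lambda>(x, y). Complex x y)"
proof (rule lborel_eqI)
  fix l u :: complex assume le: "\<And>b. b \<in> Basis \<Longrightarrow> l \<bullet> b \<le> u \<bullet> b"
  have le': "Re l \<le> Re u" "Im l \<le> Im u" using le[of 1] le[of \<i>] by (auto simp: Basis_complex_def)
  have [measurable]: "(\<lambda>(x, y). Complex x y) \<in> borel_measurable borel"
    unfolding Complex_eq split_beta by (intro borel_measurable_continuous_onI continuous_intros)
  have "(\<lambda>(x, y). Complex x y) -` box l u = {Re l <..< Re u} \<times> {Im l <..< Im u}"
    by (auto simp: mem_box Basis_complex_def)
  then have "emeasure (distr (lborel \<Otimes>\<^sub>M lborel) borel (\<lambda>(x, y). Complex x y)) (box l u)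
     = emeasure (lborel \<Otimes>\<^sub>M lborel) ({Re l <..< Re u} \<times> {Im l <..< Im u})"
    by (subst emeasure_distr) (auto simp: lborel_prod)
  also have "\<dots> = ennreal ((Re u - Re l) * (Im u - Im l))"
    using le' by (subst lborel.emeasure_pair_measure_Times) (auto simp: ennreal_mult)
  also have "(Re u - Re l) * (Im u - Im l) = (\<Prod>b\<in>Basis. (u - l) \<bullet> b)"
    by (simp add: Basis_complex_def complex_eq_iff inner_diff_left)
  finally show "emeasure (distr (lborel \<Otimes>\<^sub>M lborel) borel (\<lambda>(x, y). Complex x y)) (box l u)
      = ennreal (\<Prod>b\<in>Basis. (u - l) \<bullet> b)" .
qed simp

lemma nn_integral_complex:
  assumes [measurable]: "f \<in> borel_measurable borel"
  shows "(\<integral>\<^sup>+z. f z \<partial>lborel) = (\<integral>\<^sup>+y. \<integral>\<^sup>+x. f (Complex x y) \<partial>lborel \<partial>lborel)"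
proof -
  have [measurable]: "(\<lambda>(x, y). Complex x y) \<in> borel_measurable borel"
    unfolding Complex_eq split_beta by (intro borel_measurable_continuous_onI continuous_intros)
  have m: "(\<lambda>(x, y). Complex x y) \<in> lborel \<Otimes>\<^sub>M lborel \<rightarrow>\<^sub>M borel" by (simp add: lborel_prod)
  then have [measurable]: "(\<lambda>(x, y). f (Complex x y)) \<in> borel_measurable (lborel \<Otimes>\<^sub>M lborel)"
    using measurable_compose[OF m, of f borel] by (simp add: split_beta)
  show ?thesis
    apply (subst lborel_complex)
    apply (subst nn_integral_distr[OF m])
     apply simp
    apply (subst lborel_pair.nn_integral_snd[symmetric])
     apply (simp_all add: split_beta)
    done
qed

text \<open>This is \<open>wirtinger (reg_kernel 1)\<close>. Its rescalings form pi times an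
  approximate identity, and the rational form makes its mass computable by elementary iterated
  integrals.\<close>

definition reg_delta :: "complex \<Rightarrow> real" where
  "reg_delta z = 1 / ((norm z)\<^sup>2 + 1)\<^sup>2"

lemma reg_delta_pos: "0 < reg_delta z"
proof -
  have "(norm z)\<^sup>2 + 1 > 0" by (simp add: add_nonneg_pos)
  then show ?thesis by (simp add: reg_delta_def)
qed

lemma borel_measurable_reg_delta [measurable]: "reg_delta \<in> borel_measurable borel"
  unfolding reg_delta_def by measurable

lemma nn_integral_reg_delta: "(\<integral>\<^sup>+z. ennreal (reg_delta z) \<partial>lborel) = ennreal pi"
proof -
  have pos: "1 + y\<^sup>2 > 0" for y :: real by (simp add: add_pos_nonneg)
  have "(\<integral>\<^sup>+z. ennreal (reg_delta z) \<partial>lborel) = (\<integral>\<^sup>+y. \<integral>\<^sup>+x. ennreal (reg_delta (Complex x y)) \<partial>lborel \<partial>lborel)"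
    by (rule nn_integral_complex) measurable
  also have "\<dots> = (\<integral>\<^sup>+y. \<integral>\<^sup>+x. ennreal (1 / ((sqrt (1 + y\<^sup>2))\<^sup>2 + x\<^sup>2)\<^sup>2) \<partial>lborel \<partial>lborel)"
    using pos by (intro nn_integral_cong) (simp add: reg_delta_def cmod_def less_imp_le add_ac)
  also have "\<dots> = (\<integral>\<^sup>+y. ennreal (pi / (2 * sqrt (1 + y\<^sup>2) ^ 3)) \<partial>lborel)"
    using pos by (intro nn_integral_cong nn_integral_inverse_square_quadratic) simp
  also have "\<dots> = (\<integral>\<^sup>+y. ennreal (pi / 2) * ennreal (1 / sqrt (1 + y\<^sup>2) ^ 3) \<partial>lborel)"
    by (subst ennreal_mult[symmetric]) auto
  also have "\<dots> = ennreal (pi / 2) * 2"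
    by (subst nn_integral_cmult) (auto simp: nn_integral_sqrt_cube)
  also have "\<dots> = ennreal pi"
    using ennreal_mult[of "pi / 2" 2] by simp
  finally show ?thesis .
qed

lemma integrable_reg_delta: "integrable lborel reg_delta"
  by (rule integrableI_nonneg) (auto simp: nn_integral_reg_delta intro: less_imp_le reg_delta_pos)

lemma integral_reg_delta: "integral\<^sup>L lborel reg_delta = pi"
  using nn_integral_eq_integral[OF integrable_reg_delta] nn_integral_reg_delta reg_delta_pos
  by (simp add: less_imp_le AE_I2 integral_nonneg)

section \<open>Local integrability of the Cauchy kernel\<close>

lemma nn_integral_inverse_sqrt_finite:
  "(\<integral>\<^sup>+x. ennreal (\<bar>x\<bar> powr (- 1 / 2) * indicator {- R..R} x) \<partial>lborel) < \<infinity>"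
proof -
  define I where "I = integral {0..R} (\<lambda>x. x powr (- 1 / 2))"
  have "(\<lambda>x. x powr (- 1 / 2)) integrable_on {0..R}"
    by (cases "R \<ge> 0") (auto intro: integrable_on_powr_from_0)
  then have "(\<integral>\<^sup>+x. ennreal (x powr (- 1 / 2)) * indicator {0..R} x \<partial>lborel) = ennreal I"
    unfolding I_def by (intro nn_integral_has_integral_lebesgue' integrable_integral) auto
  moreover have "(\<integral>\<^sup>+x. ennreal (\<bar>x\<bar> powr (- 1 / 2) * indicator {- R..R} x) \<partial>lborel)
    = 2 * (\<integral>\<^sup>+x. ennreal (\<bar>x\<bar> powr (- 1 / 2) * indicator {- R..R} x) * indicator {0..} x \<partial>lborel)"
    by (rule nn_integral_even) (auto split: split_indicator)
  moreover have "(\<integral>\<^sup>+x. ennreal (\<bar>x\<bar> powr (- 1 / 2) * indicator {- R..R} x) * indicator {0..} x \<partial>lborel)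
    = (\<integral>\<^sup>+x. ennreal (x powr (- 1 / 2)) * indicator {0..R} x \<partial>lborel)"
    by (intro nn_integral_cong) (auto split: split_indicator)
  ultimately show ?thesis by (simp add: ennreal_mult_less_top)
qed

definition cauchy_kernel :: "real \<Rightarrow> complex \<Rightarrow> complex" where
  "cauchy_kernel R z = indicator (cball 0 R) z / z"

lemma borel_measurable_cauchy_kernel [measurable]: "cauchy_kernel R \<in> borel_measurable borel"
  unfolding cauchy_kernel_def[abs_def]
  by (intro borel_measurable_divide borel_measurable_indicator measurable_ident_sets[OF refl]) auto

text \<open>From |z|^2 \<ge> |Re z| |Im z| one gets 1/|z| \<le> |Re z|^(-1/2) |Im z|^(-1/2), a
  product of locally integrable functions of one real variable each.\<close>

lemma integrable_cauchy_kernel: "integrable lborel (cauchy_kernel R)"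
proof (rule integrableI_bounded)
  let ?h = "\<lambda>x::real. \<bar>x\<bar> powr (- 1 / 2) * indicator {- R..R} x"
  have bound: "norm (cauchy_kernel R z) \<le> ?h (Re z) * ?h (Im z)" if "Re z \<noteq> 0" "Im z \<noteq> 0" for z
  proof (cases "norm z \<le> R")
    case True
    have "\<bar>Re z\<bar> * \<bar>Im z\<bar> \<le> norm z * norm z"
      by (intro mult_mono abs_Re_le_cmod abs_Im_le_cmod) auto
    then have "sqrt (\<bar>Re z\<bar> * \<bar>Im z\<bar>) \<le> norm z"
      by (simp add: real_le_lsqrt power2_eq_square)
    then have "inverse (norm z) \<le> inverse (sqrt (\<bar>Re z\<bar> * \<bar>Im z\<bar>))"
      using that by (intro le_imp_inverse_le) auto
    also have "\<dots> = \<bar>Re z\<bar> powr (- 1 / 2) * \<bar>Im z\<bar> powr (- 1 / 2)"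
      using that by (simp add: powr_minus powr_half_sqrt real_sqrt_mult)
    finally have "inverse (norm z) \<le> \<bar>Re z\<bar> powr (- 1 / 2) * \<bar>Im z\<bar> powr (- 1 / 2)" .
    moreover have "Re z \<in> {- R..R}" "Im z \<in> {- R..R}"
      using True abs_Re_le_cmod[of z] abs_Im_le_cmod[of z] by auto
    ultimately show ?thesis
      using True by (simp add: cauchy_kernel_def norm_divide inverse_eq_divide)
  qed (simp add: cauchy_kernel_def)
  \<comment> \<open>The axes must be discarded: since \<open>0 powr a\<close> is 0, the bounding
    product is 0 there while the kernel need not be.\<close>
  have ae: "AE z in lborel. Re z \<noteq> 0 \<and> Im z \<noteq> 0"
  proof -
    have "AE z in lborel. (z::complex) \<bullet> b \<noteq> 0" if "b \<in> Basis" for b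
    proof -
      have "{z::complex. z \<bullet> b = 0} \<in> null_sets lebesgue"
        using negligible_standard_hyperplane[OF that, of 0] by (simp add: negligible_iff_null_sets)
      moreover have "{z::complex. z \<bullet> b = 0} \<in> sets borel" by measurable
      ultimately have "{z::complex. z \<bullet> b = 0} \<in> null_sets lborel"
        by (simp add: null_sets_completion_iff)
      from AE_not_in[OF this] show ?thesis by simp
    qed
    from this[of 1] this[of \<i>] show ?thesis by (auto simp: Basis_complex_def)
  qed
  have "(\<integral>\<^sup>+z. ennreal (norm (cauchy_kernel R z)) \<partial>lborel) \<le> (\<integral>\<^sup>+z. (\<Prod>b\<in>(Basis :: complex set). ennreal (?h (z \<bullet> b))) \<partial>lborel)"
  proof (rule nn_integral_mono_AE)
    show "AE z in lborel. ennreal (norm (cauchy_kernel R z)) \<le> (\<Prod>b\<in>Basis. ennreal (?h (z \<bullet> b)))"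
      using ae
    proof eventually_elim
      fix z assume "Re z \<noteq> 0 \<and> Im z \<noteq> 0"
      then have "ennreal (norm (cauchy_kernel R z)) \<le> ennreal (?h (Re z)) * ennreal (?h (Im z))"
        using bound[of z] by (subst ennreal_mult[symmetric]) auto
      then show "ennreal (norm (cauchy_kernel R z)) \<le> (\<Prod>b\<in>Basis. ennreal (?h (z \<bullet> b)))"
        by (simp add: Basis_complex_def complex_eq_iff)
    qed
  qed
  also have "\<dots> = (\<Prod>b\<in>(Basis :: complex set). (\<integral>\<^sup>+x. ennreal (?h x) \<partial>lborel))"
    by (rule nn_integral_lborel_prod) auto
  also have "\<dots> < \<infinity>"
    using nn_integral_inverse_sqrt_finite[of R] by (simp add: Basis_complex_def complex_eq_iff ennreal_mult_less_top)
  finally show "(\<integral>\<^sup>+z. ennreal (norm (cauchy_kernel R z)) \<partial>lborel) < \<infinity>" .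
qed simp

section \<open>Integrals of derivatives\<close>

lemma lborel_integral_translate:
  fixes f :: "'a::euclidean_space \<Rightarrow> 'b::{banach, second_countable_topology}"
  assumes "f \<in> borel_measurable borel"
  shows "(\<integral>x. f (c + x) \<partial>lborel) = (\<integral>x. f x \<partial>lborel)"
  using integral_distr[of "(+) c" lborel borel f] assms lborel_distr_plus[of c] by simp

lemma integrable_bounded_support:
  fixes \<phi> :: "'a::euclidean_space \<Rightarrow> complex"
  assumes "continuous_on UNIV \<phi>" "bounded {x. \<phi> x \<noteq> 0}"
  shows "integrable lborel \<phi>"
proof -
  have "integrable lborel (\<lambda>x. indicator (closure {x. \<phi> x \<noteq> 0}) x *\<^sub>R \<phi> x)"
    using assms by (intro borel_integrable_compact continuous_on_subset[OF assms(1)]) (auto simp: compact_closure)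
  also have "(\<lambda>x. indicator (closure {x. \<phi> x \<noteq> 0}) x *\<^sub>R \<phi> x) = \<phi>"
    using closure_subset[of "{x. \<phi> x \<noteq> 0}"] by (auto simp: fun_eq_iff indicator_def)
  finally show ?thesis .
qed

text \<open>The integral of \<phi>(w + x) over x does not depend on w; differentiating it under the
  integral at w = 0 gives the claim.\<close>

lemma integral_frechet_derivative_eq_0:
  fixes \<phi> :: "'a::euclidean_space \<Rightarrow> complex"
  assumes \<phi>: "smooth \<phi>" "bounded {x. \<phi> x \<noteq> 0}"
  shows "(\<integral>x. frechet_derivative \<phi> (at x) h \<partial>lborel) = 0"
proof -
  let ?D = "\<lambda>x. frechet_derivative \<phi> (at x)"
  obtain R where R: "\<And>x. x \<in> closure {x. \<phi> x \<noteq> 0} \<Longrightarrow> norm x \<le> R"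
    using bounded_closure[OF \<phi>(2)] by (auto simp: bounded_iff)
  have R0: "\<phi> x = 0" if "norm x > R" for x
    using R[of x] that closure_subset[of "{x. \<phi> x \<noteq> 0}"] by force
  \<comment> \<open>The constant 1 is not integrable over the whole space, so it is replaced by the
    indicator of a ball. Radius R + 1 contains the support of every translate by a vector of norm
    less than 1.\<close>
  let ?k = "\<lambda>x::'a. complex_of_real (indicator (cball 0 (R + 1)) x)"
  have k: "integrable lborel ?k"
    by (intro integrable_of_real integrable_real_indicator) (use emeasure_bounded_finite[OF bounded_cball] in auto)
  have conv: "((\<lambda>w. \<integral>x. ?k x * \<phi> (w - - x) \<partial>lborel) has_derivative
      (\<lambda>v. \<integral>x. ?k x * ?D (0 - - x) v \<partial>lborel)) (at 0)"
    by (rule conv_has_derivative[OF \<phi> k]) measurable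
  have meas: "\<phi> \<in> borel_measurable borel"
    using smooth_continuous[OF \<phi>(1)] by (rule borel_measurable_continuous_onI)
  have const: "(\<integral>x. ?k x * \<phi> (w - - x) \<partial>lborel) = (\<integral>x. \<phi> x \<partial>lborel)" if "w \<in> ball 0 1" for w
  proof -
    have "?k x * \<phi> (w - - x) = \<phi> (w + x)" for x
    proof (cases "norm x \<le> R + 1")
      case False
      have "norm x \<le> norm (w + x) + norm w"
        using norm_triangle_ineq4[of "w + x" w] by simp
      then have "norm (w + x) > R" using that False by simp
      then show ?thesis using False R0 by simp
    qed simp
    then show ?thesis by (simp only: lborel_integral_translate[OF meas])
  qed
  have "((\<lambda>w. \<integral>x. \<phi> x \<partial>lborel) has_derivative (\<lambda>v. \<integral>x. ?k x * ?D (0 - - x) v \<partial>lborel)) (at 0)"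
    by (rule has_derivative_transform_within_open[OF conv open_ball[of 0 1]]) (use const in auto)
  then have "(\<lambda>v. \<integral>x. ?k x * ?D (0 - - x) v \<partial>lborel) = (\<lambda>v. 0)"
    by (rule has_derivative_unique) simp
  from fun_cong[OF this, of h] have "(\<integral>x. ?k x * ?D x h \<partial>lborel) = 0"
    by (simp only: diff_0 minus_minus)
  moreover have "?k x * ?D x h = ?D x h" for x
    using R[of x] frechet_derivative_outside_support[OF \<phi>(1), of x h] by (cases "norm x \<le> R + 1") auto
  ultimately show ?thesis by simp
qed

section \<open>The Cauchy--Pompeiu formula in one variable\<close>

definition wirtinger :: "(complex \<Rightarrow> complex) \<Rightarrow> complex \<Rightarrow> complex" where
  "wirtinger u z = (frechet_derivative u (at z) 1 + \<i> * frechet_derivative u (at z) \<i>) / 2"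

lemma smooth_wirtinger: "smooth u \<Longrightarrow> smooth (wirtinger u)"
proof -
  assume s: "smooth u"
  have "Ck k (\<lambda>z. (1 / 2) * (frechet_derivative u (at z) 1 + \<i> * frechet_derivative u (at z) \<i>))" for k
    by (intro Ck_mult Ck_add Ck_const smooth_imp_Ck smooth_frechet_derivative s)
  then show ?thesis by (simp add: smooth_def wirtinger_def[abs_def])
qed

lemma bounded_support_wirtinger:
  assumes "smooth u" "bounded {z. u z \<noteq> 0}"
  shows "bounded {z. wirtinger u z \<noteq> 0}"
proof (rule bounded_subset[OF bounded_closure[OF assms(2)]])
  show "{z. wirtinger u z \<noteq> 0} \<subseteq> closure {z. u z \<noteq> 0}"
  proof (intro subsetI, rule ccontr)
    fix z assume z: "z \<in> {z. wirtinger u z \<noteq> 0}" "z \<notin> closure {z. u z \<noteq> 0}"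
    from frechet_derivative_outside_support[OF assms(1) z(2)] z(1) show False
      by (simp add: wirtinger_def)
  qed
qed

lemma integral_wirtinger_eq_0:
  assumes "smooth u" "bounded {z. u z \<noteq> 0}"
  shows "(\<integral>z. wirtinger u z \<partial>lborel) = 0"
proof -
  have "integrable lborel (\<lambda>z. frechet_derivative u (at z) h)" for h
    by (intro integrable_bounded_support smooth_continuous smooth_frechet_derivative
        bounded_support_frechet_derivative assms)
  then show ?thesis
    unfolding wirtinger_def using integral_frechet_derivative_eq_0[OF assms] by simp
qed

text \<open>A smooth substitute for 1/z = cnj z / |z|^2. The denominator is written as a polynomial
  in z and cnj z so that smoothness follows from sums, products and inverses.\<close>

definition reg_kernel :: "real \<Rightarrow> complex \<Rightarrow> complex" where
  "reg_kernel e z = cnj z * inverse (z * cnj z + of_real (e\<^sup>2))"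

lemma reg_kernel_denominator:
  "z * cnj z + of_real (e\<^sup>2) = of_real ((norm z)\<^sup>2 + e\<^sup>2)"
  "e > 0 \<Longrightarrow> z * cnj z + of_real (e\<^sup>2) \<noteq> 0"
proof -
  show *: "z * cnj z + of_real (e\<^sup>2) = of_real ((norm z)\<^sup>2 + e\<^sup>2)"
    by (simp add: complex_norm_square[symmetric])
  assume "e > 0"
  then have "(norm z)\<^sup>2 + e\<^sup>2 > 0" by (simp add: add_nonneg_pos)
  then show "z * cnj z + of_real (e\<^sup>2) \<noteq> 0"
    unfolding * of_real_eq_0_iff by linarith
qed

lemma smooth_reg_kernel:
  assumes "e > 0"
  shows "smooth (reg_kernel e)"
proof -
  have i: "Ck k (\<lambda>z::complex. z)" "Ck k cnj" for k
  proof -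
    have c: "Ck k (\<lambda>z::complex. z)" for k
    proof (cases k)
      case (Suc m)
      show ?thesis unfolding Suc by (rule Ck_SucI[OF has_derivative_ident]) simp
    qed simp
    then show "Ck k (\<lambda>z::complex. z)" "Ck k cnj"
      using Ck_bounded_linear[OF bounded_linear_cnj c] by auto
  qed
  from reg_kernel_denominator(2)[OF assms] show ?thesis
    unfolding smooth_def reg_kernel_def[abs_def]
    by (intro allI Ck_mult Ck_inverse Ck_add Ck_const i)
qed

text \<open>With N = |z|^2 + e^2 the quotient rule gives 1/N - |z|^2/N^2 = e^2/N^2, which is e^(-2)
  times \<open>reg_delta\<close> at z/e.\<close>

lemma wirtinger_reg_kernel:
  assumes "e > 0"
  shows "wirtinger (reg_kernel e) z = of_real (e\<^sup>2 / ((norm z)\<^sup>2 + e\<^sup>2)\<^sup>2)"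
proof -
  define N where "N = z * cnj z + of_real (e\<^sup>2)"
  have N: "N \<noteq> 0"
    unfolding N_def by (rule reg_kernel_denominator(2)[OF assms])
  have "(reg_kernel e has_derivative
      (\<lambda>v. cnj z * - (inverse N * (z * cnj v + v * cnj z) * inverse N) + cnj v * inverse N)) (at z)"
    unfolding reg_kernel_def[abs_def] N_def
  proof (rule has_derivative_mult)
    have c: "(cnj has_derivative cnj) (at z)"
      by (rule bounded_linear_imp_has_derivative[OF bounded_linear_cnj])
    show "(cnj has_derivative cnj) (at z)" by (rule c)
    have "((\<lambda>z. z * cnj z + of_real (e\<^sup>2)) has_derivative (\<lambda>v. z * cnj v + v * cnj z)) (at z)"
      using has_derivative_add[OF has_derivative_mult[OF has_derivative_ident c] has_derivative_const] by simp
    from Deriv.has_derivative_inverse[OF N[unfolded N_def] this]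
    show "((\<lambda>z. inverse (z * cnj z + of_real (e\<^sup>2))) has_derivative
       (\<lambda>v. - (inverse (z * cnj z + of_real (e\<^sup>2)) * (z * cnj v + v * cnj z) *
          inverse (z * cnj z + of_real (e\<^sup>2))))) (at z)" .
  qed
  from frechet_derivative_at[OF this, symmetric]
  have "wirtinger (reg_kernel e) z = (inverse N - cnj z * z * inverse N * inverse N)"
    by (simp add: wirtinger_def diff_divide_distrib algebra_simps)
  also have "\<dots> = (N - cnj z * z) * inverse N * inverse N"
    using N by (simp add: algebra_simps)
  also have "N - cnj z * z = of_real (e\<^sup>2)" by (simp add: N_def)
  also have "of_real (e\<^sup>2) * inverse N * inverse N = of_real (e\<^sup>2 / ((norm z)\<^sup>2 + e\<^sup>2)\<^sup>2)"
    unfolding N_def reg_kernel_denominator(1) by (simp add: power2_eq_square divide_inverse)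
  finally show ?thesis .
qed

lemma wirtinger_mult:
  assumes "smooth u" "smooth v"
  shows "wirtinger (\<lambda>z. u z * v z) z = u z * wirtinger v z + wirtinger u z * v z"
  unfolding wirtinger_def
    frechet_derivative_at[OF has_derivative_mult[OF smooth_has_derivative[OF assms(1)] smooth_has_derivative[OF assms(2)]], symmetric]
  by (simp add: field_simps)

text \<open>Integration by parts: the product of u and the smooth kernel has bounded support, so its
  Wirtinger derivative integrates to 0. A rescaling then moves e from the kernel into the argument
  of u.\<close>

lemma integral_wirtinger_reg_kernel:
  assumes "smooth u" "bounded {z. u z \<noteq> 0}" "e > 0"
  shows "(\<integral>z. wirtinger u z * reg_kernel e z \<partial>lborel) = - (\<integral>z. u (e *\<^sub>R z) * of_real (reg_delta z) \<partial>lborel)"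
proof -
  note k = smooth_reg_kernel[OF assms(3)]
  have i1: "integrable lborel (\<lambda>z. wirtinger u z * reg_kernel e z)"
    by (rule integrable_bounded_support[OF smooth_continuous[OF smooth_mult[OF smooth_wirtinger[OF assms(1)] k]]])
      (rule bounded_subset[OF bounded_support_wirtinger[OF assms(1,2)]], auto)
  have i2: "integrable lborel (\<lambda>z. u z * wirtinger (reg_kernel e) z)"
    by (rule integrable_bounded_support[OF smooth_continuous[OF smooth_mult[OF assms(1) smooth_wirtinger[OF k]]]])
      (rule bounded_subset[OF assms(2)], auto)
  have "0 = (\<integral>z. wirtinger (\<lambda>z. u z * reg_kernel e z) z \<partial>lborel)"
    by (rule integral_wirtinger_eq_0[OF smooth_mult[OF assms(1) k], symmetric])
      (rule bounded_subset[OF assms(2)], auto)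
  also have "\<dots> = (\<integral>z. u z * wirtinger (reg_kernel e) z \<partial>lborel) + (\<integral>z. wirtinger u z * reg_kernel e z \<partial>lborel)"
    unfolding wirtinger_mult[OF assms(1) k] using i1 i2 by simp
  finally have "(\<integral>z. wirtinger u z * reg_kernel e z \<partial>lborel) = - (\<integral>z. u z * wirtinger (reg_kernel e) z \<partial>lborel)"
    by (simp add: eq_neg_iff_add_eq_0 add.commute)
  \<comment> \<open>Substitution z to e z; the plane has real dimension 2, so the Jacobian is
    e^2.\<close>
  also have "(\<integral>z. u z * wirtinger (reg_kernel e) z \<partial>lborel)
      = (\<integral>z. u z * wirtinger (reg_kernel e) z \<partial>density (distr lborel borel (\<lambda>x. 0 + e *\<^sub>R x)) (\<lambda>_. ennreal (\<bar>e\<bar> ^ DIM(complex))))"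
    using lborel_affine[of e "0::complex"] assms(3) by simp
  also have "\<dots> = (\<integral>z. e\<^sup>2 *\<^sub>R (u (e *\<^sub>R z) * wirtinger (reg_kernel e) (e *\<^sub>R z)) \<partial>lborel)"
  proof -
    have [measurable]: "u \<in> borel_measurable borel" "wirtinger (reg_kernel e) \<in> borel_measurable borel"
      by (intro borel_measurable_continuous_onI smooth_continuous assms smooth_wirtinger k)+
    show ?thesis
      by (subst integral_density) (auto simp: integral_distr)
  qed
  also have "\<dots> = (\<integral>z. u (e *\<^sub>R z) * of_real (reg_delta z) \<partial>lborel)"
  proof (intro Bochner_Integration.integral_cong refl)
    fix z :: complex
    have "(norm (e *\<^sub>R z))\<^sup>2 + e\<^sup>2 = e\<^sup>2 * ((norm z)\<^sup>2 + 1)"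
      by (simp add: power_mult_distrib algebra_simps)
    then have "e\<^sup>2 * (e\<^sup>2 / ((norm (e *\<^sub>R z))\<^sup>2 + e\<^sup>2)\<^sup>2) = reg_delta z"
      using assms(3) by (simp add: reg_delta_def power_mult_distrib power2_eq_square)
    then show "e\<^sup>2 *\<^sub>R (u (e *\<^sub>R z) * wirtinger (reg_kernel e) (e *\<^sub>R z)) = u (e *\<^sub>R z) * of_real (reg_delta z)"
      unfolding wirtinger_reg_kernel[OF assms(3)]
      by (simp only: scaleR_conv_of_real of_real_mult[symmetric] mult.left_commute)
  qed
  finally show ?thesis .
qed

lemma norm_reg_kernel_le: "norm (reg_kernel e z) \<le> norm (1 / z)"
proof (cases "z = 0")
  case False
  have "norm (reg_kernel e z) = norm z / ((norm z)\<^sup>2 + e\<^sup>2)"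
    unfolding reg_kernel_def reg_kernel_denominator(1)
    by (simp add: norm_mult norm_inverse divide_inverse del: of_real_add of_real_power)
  also have "\<dots> \<le> norm z / (norm z)\<^sup>2"
    using False by (intro divide_left_mono mult_pos_pos) (auto simp: add_pos_nonneg)
  finally show ?thesis using False by (simp add: power2_eq_square norm_divide)
qed (simp add: reg_kernel_def)

lemma reg_kernel_tendsto: "(\<lambda>n. reg_kernel (1 / Suc n) z) \<longlonglongrightarrow> 1 / z"
proof (cases "z = 0")
  case False
  have "(\<lambda>n. cnj z * inverse (z * cnj z + of_real ((1 / Suc n)\<^sup>2))) \<longlonglongrightarrow> cnj z * inverse (z * cnj z + of_real (0\<^sup>2))"
    using False LIMSEQ_inverse_real_of_nat by (intro tendsto_intros) (auto simp: inverse_eq_divide)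
  moreover have "cnj z * inverse (z * cnj z + of_real (0\<^sup>2)) = 1 / z"
    using False by (simp add: field_simps)
  ultimately show ?thesis by (simp only: reg_kernel_def)
qed (simp add: reg_kernel_def)

text \<open>Let e tend to 0 along 1 / Suc n in \<open>integral_wirtinger_reg_kernel\<close>. The
  left integrand is dominated by |wirtinger u| / |z|, the right one by \<open>B * reg_delta\<close>,
  whose mass yields the factor pi.\<close>

lemma cauchy_pompeiu:
  assumes u: "smooth u" "bounded {z. u z \<noteq> 0}" and R: "\<And>z. wirtinger u z \<noteq> 0 \<Longrightarrow> norm z \<le> R"
  shows "(\<integral>z. cauchy_kernel R z * wirtinger u z \<partial>lborel) = - of_real pi * u 0"
proof -
  obtain B where B: "\<And>z. norm (u z) \<le> B" "B \<ge> 0"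
    using bounded_support_bounded[OF smooth_continuous[OF u(1)] u(2)] by metis
  note w = smooth_continuous[OF smooth_wirtinger[OF u(1)]] bounded_support_wirtinger[OF u]
  have [measurable]: "u \<in> borel_measurable borel" "wirtinger u \<in> borel_measurable borel"
    "reg_kernel (1 / Suc n) \<in> borel_measurable borel" for n
    by (intro borel_measurable_continuous_onI smooth_continuous u smooth_wirtinger smooth_reg_kernel; simp)+
  \<comment> \<open>Where the truncation would change the kernel, \<open>wirtinger u\<close>
    vanishes by the choice of R.\<close>
  have eq: "cauchy_kernel R z * wirtinger u z = wirtinger u z * (1 / z)" for z
    using R[of z] by (cases "wirtinger u z = 0") (auto simp: cauchy_kernel_def)
  have int: "integrable lborel (\<lambda>z. cauchy_kernel R z * wirtinger u (0 - - z))"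
    by (rule integrable_conv[OF w integrable_cauchy_kernel]) simp
  have "(\<lambda>n. \<integral>z. wirtinger u z * reg_kernel (1 / Suc n) z \<partial>lborel) \<longlonglongrightarrow> (\<integral>z. wirtinger u z * (1 / z) \<partial>lborel)"
  proof (rule integral_dominated_convergence)
    show "integrable lborel (\<lambda>z. norm (cauchy_kernel R z * wirtinger u z))" using int by simp
    show "AE z in lborel. (\<lambda>n. wirtinger u z * reg_kernel (1 / Suc n) z) \<longlonglongrightarrow> wirtinger u z * (1 / z)"
      by (intro AE_I2 tendsto_mult tendsto_const reg_kernel_tendsto)
    show "AE z in lborel. norm (wirtinger u z * reg_kernel (1 / Suc n) z) \<le> norm (cauchy_kernel R z * wirtinger u z)" for n
      unfolding eq norm_mult by (intro AE_I2 mult_left_mono norm_reg_kernel_le) simp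
  qed measurable
  moreover have "(\<lambda>n. \<integral>z. wirtinger u z * reg_kernel (1 / Suc n) z \<partial>lborel) \<longlonglongrightarrow> - (\<integral>z. u 0 * of_real (reg_delta z) \<partial>lborel)"
  proof -
    have "(\<lambda>n. \<integral>z. u ((1 / Suc n) *\<^sub>R z) * of_real (reg_delta z) \<partial>lborel) \<longlonglongrightarrow> (\<integral>z. u 0 * of_real (reg_delta z) \<partial>lborel)"
    proof (rule integral_dominated_convergence)
      show "integrable lborel (\<lambda>z. B * reg_delta z)" using integrable_reg_delta by simp
      show "AE z in lborel. norm (u ((1 / Suc n) *\<^sub>R z) * of_real (reg_delta z)) \<le> B * reg_delta z" for n
        using B reg_delta_pos by (auto simp: norm_mult less_imp_le intro!: AE_I2 mult_right_mono)
      show "AE z in lborel. (\<lambda>n. u ((1 / Suc n) *\<^sub>R z) * of_real (reg_delta z)) \<longlonglongrightarrow> u 0 * of_real (reg_delta z)"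
      proof (intro AE_I2 tendsto_mult tendsto_const)
        fix z :: complex
        have "(\<lambda>n. (1 / Suc n) *\<^sub>R z) \<longlonglongrightarrow> 0 *\<^sub>R z"
          using LIMSEQ_inverse_real_of_nat by (intro tendsto_intros) (simp add: inverse_eq_divide)
        then have "(\<lambda>n. (1 / Suc n) *\<^sub>R z) \<longlonglongrightarrow> 0" by simp
        moreover have "isCont u 0"
          using smooth_continuous[OF u(1)] by (simp add: continuous_on_eq_continuous_at)
        ultimately show "(\<lambda>n. u ((1 / Suc n) *\<^sub>R z)) \<longlonglongrightarrow> u 0"
          by (rule isCont_tendsto_compose[rotated])
      qed
    qed measurable
    from tendsto_minus[OF this] show ?thesis
      by (simp only: integral_wirtinger_reg_kernel[OF u] zero_less_divide_1_iff of_nat_0_less_iff zero_less_Suc)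
  qed
  ultimately have "(\<integral>z. wirtinger u z * (1 / z) \<partial>lborel) = - (\<integral>z. u 0 * of_real (reg_delta z) \<partial>lborel)"
    by (rule LIMSEQ_unique)
  also have "\<dots> = - of_real pi * u 0"
    using integral_reg_delta integral_complex_of_real[of lborel reg_delta] by simp
  finally show ?thesis unfolding eq .
qed

text \<open>Restricting \<phi> to the reflected line w - axis j \<xi> reverses the sign of the
  derivative, which cancels the minus sign of \<open>cauchy_pompeiu\<close>.\<close>

lemma cauchy_pompeiu_axis:
  fixes \<phi> :: "complex ^ 'n::finite \<Rightarrow> complex"
  assumes \<phi>: "smooth \<phi>" "bounded {z. \<phi> z \<noteq> 0}"
    and R: "\<And>\<xi>. dbar j \<phi> (w - axis j \<xi>) \<noteq> 0 \<Longrightarrow> norm \<xi> \<le> R"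
  shows "(\<integral>\<xi>. cauchy_kernel R \<xi> * dbar j \<phi> (w - axis j \<xi>) \<partial>lborel) = of_real pi * \<phi> w"
proof -
  have lin: "bounded_linear (\<lambda>\<xi>::complex. - axis j \<xi> :: complex ^ 'n)"
    unfolding linear_conv_bounded_linear[symmetric]
    by (rule linearI) (auto simp: vec_eq_iff axis_def)
  define u where "u \<xi> = \<phi> (w + - axis j \<xi>)" for \<xi>
  have s: "smooth u"
    using \<phi>(1) Ck_compose_affine[OF lin] unfolding smooth_def u_def by blast
  have "(u has_derivative (\<lambda>v. frechet_derivative \<phi> (at (w + - axis j \<xi>)) (- axis j v))) (at \<xi>)" for \<xi>
    unfolding u_def
    by (rule has_derivative_compose[OF has_derivative_affine[OF lin] smooth_has_derivative[OF \<phi>(1)]])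
  from frechet_derivative_at[OF this, symmetric]
  have wu: "wirtinger u \<xi> = - dbar j \<phi> (w - axis j \<xi>)" for \<xi>
    using linear_neg[OF has_derivative_linear[OF smooth_has_derivative[OF \<phi>(1)]]]
    by (simp add: wirtinger_def dbar_def field_simps)
  obtain S where S: "\<And>z. \<phi> z \<noteq> 0 \<Longrightarrow> norm z \<le> S" using \<phi>(2) by (auto simp: bounded_iff)
  have "bounded {\<xi>. u \<xi> \<noteq> 0}"
  proof (rule boundedI)
    fix \<xi> assume "\<xi> \<in> {\<xi>. u \<xi> \<noteq> 0}"
    then have "norm (w - axis j \<xi>) \<le> S" using S by (simp add: u_def)
    then have "norm ((w - axis j \<xi>) $ j) \<le> S"
      by (rule order_trans[OF Finite_Cartesian_Product.norm_nth_le])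
    then show "norm \<xi> \<le> S + norm (w $ j)"
      using norm_triangle_ineq2[of \<xi> "w $ j"] by (simp add: norm_minus_commute axis_def)
  qed
  from cauchy_pompeiu[OF s this, of R] R
  show ?thesis by (simp add: wu) (simp add: u_def axis_def zero_vec_def[symmetric])
qed

section \<open>The multi-Cauchy transform as a convolution\<close>

interpretation lborel_product: product_sigma_finite "\<lambda>_. lborel :: complex measure" ..

abbreviation lborel_pow :: "'n set \<Rightarrow> ('n \<Rightarrow> complex) measure" where
  "lborel_pow I \<equiv> PiM I (\<lambda>_. lborel)"

lemma pair_sigma_finite_lborel_pow:
  "pair_sigma_finite (lborel_pow (I :: 'n::finite set)) (lborel :: 'a::euclidean_space measure)"
proof -
  interpret finite_product_sigma_finite "\<lambda>_. lborel :: complex measure" I by standard simp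
  show ?thesis ..
qed

definition embed :: "'n::finite set \<Rightarrow> ('n \<Rightarrow> complex) \<Rightarrow> complex ^ 'n" where
  "embed I \<xi> = (\<Sum>i\<in>I. axis i (\<xi> i))"

lemma embed_nth [simp]: "embed I \<xi> $ j = (if j \<in> I then \<xi> j else 0)"
  by (simp add: embed_def axis_def sum.delta')

lemma borel_measurable_embed [measurable]:
  fixes I :: "'n::finite set"
  shows "embed I \<in> borel_measurable (lborel_pow I)"
proof -
  have "continuous_on UNIV (axis i :: complex \<Rightarrow> complex ^ 'n)" for i :: 'n
    by (intro linear_continuous_on linear_conv_bounded_linear[THEN iffD1] linearI)
      (auto simp: vec_eq_iff axis_def)
  then have [measurable]: "(axis i :: complex \<Rightarrow> complex ^ 'n) \<in> borel_measurable borel" for i :: 'n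
    by (rule borel_measurable_continuous_onI)
  show ?thesis
    unfolding embed_def[abs_def] by (intro borel_measurable_sum) measurable
qed

text \<open>The factor 1/pi per variable is what remains of (2 \<i>)^l / (2 pi \<i>)^l, the
  form-to-measure factor over the Cauchy constant.\<close>

definition multi_kernel :: "real \<Rightarrow> 'n::finite set \<Rightarrow> ('n \<Rightarrow> complex) \<Rightarrow> complex" where
  "multi_kernel R I \<xi> = (\<Prod>i\<in>I. cauchy_kernel R (\<xi> i) / of_real pi)"

lemma integrable_multi_kernel: "integrable (lborel_pow I) (multi_kernel R I)"
  unfolding multi_kernel_def[abs_def]
  by (rule lborel_product.product_integrable_prod) (auto intro: integrable_cauchy_kernel)

lemma borel_measurable_multi_kernel [measurable]:
  "multi_kernel R I \<in> borel_measurable (lborel_pow I)"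
  using integrable_multi_kernel by (rule borel_measurable_integrable)

text \<open>The transform in the difference variable \<xi> = \<zeta> - z. The domain of integration
  is all of the product space, as it is meant for G extended by zero.\<close>

definition potential :: "real \<Rightarrow> 'n::finite set \<Rightarrow> (complex ^ 'n \<Rightarrow> complex) \<Rightarrow> complex ^ 'n \<Rightarrow> complex" where
  "potential R I G z = (\<integral>\<xi>. multi_kernel R I \<xi> * G (z + embed I \<xi>) \<partial>lborel_pow I)"

definition dual_potential :: "real \<Rightarrow> 'n::finite set \<Rightarrow> (complex ^ 'n \<Rightarrow> complex) \<Rightarrow> complex ^ 'n \<Rightarrow> complex" where
  "dual_potential R I \<psi> w = (\<integral>\<xi>. multi_kernel R I \<xi> * \<psi> (w - embed I \<xi>) \<partial>lborel_pow I)"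

section \<open>Duality of potentials\<close>

lemma integrable_translate:
  fixes f :: "'a::euclidean_space \<Rightarrow> 'b::{banach, second_countable_topology}"
  assumes "integrable lborel f"
  shows "integrable lborel (\<lambda>x. f (c + x))"
  using integrable_distr[of "(+) c" lborel borel f] assms lborel_distr_plus[of c] by simp

lemma AE_translate:
  fixes c :: "'a::euclidean_space"
  assumes "N \<in> null_sets lborel"
  shows "AE x in lborel. c + x \<notin> N"
proof -
  have "AE x in distr lborel borel ((+) c). x \<notin> N"
    unfolding lborel_distr_plus using assms by (rule AE_not_in)
  moreover have "{x. x \<notin> N} \<in> sets borel"
    using assms by (auto simp: null_sets_def Collect_neg_eq)
  ultimately show ?thesis by (subst (asm) AE_distr_iff) auto
qed

text \<open>For fixed \<xi> the z-integral is at most B times the L1 norm of G, by translation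
  invariance; the remaining kernel is integrable in \<xi>. Taking \<psi> = 1 gives integrability of
  the potential itself.\<close>

lemma integrable_potential_pair:
  fixes G \<psi> :: "complex ^ 'n::finite \<Rightarrow> complex"
  assumes G: "integrable lborel G" and [measurable]: "\<psi> \<in> borel_measurable borel"
    and B: "\<And>z. norm (\<psi> z) \<le> B"
  shows "integrable (lborel_pow I \<Otimes>\<^sub>M lborel)
    (\<lambda>(\<xi>, z). multi_kernel R I \<xi> * (G (z + embed I \<xi>) * \<psi> z))"
proof -
  interpret P: pair_sigma_finite "lborel_pow I" "lborel :: (complex ^ 'n) measure"
    by (rule pair_sigma_finite_lborel_pow)
  have [measurable]: "G \<in> borel_measurable borel" using borel_measurable_integrable[OF G] by simp
  have int: "integrable lborel (\<lambda>z. G (z + embed I \<xi>) * \<psi> z)" for \<xi>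
  proof (rule Bochner_Integration.integrable_bound)
    show "integrable lborel (\<lambda>z. B *\<^sub>R G (z + embed I \<xi>))"
      using integrable_translate[OF G, of "embed I \<xi>"] by (simp add: add.commute)
    show "AE z in lborel. norm (G (z + embed I \<xi>) * \<psi> z) \<le> norm (B *\<^sub>R G (z + embed I \<xi>))"
      using B order_trans[OF norm_ge_zero B]
      by (intro AE_I2) (auto simp: norm_mult mult.commute[of "norm (G _)"] intro!: mult_right_mono)
  qed measurable
  have G1: "(\<integral>z. norm (G (z + embed I \<xi>)) \<partial>lborel) = (\<integral>z. norm (G z) \<partial>lborel)" for \<xi>
    using lborel_integral_translate[of "\<lambda>z. norm (G z)" "embed I \<xi>"] by (simp add: add.commute)
  show ?thesis
  proof (rule P.Fubini_integrable)
    have [measurable]: "(\<lambda>p. G (snd p + embed I (fst p))) \<in> borel_measurable (lborel_pow I \<Otimes>\<^sub>M lborel)"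
    proof -
      have "(\<lambda>p. snd p + embed I (fst p)) \<in> borel_measurable (lborel_pow I \<Otimes>\<^sub>M lborel)"
        by measurable
      from measurable_compose[OF this] show ?thesis by simp
    qed
    have [measurable]: "(\<lambda>p. \<psi> (snd p)) \<in> borel_measurable (lborel_pow I \<Otimes>\<^sub>M (lborel :: (complex ^ 'n) measure))"
      by measurable
    show m: "(\<lambda>(\<xi>, z). multi_kernel R I \<xi> * (G (z + embed I \<xi>) * \<psi> z)) \<in> borel_measurable (lborel_pow I \<Otimes>\<^sub>M lborel)"
      unfolding split_beta by measurable
    have le: "(\<integral>z. norm (G (z + embed I \<xi>) * \<psi> z) \<partial>lborel) \<le> B * (\<integral>z. norm (G z) \<partial>lborel)" for \<xi>
    proof -
      have "(\<integral>z. norm (G (z + embed I \<xi>) * \<psi> z) \<partial>lborel) \<le> (\<integral>z. B * norm (G (z + embed I \<xi>)) \<partial>lborel)"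
      proof (rule integral_mono)
        show "integrable lborel (\<lambda>z. norm (G (z + embed I \<xi>) * \<psi> z))" using int by simp
        show "integrable lborel (\<lambda>z. B * norm (G (z + embed I \<xi>)))"
          using integrable_translate[OF G, of "embed I \<xi>"] by (simp add: add.commute)
        show "norm (G (z + embed I \<xi>) * \<psi> z) \<le> B * norm (G (z + embed I \<xi>))" for z
          using B by (auto simp: norm_mult mult.commute[of "norm (G _)"] intro!: mult_right_mono)
      qed
      also have "\<dots> = B * (\<integral>z. norm (G z) \<partial>lborel)" using G1 by simp
      finally show ?thesis .
    qed
    show "integrable (lborel_pow I) (\<lambda>\<xi>. \<integral>z. norm (case (\<xi>, z) of (\<xi>, z) \<Rightarrow> multi_kernel R I \<xi> * (G (z + embed I \<xi>) * \<psi> z)) \<partial>lborel)"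
    proof (rule Bochner_Integration.integrable_bound)
      show "integrable (lborel_pow I) (\<lambda>\<xi>. norm (multi_kernel R I \<xi>) * (B * (\<integral>z. norm (G z) \<partial>lborel)))"
        by (intro integrable_mult_left integrable_norm integrable_multi_kernel)
      show "AE \<xi> in lborel_pow I. norm (\<integral>z. norm (case (\<xi>, z) of (\<xi>, z) \<Rightarrow> multi_kernel R I \<xi> * (G (z + embed I \<xi>) * \<psi> z)) \<partial>lborel)
          \<le> norm (norm (multi_kernel R I \<xi>) * (B * (\<integral>z. norm (G z) \<partial>lborel)))"
      proof (rule AE_I2)
        fix \<xi>
        have "norm (\<integral>z. norm (case (\<xi>, z) of (\<xi>, z) \<Rightarrow> multi_kernel R I \<xi> * (G (z + embed I \<xi>) * \<psi> z)) \<partial>lborel)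
          = norm (multi_kernel R I \<xi>) * (\<integral>z. norm (G (z + embed I \<xi>) * \<psi> z) \<partial>lborel)"
          by (simp add: norm_mult integral_nonneg abs_mult)
        also have "\<dots> \<le> norm (multi_kernel R I \<xi>) * (B * (\<integral>z. norm (G z) \<partial>lborel))"
          by (intro mult_left_mono le) simp
        also have "\<dots> \<le> norm (norm (multi_kernel R I \<xi>) * (B * (\<integral>z. norm (G z) \<partial>lborel)))" by simp
        finally show "norm (\<integral>z. norm (case (\<xi>, z) of (\<xi>, z) \<Rightarrow> multi_kernel R I \<xi> * (G (z + embed I \<xi>) * \<psi> z)) \<partial>lborel)
          \<le> norm (norm (multi_kernel R I \<xi>) * (B * (\<integral>z. norm (G z) \<partial>lborel)))" .
      qed
      show "(\<lambda>\<xi>. \<integral>z. norm (case (\<xi>, z) of (\<xi>, z) \<Rightarrow> multi_kernel R I \<xi> * (G (z + embed I \<xi>) * \<psi> z)) \<partial>lborel) \<in> borel_measurable (lborel_pow I)"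
        using m by (intro lborel.borel_measurable_lebesgue_integral) (simp add: split_beta)
    qed
    show "AE \<xi> in lborel_pow I. integrable lborel (\<lambda>z. case (\<xi>, z) of (\<xi>, z) \<Rightarrow> multi_kernel R I \<xi> * (G (z + embed I \<xi>) * \<psi> z))"
      using int by simp
  qed
qed

lemma integrable_potential:
  assumes "integrable lborel G"
  shows "integrable lborel (potential R I G)"
proof -
  interpret P: pair_sigma_finite "lborel_pow I" "lborel :: (complex ^ 'a) measure"
    by (rule pair_sigma_finite_lborel_pow)
  show ?thesis
    using P.integrable_snd[OF integrable_potential_pair[OF assms, of "\<lambda>_. 1" 1 I R]]
    by (simp add: potential_def[abs_def])
qed

lemma potential_duality:
  fixes G \<psi> :: "complex ^ 'n::finite \<Rightarrow> complex"
  assumes G: "integrable lborel G" and \<psi>: "\<psi> \<in> borel_measurable borel" "\<And>z. norm (\<psi> z) \<le> B"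
  shows "(\<integral>z. potential R I G z * \<psi> z \<partial>lborel) = (\<integral>w. G w * dual_potential R I \<psi> w \<partial>lborel)"
proof -
  interpret P: pair_sigma_finite "lborel_pow I" "lborel :: (complex ^ 'n) measure"
    by (rule pair_sigma_finite_lborel_pow)
  note [measurable] = \<psi>(1)
  have [measurable]: "G \<in> borel_measurable borel" using borel_measurable_integrable[OF G] by simp
  have i1: "integrable (lborel_pow I \<Otimes>\<^sub>M lborel) (\<lambda>(\<xi>, z). multi_kernel R I \<xi> * (G (z + embed I \<xi>) * \<psi> z))"
    by (rule integrable_potential_pair[OF G \<psi>])
  have shift: "(\<integral>z. G (z + embed I \<xi>) * \<psi> z \<partial>lborel) = (\<integral>w. G w * \<psi> (w - embed I \<xi>) \<partial>lborel)" for \<xi>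
    using lborel_integral_translate[of "\<lambda>w. G w * \<psi> (w - embed I \<xi>)" "embed I \<xi>"]
    by (simp add: add.commute)
  \<comment> \<open>The translation depends on \<xi>, so integrability on the product is verified
    anew after it. The integrand is now bounded by B times a product of separated variables.\<close>
  have i2: "integrable (lborel_pow I \<Otimes>\<^sub>M lborel) (\<lambda>(\<xi>, w). multi_kernel R I \<xi> * (G w * \<psi> (w - embed I \<xi>)))"
  proof (rule Bochner_Integration.integrable_bound)
    have m1: "(\<lambda>p. \<psi> (snd p - embed I (fst p))) \<in> borel_measurable (lborel_pow I \<Otimes>\<^sub>M lborel)"
    proof -
      have "(\<lambda>p. snd p - embed I (fst p)) \<in> borel_measurable (lborel_pow I \<Otimes>\<^sub>M lborel)"
        by measurable
      from measurable_compose[OF this] show ?thesis by simp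
    qed
    have m2: "(\<lambda>p. G (snd p)) \<in> borel_measurable (lborel_pow I \<Otimes>\<^sub>M (lborel :: (complex ^ 'n) measure))"
      by measurable
    have m3: "(\<lambda>p. multi_kernel R I (fst p)) \<in> borel_measurable (lborel_pow I \<Otimes>\<^sub>M (lborel :: (complex ^ 'n) measure))"
      by measurable
    show "(\<lambda>(\<xi>, w). multi_kernel R I \<xi> * (G w * \<psi> (w - embed I \<xi>))) \<in> borel_measurable (lborel_pow I \<Otimes>\<^sub>M lborel)"
      unfolding split_beta by (intro borel_measurable_times m1 m2 m3)
    have "integrable (lborel_pow I \<Otimes>\<^sub>M lborel) (\<lambda>p. multi_kernel R I (fst p) * G (snd p))"
    proof (rule P.Fubini_integrable)
      show "(\<lambda>p. multi_kernel R I (fst p) * G (snd p)) \<in> borel_measurable (lborel_pow I \<Otimes>\<^sub>M lborel)"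
        by (intro borel_measurable_times m2 m3)
      show "integrable (lborel_pow I) (\<lambda>\<xi>. \<integral>w. norm (multi_kernel R I (fst (\<xi>, w)) * G (snd (\<xi>, w))) \<partial>lborel)"
        by (simp add: norm_mult integrable_norm[OF integrable_multi_kernel])
      show "AE \<xi> in lborel_pow I. integrable lborel (\<lambda>w. multi_kernel R I (fst (\<xi>, w)) * G (snd (\<xi>, w)))"
        using G by simp
    qed
    then show "integrable (lborel_pow I \<Otimes>\<^sub>M lborel) (\<lambda>p. norm (multi_kernel R I (fst p) * G (snd p)) * B)"
      by simp
    show "AE p in lborel_pow I \<Otimes>\<^sub>M lborel. norm (case p of (\<xi>, w) \<Rightarrow> multi_kernel R I \<xi> * (G w * \<psi> (w - embed I \<xi>)))
      \<le> norm (norm (multi_kernel R I (fst p) * G (snd p)) * B)"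
      using \<psi>(2) order_trans[OF norm_ge_zero \<psi>(2)]
      by (intro AE_I2) (auto simp: norm_mult mult.assoc intro!: mult_left_mono)
  qed
  have "(\<integral>z. potential R I G z * \<psi> z \<partial>lborel)
      = (\<integral>z. \<integral>\<xi>. multi_kernel R I \<xi> * (G (z + embed I \<xi>) * \<psi> z) \<partial>lborel_pow I \<partial>lborel)"
    unfolding potential_def by (simp flip: integral_mult_left_zero add: mult.assoc)
  also have "\<dots> = (\<integral>\<xi>. \<integral>z. multi_kernel R I \<xi> * (G (z + embed I \<xi>) * \<psi> z) \<partial>lborel \<partial>lborel_pow I)"
    by (rule P.Fubini_integral[OF i1])
  also have "\<dots> = (\<integral>\<xi>. \<integral>w. multi_kernel R I \<xi> * (G w * \<psi> (w - embed I \<xi>)) \<partial>lborel \<partial>lborel_pow I)"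
    using shift by simp
  also have "\<dots> = (\<integral>w. \<integral>\<xi>. multi_kernel R I \<xi> * (G w * \<psi> (w - embed I \<xi>)) \<partial>lborel_pow I \<partial>lborel)"
    by (rule P.Fubini_integral[OF i2, symmetric])
  also have "\<dots> = (\<integral>w. G w * dual_potential R I \<psi> w \<partial>lborel)"
    unfolding dual_potential_def by (simp flip: integral_mult_right_zero add: mult.left_commute)
  finally show ?thesis .
qed

section \<open>From the Cauchy transform to the potential\<close>

lemma distr_lborel_pow_translate:
  fixes c :: "'n::finite \<Rightarrow> complex"
  shows "distr (lborel_pow I) (lborel_pow I) (\<lambda>\<zeta>. \<lambda>i\<in>I. c i + \<zeta> i) = lborel_pow I"
proof (rule lborel_product.PiM_eqI)
  have m: "(\<lambda>\<zeta>. \<lambda>i\<in>I. c i + \<zeta> i) \<in> lborel_pow I \<rightarrow>\<^sub>M lborel_pow I"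
    by (intro measurable_restrict) measurable
  fix A :: "'n \<Rightarrow> complex set" assume A: "\<And>i. i \<in> I \<Longrightarrow> A i \<in> sets lborel"
  have "(\<lambda>\<zeta>. \<lambda>i\<in>I. c i + \<zeta> i) -` Pi\<^sub>E I A \<inter> space (lborel_pow I) = Pi\<^sub>E I (\<lambda>i. (+) (c i) -` A i)"
    by (auto simp: space_PiM PiE_def Pi_def)
  then have "emeasure (distr (lborel_pow I) (lborel_pow I) (\<lambda>\<zeta>. \<lambda>i\<in>I. c i + \<zeta> i)) (Pi\<^sub>E I A)
      = emeasure (lborel_pow I) (Pi\<^sub>E I (\<lambda>i. (+) (c i) -` A i))"
    using A by (subst emeasure_distr[OF m]) (auto intro!: sets_PiM_I_finite)
  also have "\<dots> = (\<Prod>i\<in>I. emeasure lborel ((+) (c i) -` A i))"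
  proof (rule lborel_product.emeasure_PiM)
    show "(+) (c i) -` A i \<in> sets lborel" if "i \<in> I" for i
      using measurable_sets[of "(+) (c i)" borel borel "A i"] A[OF that] by simp
  qed simp
  also have "\<dots> = (\<Prod>i\<in>I. emeasure lborel (A i))"
  proof (rule prod.cong[OF refl])
    fix i assume "i \<in> I"
    have "emeasure (distr lborel borel ((+) (c i))) (A i) = emeasure lborel ((+) (c i) -` A i)"
      using A[OF \<open>i \<in> I\<close>] by (subst emeasure_distr) auto
    then show "emeasure lborel ((+) (c i) -` A i) = emeasure lborel (A i)"
      unfolding lborel_distr_plus by simp
  qed
  finally show "emeasure (distr (lborel_pow I) (lborel_pow I) (\<lambda>\<zeta>. \<lambda>i\<in>I. c i + \<zeta> i)) (Pi\<^sub>E I A)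
      = (\<Prod>i\<in>I. emeasure lborel (A i))" .
qed simp_all

text \<open>Integrands built from a Lebesgue measurable g, or from T f, get their measurability only
  through almost everywhere equality with a Borel expression; the completed measure allows this
  transfer.\<close>

lemma borel_measurable_completion_cong_AE:
  assumes f: "f \<in> borel_measurable (completion M)" and ae: "AE x in M. f x = g x"
  shows "g \<in> borel_measurable (completion M)"
proof (rule measurableI)
  fix A :: "'b set" assume A: "A \<in> sets borel"
  have 1: "{x \<in> space M. f x \<in> A} \<in> sets (completion M)"
    using measurable_sets[OF f A] by (simp add: vimage_def Int_def conj_commute)
  \<comment> \<open>Any subset of the exceptional set is measurable for the completion, so no
    condition on Q is required.\<close>
  have 2: "{x \<in> space M. f x \<noteq> g x \<and> Q x} \<in> sets (completion M)" for Q
  proof -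
    have "Measurable.pred (completion M) (\<lambda>x. f x \<noteq> g x \<and> Q x)"
      using ae by (intro sets_completion_AE) (auto elim: eventually_mono)
    then show ?thesis by (simp add: pred_def)
  qed
  have "{x \<in> space M. f x \<in> A} - {x \<in> space M. f x \<noteq> g x \<and> True}
      \<union> {x \<in> space M. f x \<noteq> g x \<and> g x \<in> A} \<in> sets (completion M)"
    by (intro sets.Un sets.Diff 1 2)
  also have "{x \<in> space M. f x \<in> A} - {x \<in> space M. f x \<noteq> g x \<and> True}
      \<union> {x \<in> space M. f x \<noteq> g x \<and> g x \<in> A} = g -` A \<inter> space (completion M)"
    by auto
  finally show "g -` A \<inter> space (completion M) \<in> sets (completion M)" .
qed simp

text \<open>A Borel representative, almost everywhere zero off U, makes the convolution integrands
  jointly measurable. Real and imaginary parts are treated separately, as the selection result is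
  applied to real functions.\<close>

lemma absolutely_integrable_borel_version:
  fixes g :: "'a::euclidean_space \<Rightarrow> complex"
  assumes "g absolutely_integrable_on U"
  obtains G where "integrable lborel G" "AE z in lborel. indicator U z *\<^sub>R g z = G z"
proof -
  let ?h = "\<lambda>z. indicator U z *\<^sub>R g z"
  have h: "integrable lebesgue ?h" using assms by (simp add: set_integrable_def)
  then have [measurable]: "?h \<in> borel_measurable lebesgue" by (rule borel_measurable_integrable)
  have "(\<lambda>z. Re (?h z)) \<in> borel_measurable lebesgue" "(\<lambda>z. Im (?h z)) \<in> borel_measurable lebesgue"
    by measurable
  note m = this
  obtain r where r: "r \<in> borel_measurable lborel" "AE z in lborel. Re (?h z) = r z"
    using completion_ex_borel_measurable_real[OF m(1)] by blast
  obtain s where s: "s \<in> borel_measurable lborel" "AE z in lborel. Im (?h z) = s z"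
    using completion_ex_borel_measurable_real[OF m(2)] by blast
  define G where "G z = of_real (r z) + \<i> * of_real (s z)" for z
  have G: "G \<in> borel_measurable lborel" unfolding G_def using r(1) s(1) by measurable
  have ae: "AE z in lborel. ?h z = G z"
    using r(2) s(2) by eventually_elim (simp add: complex_eq_iff G_def)
  have "integrable lebesgue G"
    by (rule integrable_cong_AE_imp[OF h])
      (use G AE_completion[OF ae] in \<open>auto intro: measurable_completion elim!: eventually_mono\<close>)
  then have "integrable lborel G" using integrable_completion[OF G] by simp
  then show ?thesis using ae by (rule that)
qed

text \<open>The transform sees g only on sections, so a null set where g and G differ could matter
  for a particular z. By Fubini, almost every z has sections on which the difference is
  negligible.\<close>

lemma cauchy_transform_eq_potential:
  fixes g :: "complex ^ 'n::finite \<Rightarrow> complex"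
  assumes G: "integrable lborel G" "AE z in lborel. indicator (prod_domain D) z *\<^sub>R g z = G z"
    and R: "\<And>i z w. z \<in> D i \<Longrightarrow> w \<in> D i \<Longrightarrow> norm (z - w) \<le> R"
  shows "AE z in lborel. z \<in> prod_domain D \<longrightarrow> cauchy_transform D I g z = potential R I G z"
proof -
  interpret P: pair_sigma_finite "lborel_pow I" "lborel :: (complex ^ 'n) measure"
    by (rule pair_sigma_finite_lborel_pow)
  have [measurable]: "G \<in> borel_measurable borel" using borel_measurable_integrable[OF G(1)] by simp
  let ?U = "prod_domain D"
  obtain N where N: "N \<in> null_sets lborel" "\<And>z. z \<notin> N \<Longrightarrow> indicator ?U z *\<^sub>R g z = G z"
    using AE_E3[OF G(2)] by auto
  have [measurable]: "N \<in> sets borel" using N(1) by (auto simp: null_sets_def)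
  \<comment> \<open>For each fixed \<xi> the translate of \<open>N\<close> is null; exchanging the
    order of the two almost everywhere statements gives the version for almost every z.\<close>
  have "AE \<xi> in lborel_pow I. AE z in lborel. z + embed I \<xi> \<notin> N"
    by (rule AE_I2, subst add.commute, rule AE_translate[OF N(1)])
  moreover have "{x \<in> space (lborel_pow I \<Otimes>\<^sub>M lborel). (\<lambda>\<xi> z. z + embed I \<xi> \<notin> N) (fst x) (snd x)} \<in> sets (lborel_pow I \<Otimes>\<^sub>M lborel)"
  proof -
    have "(\<lambda>p. snd p + embed I (fst p)) \<in> borel_measurable (lborel_pow I \<Otimes>\<^sub>M lborel)"
      by measurable
    from measurable_sets[OF this, of "- N"] show ?thesis
      by (simp add: vimage_def Int_def conj_commute)
  qed
  ultimately have "AE z in lborel. AE \<xi> in lborel_pow I. z + embed I \<xi> \<notin> N"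
    using P.AE_commute[of "\<lambda>\<xi> z. z + embed I \<xi> \<notin> N"] by simp
  then show ?thesis
  proof eventually_elim
    fix z assume ae: "AE \<xi> in lborel_pow I. z + embed I \<xi> \<notin> N"
    show "z \<in> ?U \<longrightarrow> cauchy_transform D I g z = potential R I G z"
    proof
      assume z: "z \<in> ?U"
      let ?S = "\<lambda>\<zeta>. \<lambda>i\<in>I. - z $ i + \<zeta> i"
      \<comment> \<open>\<open>?c\<close> cancels the prefactor in the definition of
        \<open>cauchy_transform\<close>: the 1/pi in \<open>multi_kernel\<close> turns it into the
        (2 \<i>)^l of the volume form.\<close>
      let ?c = "(2 * \<i> * of_real pi) ^ card I"
      have S: "?S \<in> lborel_pow I \<rightarrow>\<^sub>M lborel_pow I"
        by (intro measurable_restrict) measurable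
      note distrS = distr_lborel_pow_translate[of I "\<lambda>i. - z $ i"]
      define H where "H \<xi> = ?c * (multi_kernel R I \<xi> * G (z + embed I \<xi>))" for \<xi>
      have H: "H \<in> borel_measurable (lborel_pow I)"
      proof -
        have "(\<lambda>\<xi>. z + embed I \<xi>) \<in> borel_measurable (lborel_pow I)" by measurable
        then have "(\<lambda>\<xi>. G (z + embed I \<xi>)) \<in> borel_measurable (lborel_pow I)"
          by (rule measurable_compose) simp
        then show ?thesis unfolding H_def[abs_def] by (intro borel_measurable_times) auto
      qed
      define F where "F \<zeta> = indicator (\<Pi>\<^sub>E i\<in>I. D i) \<zeta> *\<^sub>R
        (g (\<chi> i. if i \<in> I then \<zeta> i else z $ i) / (\<Prod>i\<in>I. \<zeta> i - z $ i) * (2 * \<i>) ^ card I)" for \<zeta>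
      have "AE \<xi> in distr (lborel_pow I) (lborel_pow I) ?S. z + embed I \<xi> \<notin> N"
        unfolding distrS by (rule ae)
      moreover have "{\<xi> \<in> space (lborel_pow I). z + embed I \<xi> \<notin> N} \<in> sets (lborel_pow I)"
      proof -
        have "(\<lambda>\<xi>. z + embed I \<xi>) \<in> borel_measurable (lborel_pow I)" by measurable
        from measurable_sets[OF this, of "- N"] show ?thesis
          by (simp add: vimage_def Int_def conj_commute)
      qed
      ultimately have "AE \<zeta> in lborel_pow I. z + embed I (?S \<zeta>) \<notin> N"
        by (subst (asm) AE_distr_iff[OF S])
      then have aeF: "AE \<zeta> in lborel_pow I. H (?S \<zeta>) = F \<zeta>"
      proof (rule AE_mp, intro AE_I2 impI)
        fix \<zeta> assume sp: "\<zeta> \<in> space (lborel_pow I)" and nN: "z + embed I (?S \<zeta>) \<notin> N"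
        define w where "w = z + embed I (?S \<zeta>)"
        have w: "w = (\<chi> i. if i \<in> I then \<zeta> i else z $ i)"
          by (simp add: vec_eq_iff w_def)
        \<comment> \<open>The coordinates outside I are those of z, which lies in D; membership of w
          is therefore decided by the variables \<zeta>.\<close>
        have wU: "w \<in> ?U \<longleftrightarrow> \<zeta> \<in> (\<Pi>\<^sub>E i\<in>I. D i)"
          using sp z by (auto simp: w prod_domain_def space_PiM PiE_def Pi_def)
        have Gw: "G w = indicator ?U w *\<^sub>R g w" using N(2) nN by (simp add: w_def)
        show "H (?S \<zeta>) = F \<zeta>"
        proof (cases "w \<in> ?U")
          case False
          then show ?thesis using wU Gw by (simp add: H_def F_def w_def)
        next
          case True
          \<comment> \<open>Both points lie in \<open>D i\<close>, whose diameter is at most R, so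
            the truncation is not felt. On the diagonal both sides are 0, by division by
            zero.\<close>
          have "cauchy_kernel R (\<zeta> i - z $ i) = 1 / (\<zeta> i - z $ i)" if "i \<in> I" for i
          proof -
            have "\<zeta> i \<in> D i" "z $ i \<in> D i" using True z that wU by (auto simp: prod_domain_def)
            from R[OF this] show ?thesis by (simp add: cauchy_kernel_def)
          qed
          then have "multi_kernel R I (?S \<zeta>) = (\<Prod>i\<in>I. 1 / (\<zeta> i - z $ i) / of_real pi)"
            by (auto simp: multi_kernel_def intro!: prod.cong)
          also have "\<dots> = 1 / (\<Prod>i\<in>I. \<zeta> i - z $ i) / of_real pi ^ card I"
            by (simp add: prod_dividef prod.distrib)
          finally have mk: "multi_kernel R I (?S \<zeta>) = 1 / (\<Prod>i\<in>I. \<zeta> i - z $ i) / of_real pi ^ card I" .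
          have "H (?S \<zeta>) = ?c * (1 / (\<Prod>i\<in>I. \<zeta> i - z $ i) / of_real pi ^ card I * g w)"
            using True Gw unfolding H_def mk w_def[symmetric] by simp
          also have "\<dots> = g w / (\<Prod>i\<in>I. \<zeta> i - z $ i) * (2 * \<i>) ^ card I"
            by (simp add: power_mult_distrib)
          also have "\<dots> = F \<zeta>"
            using True wU unfolding F_def w[symmetric] by simp
          finally show ?thesis .
        qed
      qed
      have HS: "(\<lambda>\<zeta>. H (?S \<zeta>)) \<in> borel_measurable (lborel_pow I)"
        by (rule measurable_compose[OF S H])
      have "(\<integral>\<zeta>. F \<zeta> \<partial>completion (lborel_pow I)) = (\<integral>\<zeta>. H (?S \<zeta>) \<partial>completion (lborel_pow I))"
      proof (rule integral_cong_AE)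
        show "(\<lambda>\<zeta>. H (?S \<zeta>)) \<in> borel_measurable (completion (lborel_pow I))"
          using HS by (rule measurable_completion)
        then show "F \<in> borel_measurable (completion (lborel_pow I))"
          using aeF by (rule borel_measurable_completion_cong_AE)
        show "AE \<zeta> in completion (lborel_pow I). F \<zeta> = H (?S \<zeta>)"
          using AE_completion[OF aeF] by eventually_elim simp
      qed
      also have "\<dots> = (\<integral>\<zeta>. H (?S \<zeta>) \<partial>lborel_pow I)"
        by (rule integral_completion[OF HS])
      also have "\<dots> = (\<integral>\<xi>. H \<xi> \<partial>lborel_pow I)"
        using integral_distr[OF S H] unfolding distrS by simp
      also have "\<dots> = ?c * potential R I G z"
        by (simp add: H_def potential_def)
      finally have "(\<integral>\<zeta>. F \<zeta> \<partial>completion (lborel_pow I)) = ?c * potential R I G z" .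
      then show "cauchy_transform D I g z = potential R I G z"
        unfolding cauchy_transform_def set_lebesgue_integral_def F_def[symmetric]
        by (simp add: mult_ac power_mult_distrib)
    qed
  qed
qed

section \<open>The dbar equation\<close>

lemma smooth_dual_potential:
  "smooth \<phi> \<Longrightarrow> bounded {z. \<phi> z \<noteq> 0} \<Longrightarrow> smooth (dual_potential R I \<phi>)"
  unfolding dual_potential_def[abs_def]
  by (rule smooth_conv[OF _ _ integrable_multi_kernel borel_measurable_embed])

lemma dbar_dual_potential:
  "smooth \<phi> \<Longrightarrow> bounded {z. \<phi> z \<noteq> 0} \<Longrightarrow> dbar j (dual_potential R I \<phi>) = dual_potential R I (dbar j \<phi>)"
  unfolding dual_potential_def[abs_def]
  by (rule ext) (rule dbar_conv[OF _ _ integrable_multi_kernel borel_measurable_embed])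

lemma norm_dual_potential_le:
  assumes "continuous_on UNIV \<psi>" "bounded {z. \<psi> z \<noteq> 0}" "\<And>z. norm (\<psi> z) \<le> B"
  shows "norm (dual_potential R I \<psi> w) \<le> (\<integral>\<xi>. norm (multi_kernel R I \<xi>) \<partial>lborel_pow I) * B"
proof -
  have "norm (dual_potential R I \<psi> w) \<le> (\<integral>\<xi>. norm (multi_kernel R I \<xi>) * B \<partial>lborel_pow I)"
    unfolding dual_potential_def
  proof (rule order_trans[OF integral_norm_bound integral_mono])
    show "integrable (lborel_pow I) (\<lambda>\<xi>. norm (multi_kernel R I \<xi> * \<psi> (w - embed I \<xi>)))"
      by (intro integrable_norm integrable_conv assms integrable_multi_kernel borel_measurable_embed)
    show "integrable (lborel_pow I) (\<lambda>\<xi>. norm (multi_kernel R I \<xi>) * B)"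
      by (intro integrable_mult_left integrable_norm integrable_multi_kernel)
    show "norm (multi_kernel R I \<xi> * \<psi> (w - embed I \<xi>)) \<le> norm (multi_kernel R I \<xi>) * B" for \<xi>
      unfolding norm_mult by (intro mult_left_mono assms) simp
  qed
  then show ?thesis by simp
qed

text \<open>Together with \<open>dual_potential_insert_dbar\<close> for the empty set, this turns
  the surviving term of the sum into the pairing of f_j with \<phi>.\<close>

lemma dual_potential_empty: "dual_potential R {} \<phi> = \<phi>"
  by (rule ext) (simp add: dual_potential_def PiM_empty multi_kernel_def embed_def
      lebesgue_integral_count_space_finite)

text \<open>Integrate over the new variable first. As j is not in I, the shift by
  \<open>embed I \<xi>\<close> leaves the coordinate w_j alone; for w in D a nonzero integrand puts
  w_j and w_j - y into D_j, so |y| \<le> R and the truncated kernel satisfies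
  Cauchy--Pompeiu.\<close>

lemma dual_potential_insert_dbar:
  fixes \<phi> :: "complex ^ 'n::finite \<Rightarrow> complex"
  assumes \<phi>: "test_fun (prod_domain D) \<phi>" and j: "j \<notin> I" and w: "w \<in> prod_domain D"
    and R: "\<And>i z w. z \<in> D i \<Longrightarrow> w \<in> D i \<Longrightarrow> norm (z - w) \<le> R"
  shows "dual_potential R (insert j I) (dbar j \<phi>) w = dual_potential R I \<phi> w"
proof -
  note s = test_fun_smooth[OF \<phi>] test_fun_bounded_support[OF \<phi>]
  note t = test_fun_dbar[OF \<phi>, of j]
  have int: "integrable (lborel_pow (insert j I)) (\<lambda>\<xi>. multi_kernel R (insert j I) \<xi> * dbar j \<phi> (w - embed (insert j I) \<xi>))"
    by (intro integrable_conv smooth_continuous test_fun_smooth[OF t] test_fun_bounded_support[OF t]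
        integrable_multi_kernel borel_measurable_embed)
  have mk: "multi_kernel R (insert j I) (\<xi>(j := y)) = multi_kernel R I \<xi> * (cauchy_kernel R y / of_real pi)" for \<xi> y
  proof -
    have "multi_kernel R (insert j I) (\<xi>(j := y)) = (cauchy_kernel R y / of_real pi) * multi_kernel R I (\<xi>(j := y))"
      using j by (simp add: multi_kernel_def)
    also have "multi_kernel R I (\<xi>(j := y)) = multi_kernel R I \<xi>"
      using j by (auto simp: multi_kernel_def intro!: prod.cong)
    finally show ?thesis by (simp only: mult.commute)
  qed
  have em: "w - embed (insert j I) (\<xi>(j := y)) = (w - embed I \<xi>) - axis j y" for \<xi> y
    using j by (auto simp: vec_eq_iff axis_def)
  have cp: "(\<integral>y. cauchy_kernel R y * dbar j \<phi> ((w - embed I \<xi>) - axis j y) \<partial>lborel) = of_real pi * \<phi> (w - embed I \<xi>)" for \<xi>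
  proof (rule cauchy_pompeiu_axis[OF s])
    fix y assume "dbar j \<phi> ((w - embed I \<xi>) - axis j y) \<noteq> 0"
    then have "(w - embed I \<xi>) - axis j y \<in> prod_domain D"
      using test_fun_outside[OF t] by blast
    then have "((w - embed I \<xi>) - axis j y) $ j \<in> D j" "w $ j \<in> D j"
      using w unfolding prod_domain_def by blast+
    from R[OF this] show "norm y \<le> R"
      using j by (simp add: axis_def norm_minus_commute)
  qed
  have "dual_potential R (insert j I) (dbar j \<phi>) w
     = (\<integral>\<xi>. \<integral>y. multi_kernel R (insert j I) (\<xi>(j := y)) * dbar j \<phi> (w - embed (insert j I) (\<xi>(j := y))) \<partial>lborel \<partial>lborel_pow I)"
    unfolding dual_potential_def
    by (rule lborel_product.product_integral_insert[OF _ j int]) simp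
  also have "\<dots> = (\<integral>\<xi>. \<integral>y. (multi_kernel R I \<xi> / of_real pi) * (cauchy_kernel R y * dbar j \<phi> ((w - embed I \<xi>) - axis j y)) \<partial>lborel \<partial>lborel_pow I)"
    unfolding mk em by (simp add: mult_ac)
  also have "\<dots> = (\<integral>\<xi>. (multi_kernel R I \<xi> / of_real pi) * (of_real pi * \<phi> (w - embed I \<xi>)) \<partial>lborel_pow I)"
    by (simp only: integral_mult_right_zero cp)
  also have "\<dots> = dual_potential R I \<phi> w"
    by (simp add: dual_potential_def)
  finally show ?thesis .
qed

section \<open>Cutoffs independent of one variable\<close>

lemma frechet_derivative_invariant_direction:
  assumes "smooth \<phi>" and inv: "\<And>t::real. \<phi> (z + t *\<^sub>R v) = \<phi> z"
  shows "frechet_derivative \<phi> (at z) v = 0"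
proof -
  have lin: "bounded_linear (\<lambda>t::real. t *\<^sub>R v)" by (rule bounded_linear_scaleR_left)
  have "((\<lambda>t::real. \<phi> (z + t *\<^sub>R v)) has_derivative (\<lambda>t. frechet_derivative \<phi> (at (z + 0 *\<^sub>R v)) (t *\<^sub>R v))) (at 0)"
    by (rule has_derivative_compose[OF has_derivative_affine[OF lin] smooth_has_derivative[OF assms(1)]])
  then have "((\<lambda>t::real. \<phi> z) has_derivative (\<lambda>t. frechet_derivative \<phi> (at z) (t *\<^sub>R v))) (at 0)"
    by (simp add: inv)
  then have "(\<lambda>t. frechet_derivative \<phi> (at z) (t *\<^sub>R v)) = (\<lambda>t. 0)"
    by (rule has_derivative_unique) simp
  from fun_cong[OF this, of 1] show ?thesis by simp
qed

text \<open>The Leibniz term with the derivative of \<eta> drops out. Derivatives of cutoffs could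
  blow up near the boundary; without them the cutoffs can be removed in the limit.\<close>

lemma dbar_mult_invariant:
  assumes "smooth \<eta>" "smooth \<phi>" and inv: "\<And>z a. \<eta> (z + axis j a) = \<eta> z"
  shows "dbar j (\<lambda>z. \<eta> z * \<phi> z) z = \<eta> z * dbar j \<phi> z"
proof -
  have ax: "t *\<^sub>R axis j a = axis j (t *\<^sub>R a)" for t and a :: complex
    by (simp add: vec_eq_iff axis_def)
  have "frechet_derivative \<eta> (at z) (axis j a) = 0" for a
    by (rule frechet_derivative_invariant_direction[OF assms(1)]) (simp add: ax inv)
  then show ?thesis
    unfolding dbar_def
      frechet_derivative_at[OF has_derivative_mult[OF smooth_has_derivative[OF assms(1)] smooth_has_derivative[OF assms(2)]], symmetric]
    by (simp add: field_simps)
qed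

lemma compact_prod_domain:
  fixes C :: "'n::finite \<Rightarrow> complex set"
  assumes "\<And>i. compact (C i)"
  shows "compact (prod_domain C)"
proof -
  have "closed (prod_domain C)"
    unfolding prod_domain_def
    by (intro closed_Collect_all closed_Collect_const)
      (use assms compact_imp_closed in \<open>auto intro!: closed_vimage_vec_nth simp: vimage_def[symmetric]\<close>)
  moreover have "\<exists>B. \<forall>z\<in>C i. norm z \<le> B" for i
    by (meson assms bounded_iff compact_imp_bounded)
  then obtain B where B: "\<And>i z. z \<in> C i \<Longrightarrow> norm z \<le> B i" by metis
  have "bounded (prod_domain C)"
  proof (rule boundedI)
    fix z assume "z \<in> prod_domain C"
    then have "(\<Sum>i\<in>UNIV. norm (z $ i)) \<le> (\<Sum>i\<in>UNIV. B i)"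
      by (intro sum_mono B) (simp add: prod_domain_def)
    then show "norm z \<le> (\<Sum>i\<in>UNIV. B i)"
      unfolding norm_vec_def by (intro order_trans[OF L2_set_le_sum]) auto
  qed
  ultimately show ?thesis by (simp add: compact_eq_bounded_closed)
qed

text \<open>
  The function \<open>dual_potential R I \<phi>\<close> is not compactly supported in the variables in \<open>I\<close>; as it is
  differentiated in another variable \<open>j\<close> only, cutoffs not depending on \<open>z\<^sub>j\<close> suffice.
\<close>

lemma cutoff_dual_potential:
  fixes \<phi> :: "complex ^ 'n::finite \<Rightarrow> complex"
  assumes D: "\<And>i. open (D i)" and \<phi>: "test_fun (prod_domain D) \<phi>" and j: "j \<notin> I"
  obtains \<eta> :: "nat \<Rightarrow> complex ^ 'n \<Rightarrow> complex"
  where "\<And>k. smooth (\<eta> k)" "\<And>k z. norm (\<eta> k z) \<le> 1" "\<And>k z a. \<eta> k (z + axis j a) = \<eta> k z"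
    "\<And>z. z \<in> prod_domain D \<Longrightarrow> (\<lambda>k. \<eta> k z) \<longlonglongrightarrow> 1"
    "\<And>k. test_fun (prod_domain D) (\<lambda>z. \<eta> k z * dual_potential R I \<phi> z)"
proof -
  have "\<exists>(\<chi>' :: nat \<Rightarrow> complex \<Rightarrow> complex) K. (\<forall>k. smooth (\<chi>' k)) \<and> (\<forall>k x. norm (\<chi>' k x) \<le> 1) \<and>
      (\<forall>k. compact (K k)) \<and> (\<forall>k. K k \<subseteq> D i) \<and> (\<forall>k x. \<chi>' k x \<noteq> 0 \<longrightarrow> x \<in> K k) \<and>
      (\<forall>x\<in>D i. (\<lambda>k. \<chi>' k x) \<longlonglongrightarrow> 1)" for i
    using smooth_cutoff_sequence[OF D, of i] by metis
  then obtain \<kappa> :: "'n \<Rightarrow> nat \<Rightarrow> complex \<Rightarrow> complex" and K where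
    \<kappa>: "\<And>i k. smooth (\<kappa> i k)" "\<And>i k x. norm (\<kappa> i k x) \<le> 1" "\<And>i k. compact (K i k)" "\<And>i k. K i k \<subseteq> D i"
      "\<And>i k x. \<kappa> i k x \<noteq> 0 \<Longrightarrow> x \<in> K i k" "\<And>i x. x \<in> D i \<Longrightarrow> (\<lambda>k. \<kappa> i k x) \<longlonglongrightarrow> 1"
    by metis
  define \<eta> where "\<eta> k z = (\<Prod>i\<in>- {j}. \<kappa> i k (z $ i))" for k and z :: "complex ^ 'n"
  note s = test_fun_smooth[OF \<phi>] test_fun_bounded_support[OF \<phi>]
  show ?thesis
  proof (rule that[of \<eta>])
    show sm: "smooth (\<eta> k)" for k
      unfolding smooth_def \<eta>_def[abs_def]
    proof (intro allI Ck_prod)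
      fix m i
      show "Ck m (\<lambda>z::complex ^ 'n. \<kappa> i k (z $ i))"
        using Ck_compose_affine[OF bounded_linear_vec_nth smooth_imp_Ck[OF \<kappa>(1)], of m i k 0 i] by simp
    qed
    show "norm (\<eta> k z) \<le> 1" for k z
      unfolding \<eta>_def prod_norm[symmetric] by (intro prod_le_1) (simp add: \<kappa>(2))
    show "\<eta> k (z + axis j a) = \<eta> k z" for k z a
      unfolding \<eta>_def by (intro prod.cong) (auto simp: axis_def)
    show "(\<lambda>k. \<eta> k z) \<longlonglongrightarrow> 1" if "z \<in> prod_domain D" for z
    proof -
      have "(\<lambda>k. \<eta> k z) \<longlonglongrightarrow> (\<Prod>i\<in>- {j}. 1)"
        unfolding \<eta>_def by (intro tendsto_prod \<kappa>(6)) (use that in \<open>simp add: prod_domain_def\<close>)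
      then show ?thesis by simp
    qed
    show "test_fun (prod_domain D) (\<lambda>z. \<eta> k z * dual_potential R I \<phi> z)" for k
    proof -
      define S where "S = closure {z. \<phi> z \<noteq> 0}"
      have S: "compact S" "S \<subseteq> prod_domain D" using \<phi> by (simp_all add: test_fun_def S_def)
      \<comment> \<open>In direction j compactness comes from the support of \<phi>, since j is not
        in I and the dual potential does not spread it there; in all other directions it comes from
        the cutoffs.\<close>
      define C where "C i = (if i = j then (\<lambda>z. z $ j) ` S else K i k)" for i
      have C: "compact (C i)" "C i \<subseteq> D i" for i
        using S \<kappa>(3,4) by (auto simp: C_def prod_domain_def intro!: compact_continuous_image continuous_intros)
      have "{z. \<eta> k z * dual_potential R I \<phi> z \<noteq> 0} \<subseteq> prod_domain C"
      proof safe
        fix z assume ne: "\<eta> k z * dual_potential R I \<phi> z \<noteq> 0"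
        then have "\<kappa> i k (z $ i) \<noteq> 0" if "i \<noteq> j" for i
          using that by (auto simp: \<eta>_def)
        then have 1: "z $ i \<in> C i" if "i \<noteq> j" for i
          using that \<kappa>(5) by (auto simp: C_def)
        \<comment> \<open>Otherwise the integrand of the dual potential would vanish
          identically.\<close>
        have "\<exists>\<xi>. \<phi> (z - embed I \<xi>) \<noteq> 0"
          using ne by (rule contrapos_np) (simp add: dual_potential_def)
        then obtain \<xi> where "z - embed I \<xi> \<in> S"
          unfolding S_def using closure_subset[of "{z. \<phi> z \<noteq> 0}"] by auto
        then have "(z - embed I \<xi>) $ j \<in> (\<lambda>z. z $ j) ` S" by (rule imageI)
        then have "z $ j \<in> C j" using j by (simp add: C_def)
        with 1 show "z \<in> prod_domain C" by (auto simp: prod_domain_def) metis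
      qed
      then have cl: "closure {z. \<eta> k z * dual_potential R I \<phi> z \<noteq> 0} \<subseteq> prod_domain C"
        by (rule closure_minimal) (intro compact_imp_closed compact_prod_domain C)
      moreover have "prod_domain C \<subseteq> prod_domain D"
        using C(2) by (auto simp: prod_domain_def)
      moreover have "compact (closure {z. \<eta> k z * dual_potential R I \<phi> z \<noteq> 0})"
        using compact_prod_domain[where C = C, OF C(1)] cl
        by (meson bounded_subset closed_closure compact_eq_bounded_closed)
      ultimately show ?thesis
        using smooth_mult[OF sm smooth_dual_potential[OF s]] unfolding test_fun_def smooth_def by blast
    qed
  qed
qed

section \<open>Weak derivatives of the components of f\<close>

lemma form_comp_works:
  assumes "f \<in> space_B U" "I \<noteq> {}"
  shows "is_form_comp U f I (form_comp U f I)" "form_comp U f I absolutely_integrable_on U"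
proof -
  have "\<exists>g. is_form_comp U f I g \<and> g absolutely_integrable_on U"
    using assms by (simp add: space_B_def)
  from someI_ex[OF this] show "is_form_comp U f I (form_comp U f I)"
    "form_comp U f I absolutely_integrable_on U"
    unfolding form_comp_def by blast+
qed

text \<open>The singleton case, which \<open>is_form_comp\<close> treats by equality, is the case of
  the empty list, so both cases share one formula from here on.\<close>

lemma form_comp_integral:
  assumes "f \<in> space_B U" "I \<noteq> {}"
  shows "\<exists>i js. distinct (i # js) \<and> set (i # js) = I \<and>
    (\<forall>\<theta>. test_fun U \<theta> \<longrightarrow> (LINT z:U|lebesgue. form_comp U f I z * \<theta> z)
        = (-1) ^ length js * (LINT z:U|lebesgue. f i z * foldr dbar js \<theta> z))"
proof (cases "is_singleton I")
  case True
  then obtain a where "I = {a}" by (auto simp: is_singleton_def)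
  then show ?thesis
    using form_comp_works(1)[OF assms] True
    by (intro exI[of _ a] exI[of _ "[]"]) (simp add: is_form_comp_def)
next
  case False
  then obtain i js where "distinct (i # js)" "set (i # js) = I" "weak_dbar U js (f i) (form_comp U f I)"
    using form_comp_works(1)[OF assms] by (auto simp only: is_form_comp_def if_False)
  then show ?thesis unfolding weak_dbar_def by blast
qed

lemma test_fun_foldr_dbar: "test_fun U \<theta> \<Longrightarrow> test_fun U (foldr dbar js \<theta>)"
  by (induction js) (auto intro: test_fun_dbar)

text \<open>If the leading indices agree, partial derivatives commute. Otherwise pull k out of
  \<open>js\<close> and i out of \<open>ks\<close>: what remains is the same test function, and
  closedness swaps f_i with f_k.\<close>

lemma dbar_closed_integral_perm:
  assumes f: "dbar_closed_weakly U f" and \<theta>: "test_fun U \<theta>"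
    and d: "distinct (i # js)" "distinct (k # ks)" "set (i # js) = set (k # ks)"
  shows "(LINT z:U|lebesgue. f i z * foldr dbar js \<theta> z) = (LINT z:U|lebesgue. f k z * foldr dbar ks \<theta> z)"
proof (cases "i = k")
  case True
  then have "foldr dbar js \<theta> = foldr dbar ks \<theta>"
    using d by (intro foldr_dbar_perm test_fun_smooth[OF \<theta>]) auto
  then show ?thesis using True by simp
next
  case False
  let ?\<psi> = "foldr dbar (remove1 k js) \<theta>"
  have "foldr dbar js \<theta> = dbar k ?\<psi>"
    using False d by (intro foldr_dbar_remove1 test_fun_smooth[OF \<theta>]) auto
  moreover have "foldr dbar ks \<theta> = dbar i (foldr dbar (remove1 i ks) \<theta>)"
    using False d by (intro foldr_dbar_remove1 test_fun_smooth[OF \<theta>]) auto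
  moreover have "foldr dbar (remove1 i ks) \<theta> = ?\<psi>"
    using False d by (intro foldr_dbar_perm test_fun_smooth[OF \<theta>]) auto
  ultimately show ?thesis
    using f test_fun_foldr_dbar[OF \<theta>, of "remove1 k js"] by (simp add: dbar_closed_weakly_def)
qed

text \<open>Appending j to the enumeration chosen for I gives one of I + j, possibly different from
  the one chosen there; closedness reconciles them, and the extra derivative accounts for the
  sign.\<close>

lemma form_comp_insert:
  assumes f: "f \<in> space_B U" and I: "I \<noteq> {}" "j \<notin> I" and \<theta>: "test_fun U \<theta>"
  shows "(LINT z:U|lebesgue. form_comp U f I z * dbar j \<theta> z)
     = - (LINT z:U|lebesgue. form_comp U f (insert j I) z * \<theta> z)"
proof -
  obtain i js where 1: "distinct (i # js)" "set (i # js) = I"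
    "\<And>\<theta>. test_fun U \<theta> \<Longrightarrow> (LINT z:U|lebesgue. form_comp U f I z * \<theta> z)
        = (-1) ^ length js * (LINT z:U|lebesgue. f i z * foldr dbar js \<theta> z)"
    using form_comp_integral[OF f I(1)] by blast
  obtain k ks where 2: "distinct (k # ks)" "set (k # ks) = insert j I"
    "\<And>\<theta>. test_fun U \<theta> \<Longrightarrow> (LINT z:U|lebesgue. form_comp U f (insert j I) z * \<theta> z)
        = (-1) ^ length ks * (LINT z:U|lebesgue. f k z * foldr dbar ks \<theta> z)"
    using form_comp_integral[OF f insert_not_empty] by blast
  have "length (k # ks) = Suc (length (i # js))"
    using distinct_card[OF 1(1)] distinct_card[OF 2(1)] 1(2) 2(2) I(2) by simp
  then have len: "length ks = Suc (length js)" by simp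
  \<comment> \<open>\<open>foldr\<close> applies its last entry first, so
    \<open>dbar j \<theta>\<close> followed by \<open>js\<close> is the list
    \<open>js @ [j]\<close>.\<close>
  have "(LINT z:U|lebesgue. form_comp U f I z * dbar j \<theta> z)
      = (-1) ^ length js * (LINT z:U|lebesgue. f i z * foldr dbar (js @ [j]) \<theta> z)"
    using 1(3)[OF test_fun_dbar[OF \<theta>]] by simp
  also have "(LINT z:U|lebesgue. f i z * foldr dbar (js @ [j]) \<theta> z) = (LINT z:U|lebesgue. f k z * foldr dbar ks \<theta> z)"
    using f 1(1,2) 2(1,2) I(2) by (intro dbar_closed_integral_perm \<theta>) (auto simp: space_B_def)
  also have "(-1) ^ length js * \<dots> = - (LINT z:U|lebesgue. form_comp U f (insert j I) z * \<theta> z)"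
    using 2(3)[OF \<theta>] len by simp
  finally show ?thesis .
qed

lemma set_integral_borel_version:
  fixes g \<psi> :: "'a::euclidean_space \<Rightarrow> complex"
  assumes G: "integrable lborel G" "AE z in lborel. indicator U z *\<^sub>R g z = G z"
    and \<psi>: "\<psi> \<in> borel_measurable borel"
  shows "(LINT z:U|lebesgue. g z * \<psi> z) = (\<integral>z. G z * \<psi> z \<partial>lborel)"
proof -
  have m: "(\<lambda>z. G z * \<psi> z) \<in> borel_measurable lborel"
    using borel_measurable_integrable[OF G(1)] \<psi> by simp
  have ae: "AE z in lborel. G z * \<psi> z = indicator U z *\<^sub>R (g z * \<psi> z)"
    using G(2) by eventually_elim (metis mult_scaleR_left)
  have "(LINT z:U|lebesgue. g z * \<psi> z) = (\<integral>z. G z * \<psi> z \<partial>lebesgue)"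
    unfolding set_lebesgue_integral_def
  proof (rule integral_cong_AE)
    show m': "(\<lambda>z. G z * \<psi> z) \<in> borel_measurable lebesgue"
      using m by (rule measurable_completion)
    show "(\<lambda>z. indicator U z *\<^sub>R (g z * \<psi> z)) \<in> borel_measurable lebesgue"
      by (rule borel_measurable_completion_cong_AE[OF m' ae])
    show "AE z in lebesgue. indicator U z *\<^sub>R (g z * \<psi> z) = G z * \<psi> z"
      using AE_completion[OF ae] by eventually_elim simp
  qed
  also have "\<dots> = (\<integral>z. G z * \<psi> z \<partial>lborel)" by (rule integral_completion[OF m])
  finally show ?thesis .
qed

text \<open>\<open>form_comp_insert\<close> is applied to the cut-off dual potential, whose
  derivative is the cut-off dual potential of \<open>dbar j \<phi>\<close>. Dominated convergence
  then removes the cutoff on both sides.\<close>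

lemma form_comp_dual_potential:
  fixes \<phi> :: "complex ^ 'n::finite \<Rightarrow> complex"
  assumes D: "\<And>i. open (D i)" and f: "f \<in> space_B (prod_domain D)"
    and I: "I \<noteq> {}" "j \<notin> I" and \<phi>: "test_fun (prod_domain D) \<phi>"
    and G: "integrable lborel G" "AE z in lborel. indicator (prod_domain D) z *\<^sub>R form_comp (prod_domain D) f I z = G z"
    and H: "integrable lborel H" "AE z in lborel. indicator (prod_domain D) z *\<^sub>R form_comp (prod_domain D) f (insert j I) z = H z"
  shows "(\<integral>z. G z * dual_potential R I (dbar j \<phi>) z \<partial>lborel) = - (\<integral>z. H z * dual_potential R I \<phi> z \<partial>lborel)"
proof -
  let ?U = "prod_domain D"
  note s = test_fun_smooth[OF \<phi>] test_fun_bounded_support[OF \<phi>]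
  note t = test_fun_dbar[OF \<phi>, of j]
  note sd = test_fun_smooth[OF t] test_fun_bounded_support[OF t]
  obtain \<eta> :: "nat \<Rightarrow> complex ^ 'n \<Rightarrow> complex"
    where \<eta>: "\<And>k. smooth (\<eta> k)" "\<And>k z. norm (\<eta> k z) \<le> 1" "\<And>k z a. \<eta> k (z + axis j a) = \<eta> k z"
      "\<And>z. z \<in> ?U \<Longrightarrow> (\<lambda>k. \<eta> k z) \<longlonglongrightarrow> 1"
      "\<And>k. test_fun ?U (\<lambda>z. \<eta> k z * dual_potential R I \<phi> z)"
    using cutoff_dual_potential[OF D \<phi> I(2), of R] by blast
  have m: "\<eta> k \<in> borel_measurable borel" "dual_potential R I \<phi> \<in> borel_measurable borel"
    "dual_potential R I (dbar j \<phi>) \<in> borel_measurable borel" for k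
    by (intro borel_measurable_continuous_onI smooth_continuous \<eta> smooth_dual_potential s sd)+
  \<comment> \<open>Used twice: for G with \<open>dbar j \<phi>\<close> and for H with \<phi>. The
    dominating function is |F| times a uniform bound of the dual potential.\<close>
  have lim: "(\<lambda>k. \<integral>z. F z * (\<eta> k z * dual_potential R I \<psi> z) \<partial>lborel)
      \<longlonglongrightarrow> (\<integral>z. F z * dual_potential R I \<psi> z \<partial>lborel)"
    if F: "integrable lborel F" "AE z in lborel. indicator ?U z *\<^sub>R g z = F z" and \<psi>: "test_fun ?U \<psi>" for F g \<psi>
  proof -
    note c = smooth_continuous[OF test_fun_smooth[OF \<psi>]] test_fun_bounded_support[OF \<psi>]
    obtain B where B: "\<And>z. norm (\<psi> z) \<le> B" using bounded_support_bounded[OF c] by metis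
    define M where "M = (\<integral>\<xi>. norm (multi_kernel R I \<xi>) \<partial>lborel_pow I) * B"
    have M: "norm (dual_potential R I \<psi> z) \<le> M" for z
      unfolding M_def by (rule norm_dual_potential_le[OF c B])
    have [measurable]: "dual_potential R I \<psi> \<in> borel_measurable borel" "F \<in> borel_measurable borel"
      using borel_measurable_integrable[OF F(1)]
      by (auto intro!: borel_measurable_continuous_onI smooth_continuous smooth_dual_potential test_fun_smooth[OF \<psi>] c(2))
    note m(1)[measurable]
    show ?thesis
    proof (rule integral_dominated_convergence)
      show "integrable lborel (\<lambda>z. norm (F z) * M)" using F(1) by simp
      show "AE z in lborel. (\<lambda>k. F z * (\<eta> k z * dual_potential R I \<psi> z)) \<longlonglongrightarrow> F z * dual_potential R I \<psi> z"
        using F(2)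
      proof eventually_elim
        fix z assume z: "indicator ?U z *\<^sub>R g z = F z"
        show "(\<lambda>k. F z * (\<eta> k z * dual_potential R I \<psi> z)) \<longlonglongrightarrow> F z * dual_potential R I \<psi> z"
        proof (cases "z \<in> ?U")
          case True
          have "(\<lambda>k. F z * (\<eta> k z * dual_potential R I \<psi> z)) \<longlonglongrightarrow> F z * (1 * dual_potential R I \<psi> z)"
            by (intro tendsto_mult tendsto_const \<eta>(4) True)
          then show ?thesis by simp
        qed (use z in simp)
      qed
      show "AE z in lborel. norm (F z * (\<eta> k z * dual_potential R I \<psi> z)) \<le> norm (F z) * M" for k
      proof (rule AE_I2)
        fix z
        have "norm (\<eta> k z) * norm (dual_potential R I \<psi> z) \<le> 1 * M"
          by (intro mult_mono \<eta>(2) M) auto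
        then show "norm (F z * (\<eta> k z * dual_potential R I \<psi> z)) \<le> norm (F z) * M"
          unfolding norm_mult by (intro mult_left_mono) auto
      qed
    qed measurable
  qed
  have eq: "(\<integral>z. G z * (\<eta> k z * dual_potential R I (dbar j \<phi>) z) \<partial>lborel)
      = - (\<integral>z. H z * (\<eta> k z * dual_potential R I \<phi> z) \<partial>lborel)" for k
  proof -
    let ?\<theta> = "\<lambda>z. \<eta> k z * dual_potential R I \<phi> z"
    have d: "dbar j ?\<theta> = (\<lambda>z. \<eta> k z * dual_potential R I (dbar j \<phi>) z)"
      using dbar_mult_invariant[OF \<eta>(1) smooth_dual_potential[OF s] \<eta>(3)]
      by (intro ext) (simp add: dbar_dual_potential[OF s])
    have "(LINT z:?U|lebesgue. form_comp ?U f I z * dbar j ?\<theta> z)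
       = - (LINT z:?U|lebesgue. form_comp ?U f (insert j I) z * ?\<theta> z)"
      by (rule form_comp_insert[OF f I \<eta>(5)])
    then show ?thesis
      unfolding d using m
      by (subst (asm) set_integral_borel_version[OF G], simp)
        (subst (asm) set_integral_borel_version[OF H], simp_all)
  qed
  have "(\<lambda>k. \<integral>z. G z * (\<eta> k z * dual_potential R I (dbar j \<phi>) z) \<partial>lborel)
      \<longlonglongrightarrow> - (\<integral>z. H z * dual_potential R I \<phi> z \<partial>lborel)"
    unfolding eq by (intro tendsto_minus lim[OF H \<phi>])
  with lim[OF G t] show ?thesis by (rule LIMSEQ_unique)
qed

text \<open>The sets not containing j are paired with their unions with {j}; only {j} has no
  partner, the empty set being excluded.\<close>

lemma sum_nonempty_subsets_telescope:
  fixes a :: "'n::finite set \<Rightarrow> 'b::ab_group_add"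
  assumes "\<And>I. I \<noteq> {} \<Longrightarrow> j \<notin> I \<Longrightarrow> a (insert j I) = - a I"
  shows "(\<Sum>I | I \<noteq> {}. a I) = a {j}"
proof -
  let ?A = "{I. I \<noteq> {} \<and> j \<notin> I}"
  have inj: "inj_on (insert j) ?A"
    by (auto simp: inj_on_def)
  have split: "{I. I \<noteq> {}} = insert {j} (?A \<union> insert j ` ?A)"
  proof (intro equalityI subsetI)
    fix I assume I: "I \<in> {I::'n set. I \<noteq> {}}"
    show "I \<in> insert {j} (?A \<union> insert j ` ?A)"
    proof (cases "j \<in> I \<and> I \<noteq> {j}")
      case True
      then have "I = insert j (I - {j})" "I - {j} \<in> ?A" by auto
      then show ?thesis by blast
    qed (use I in auto)
  qed auto
  have "(\<Sum>I | I \<noteq> {}. a I) = a {j} + (\<Sum>I\<in>?A \<union> insert j ` ?A. a I)"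
    unfolding split by (rule sum.insert) auto
  also have "(\<Sum>I\<in>?A \<union> insert j ` ?A. a I) = (\<Sum>I\<in>?A. a I) + (\<Sum>I\<in>insert j ` ?A. a I)"
    by (rule sum.union_disjoint) auto
  also have "(\<Sum>I\<in>insert j ` ?A. a I) = (\<Sum>I\<in>?A. - a I)"
    unfolding sum.reindex[OF inj] using assms by (intro sum.cong) auto
  finally show ?thesis by (simp add: sum_negf)
qed

lemma bounded_prod_domain_diameter:
  fixes D :: "'n::finite \<Rightarrow> complex set"
  assumes "bounded (prod_domain D)" "\<And>i. D i \<noteq> {}"
  obtains R where "\<And>i z w. z \<in> D i \<Longrightarrow> w \<in> D i \<Longrightarrow> norm (z - w) \<le> R"
proof -
  obtain B where B: "\<And>z. z \<in> prod_domain D \<Longrightarrow> norm z \<le> B"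
    using assms(1) by (auto simp: bounded_iff)
  have "norm z \<le> B" if "z \<in> D i" for i z
  proof -
    \<comment> \<open>The bound is known for points of the product, so a point of one factor is
      completed by arbitrary points of the other, nonempty, factors.\<close>
    define p where "p = (\<chi> l. if l = i then z else (SOME x. x \<in> D l))"
    have "p \<in> prod_domain D"
      using that assms(2) by (auto simp: p_def prod_domain_def some_in_eq)
    from order_trans[OF Finite_Cartesian_Product.norm_nth_le B[OF this], of i]
    show ?thesis by (simp add: p_def)
  qed
  then have "norm (z - w) \<le> B + B" if "z \<in> D i" "w \<in> D i" for i z w
    using that by (intro order_trans[OF norm_triangle_ineq4] add_mono)
  then show ?thesis by (rule that)
qed

theorem theorem0p3:
  fixes D :: "'n::finite \<Rightarrow> complex set" and f :: "'n form01"
  assumes "\<And>j. pw_C1_domain (D j)"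
    and "bounded (prod_domain D)"
    and "f \<in> space_B (prod_domain D)"
  shows "dbar_eq_weakly (prod_domain D) (T_op D f) f"
proof -
  let ?U = "prod_domain D" and ?F = "form_comp (prod_domain D) f"
  have D: "open (D i)" "D i \<noteq> {}" for i using assms(1) by (auto simp: pw_C1_domain_def)
  obtain R where R: "\<And>i z w. z \<in> D i \<Longrightarrow> w \<in> D i \<Longrightarrow> norm (z - w) \<le> R"
    using bounded_prod_domain_diameter[OF assms(2) D(2)] by metis
  have "\<exists>G. integrable lborel G \<and> (AE z in lborel. indicator ?U z *\<^sub>R ?F I z = G z)" if "I \<noteq> {}" for I
    using absolutely_integrable_borel_version[OF form_comp_works(2)[OF assms(3) that]] by metis
  then obtain G where G: "\<And>I. I \<noteq> {} \<Longrightarrow> integrable lborel (G I)"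
    "\<And>I. I \<noteq> {} \<Longrightarrow> AE z in lborel. indicator ?U z *\<^sub>R ?F I z = G I z"
    by metis
  \<comment> \<open>A globally integrable representative of T f built from Borel data; it agrees
    with \<open>T_op D f\<close> almost everywhere on D.\<close>
  define P where "P z = - (\<Sum>I | I \<noteq> {}. potential R I (G I) z)" for z
  have P: "integrable lborel P"
    unfolding P_def by (intro Bochner_Integration.integrable_minus Bochner_Integration.integrable_sum integrable_potential G(1)) simp
  have "AE z in lborel. \<forall>I\<in>{I. I \<noteq> {}}. z \<in> ?U \<longrightarrow> cauchy_transform D I (?F I) z = potential R I (G I) z"
    by (intro AE_finite_allI cauchy_transform_eq_potential[OF G R]) auto
  then have TP: "AE z in lborel. z \<in> ?U \<longrightarrow> T_op D f z = P z"
    by eventually_elim (simp add: T_op_def P_def)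
  have U: "?U \<in> sets borel"
    unfolding prod_domain_def
    using D(1) by (intro borel_open open_vector_box) simp
  have loc: "locally_L1 ?U (T_op D f)"
    unfolding locally_L1_def set_integrable_def
  proof (intro allI impI)
    fix K assume K: "compact K \<and> K \<subseteq> ?U"
    then have "K \<in> sets borel" by (simp add: borel_compact)
    then have "integrable lborel (\<lambda>z. indicator K z *\<^sub>R P z)"
      using P by (intro integrable_mult_indicator) auto
    then have KP: "integrable lebesgue (\<lambda>z. indicator K z *\<^sub>R P z)"
      by (subst integrable_completion) auto
    have ae: "AE z in lborel. indicator K z *\<^sub>R P z = indicator K z *\<^sub>R T_op D f z"
      using TP by eventually_elim (use K in \<open>auto split: split_indicator\<close>)
    show "integrable lebesgue (\<lambda>z. indicator K z *\<^sub>R T_op D f z)"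
      by (rule integrable_cong_AE_imp[OF KP])
        (use borel_measurable_completion_cong_AE[OF borel_measurable_integrable[OF KP] ae] AE_completion[OF ae]
          in \<open>auto elim: eventually_mono\<close>)
  qed
  show ?thesis
    unfolding dbar_eq_weakly_def
  proof
    fix j
    have "(LINT z:?U|lebesgue. f j z * \<phi> z) = - (LINT z:?U|lebesgue. T_op D f z * dbar j \<phi> z)"
      if \<phi>: "test_fun ?U \<phi>" for \<phi>
    proof -
      note t = test_fun_dbar[OF \<phi>, of j]
      have c: "continuous_on UNIV \<phi>" "continuous_on UNIV (dbar j \<phi>)"
        by (intro smooth_continuous test_fun_smooth[OF \<phi>] test_fun_smooth[OF t])+
      obtain B where B: "\<And>z. norm (dbar j \<phi> z) \<le> B"
        using bounded_support_bounded[OF c(2) test_fun_bounded_support[OF t]] by metis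
      have m: "\<phi> \<in> borel_measurable borel" "dbar j \<phi> \<in> borel_measurable borel"
        using c by (auto intro: borel_measurable_continuous_onI)
      define a where "a I = (\<integral>w. G I w * dual_potential R I (dbar j \<phi>) w \<partial>lborel)" for I
      have ins: "a (insert j I) = (\<integral>w. G (insert j I) w * dual_potential R I \<phi> w \<partial>lborel)" if "j \<notin> I" for I
        unfolding a_def
      proof (rule integral_cong_AE)
        have mG: "G (insert j I) \<in> borel_measurable borel"
          using borel_measurable_integrable[OF G(1)[of "insert j I"]] by simp
        have "smooth (dual_potential R I \<phi>)" "smooth (dual_potential R (insert j I) (dbar j \<phi>))"
          by (intro smooth_dual_potential test_fun_smooth[OF \<phi>] test_fun_smooth[OF t]
              test_fun_bounded_support[OF \<phi>] test_fun_bounded_support[OF t])+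
        from this[THEN smooth_continuous, THEN borel_measurable_continuous_onI] mG
        show "(\<lambda>w. G (insert j I) w * dual_potential R (insert j I) (dbar j \<phi>) w) \<in> borel_measurable lborel"
          "(\<lambda>w. G (insert j I) w * dual_potential R I \<phi> w) \<in> borel_measurable lborel"
          by simp_all
        show "AE w in lborel. G (insert j I) w * dual_potential R (insert j I) (dbar j \<phi>) w
            = G (insert j I) w * dual_potential R I \<phi> w"
          using G(2)[OF insert_not_empty, of j I]
        proof eventually_elim
          fix w assume w: "indicator ?U w *\<^sub>R ?F (insert j I) w = G (insert j I) w"
          show "G (insert j I) w * dual_potential R (insert j I) (dbar j \<phi>) w
            = G (insert j I) w * dual_potential R I \<phi> w"
          proof (cases "w \<in> ?U")
            case True
            then show ?thesis using dual_potential_insert_dbar[OF \<phi> that True R] by simp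
          qed (use w in simp)
        qed
      qed
      have "a (insert j I) = - a I" if "I \<noteq> {}" "j \<notin> I" for I
        using form_comp_dual_potential[OF D(1) assms(3) that \<phi> G(1)[OF that(1)] G(2)[OF that(1)]
            G(1)[OF insert_not_empty] G(2)[OF insert_not_empty]] ins[OF that(2)]
        by (simp add: a_def)
      then have tel: "(\<Sum>I | I \<noteq> {}. a I) = a {j}" by (rule sum_nonempty_subsets_telescope)
      have int: "integrable lborel (\<lambda>z. potential R I (G I) z * dbar j \<phi> z)" if "I \<noteq> {}" for I
      proof (rule Bochner_Integration.integrable_bound)
        show "integrable lborel (\<lambda>z. B *\<^sub>R potential R I (G I) z)"
          using integrable_potential[OF G(1)[OF that]] by simp
        show "(\<lambda>z. potential R I (G I) z * dbar j \<phi> z) \<in> borel_measurable lborel"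
          using borel_measurable_integrable[OF integrable_potential[OF G(1)[OF that]]] m(2) by simp
        show "AE z in lborel. norm (potential R I (G I) z * dbar j \<phi> z) \<le> norm (B *\<^sub>R potential R I (G I) z)"
          using B order_trans[OF norm_ge_zero B]
          by (intro AE_I2) (auto simp: norm_mult mult.commute[of "norm (potential _ _ _ _)"] intro!: mult_right_mono)
      qed
      \<comment> \<open>P need not vanish off D, and its agreement with T f is known on D only; the
        indicator handles both.\<close>
      have IP: "integrable lborel (\<lambda>z. indicator ?U z *\<^sub>R P z)"
        using P U by (intro integrable_mult_indicator) auto
      have "AE z in lborel. indicator ?U z *\<^sub>R T_op D f z = indicator ?U z *\<^sub>R P z"
        using TP by eventually_elim (auto split: split_indicator)
      then have "(LINT z:?U|lebesgue. T_op D f z * dbar j \<phi> z) = (\<integral>z. (indicator ?U z *\<^sub>R P z) * dbar j \<phi> z \<partial>lborel)"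
        by (rule set_integral_borel_version[OF IP _ m(2)])
      also have "\<dots> = (\<integral>z. - (\<Sum>I | I \<noteq> {}. potential R I (G I) z * dbar j \<phi> z) \<partial>lborel)"
        using test_fun_outside[OF t]
        by (intro Bochner_Integration.integral_cong refl) (auto simp: P_def sum_distrib_right split: split_indicator)
      also have "\<dots> = - (\<Sum>I | I \<noteq> {}. \<integral>z. potential R I (G I) z * dbar j \<phi> z \<partial>lborel)"
        using int by simp
      also have "(\<Sum>I | I \<noteq> {}. \<integral>z. potential R I (G I) z * dbar j \<phi> z \<partial>lborel) = (\<Sum>I | I \<noteq> {}. a I)"
        unfolding a_def by (intro sum.cong refl potential_duality[OF G(1) m(2) B]) simp
      also have "(\<Sum>I | I \<noteq> {}. a I) = (\<integral>w. G {j} w * \<phi> w \<partial>lborel)"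
        using tel ins[of "{}"] by (simp add: dual_potential_empty)
      also have "\<dots> = (LINT z:?U|lebesgue. ?F {j} z * \<phi> z)"
        by (rule set_integral_borel_version[OF G m(1), symmetric]) auto
      \<comment> \<open>An equality of functions rather than an almost everywhere one, since
        \<open>is_form_comp\<close> prescribes the component of a singleton exactly.\<close>
      also have "?F {j} = f j"
        using form_comp_works(1)[OF assms(3), of "{j}"] by (simp add: is_form_comp_def)
      finally show ?thesis by simp
    qed
    moreover have "locally_L1 ?U (f j)"
      using assms(3) by (auto simp: space_B_def dbar_closed_weakly_def)
    ultimately show "weak_dbar ?U [j] (T_op D f) (f j)"
      using loc by (simp add: weak_dbar_def)
  qed
qed

end
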